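(* Let $X=\{0,1\}^{\mathbb N}$. There exist a computable map $T:X\to X$ and a $T$-invariant closed subset $A\subset X$ with the following properties: (i) $A$ is $\Pi_1$-complete. (ii) $A$ is the topological attractor of $T$, and the metric attractor of $T$ with respect to any reference measure $\lambda$ which is shift-ergodic and of full support. Moreover, the dynamics of $T$ on $A$ is a topologically mixing shift of positive entropy (that is, $A$ is a subshift, $T$ coincides with the shift map on $A$, and this shift is topologically mixing with positive topological entropy). (iii) $A$ is strongly attracting, and its realm of attraction is the whole space: $\omega(x)\subset A$ for all $x\in X$. (iv) $A$ is the statistical attractor of $T$ with respect to any reference measure $\lambda$ which is shift-ergodic and of full support. In particular, the unique physical measure of the system is non computable.
   Context: **Symbolic space.** On $X=\mathcal A^{\mathbb N}$, $\mathcal A$ a finite alphabet, the distance is $d(x,y)=2^{-\min\{n:x_n\ne y_n\}}$; the ideal points are the eventually constant sequences $w0^\infty$, $w\in\mathcal A^*$ (with $0\in\mathcal A$ a fixed letter). The ideal balls are the open balls with ideal center and positive rational radius (they are cylinders); $(B_i)_{i\in\mathbb N}$ is a fixed computable enumeration of them, and $\overline{B_i}$ is the closed ball with the same center and radius. A map $T:X\to X$ is computable iff there are a non-decreasing computable function $\varphi:\mathbb N\to\mathbb N$ and an algorithm which, given the first $\varphi(n)$ symbols of $x$, computes the first $n$ symbols of $T(x)$. The shift is $\sigma(x)_i=x_{i+1}$; a subshift is a closed shift-invariant subset. A measure is shift-ergodic if it is a $\sigma$-invariant and $\sigma$-ergodic Borel probability measure. A Borel probability measure $\mu$ on $X$ is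 computable iff there is an algorithm which on input $i_1,\dots,i_n$ and $k$ outputs a rational number whose supremum over $k$ equals $\mu(B_{i_1}\cup\dots\cup B_{i_n})$. **Complexity of closed sets.** A compact set $K$ is $\Pi_n$ if its outer collection $\{i:\overline{B_i}\cap K=\emptyset\}$ is a $\Sigma_n$ set of integers (arithmetical hierarchy). $K$ is $\Pi_n$-complete if it is $\Pi_n$ and any other $\Pi_n$ compact set $K'$ can be reduced to $K$, in the sense that, provided with an enumeration of the outer collection of $K$, we can (algorithmically) enumerate the outer collection of $K'$. **Attractors.** $\omega(x)$ is the set of accumulation points of $x,T(x),T^2(x),\dots$. For a closed set $A$, its realm of attraction is $\rho(A)=\{x:\omega(x)\subset A\}$. A set is generic if it contains a countable intersection of open dense sets; meager sets are complements of generic sets. A closed set $A$ is a metric attractor (with respect to a reference measure $\lambda$) if $\rho(A)$ has full $\lambda$-measure and no strictly smaller closed $A'\subset A$ has $\lambda(\rho(A'))>0$. It is a topological attractor if $\rho(A)$ is generic and no strictly smaller closed $A'\subset A$ has $\rho(A')$ non-meager. $\nu_x$ denotes the weak* limit of $\frac1n\sum_{i<n}\delta_{T^i(x)}$ when it exists. A closed set $A$ is a statistical attractor (with respect to $\lambda$) if there is a unique $T$-invariant probability measure $\mu$ such that $\mathrm{supp}(\mu)=A$ and $\nu_x=\mu$ for $\lambda$-almost every $x$; this $\mu$ is called the physical measure. An attractor $A$ is strongly attracting if there is an open neighbourhood $U$ of $A$ with $T(\overline U)\subset U$ and $A=\bigcap_n T^n(U)$. *)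

theory Defs
  imports "HOL-Probability.Probability"
begin

section \<open>Computability\<close>

text \<open>
  Partial recursive programs relative to an oracle, acting on lists of natural numbers.
  The judgement \<open>run f p xs y\<close> means that program \<open>p\<close> with oracle \<open>f\<close> halts on the arguments
  \<open>xs\<close> with output \<open>y\<close>. Plain computability is computability with the zero oracle.
\<close>

datatype prog =
    Zero
  | Succ
  | Proj nat
  | Oracle
  | Comp prog "prog list"
  | PrimRec prog prog
  | Mu prog

inductive run :: "(nat \<Rightarrow> nat) \<Rightarrow> prog \<Rightarrow> nat list \<Rightarrow> nat \<Rightarrow> bool" for f where
  run_Zero: "run f Zero xs 0"
| run_Succ: "run f Succ (x # xs) (Suc x)"
| run_Proj: "i < length xs \<Longrightarrow> run f (Proj i) xs (xs ! i)"
| run_Oracle: "run f Oracle (x # xs) (f x)"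
| run_Comp: "list_all2 (\<lambda>q y. run f q xs y) qs ys \<Longrightarrow> run f p ys z \<Longrightarrow> run f (Comp p qs) xs z"
| run_PrimRec_0: "run f p xs y \<Longrightarrow> run f (PrimRec p q) (0 # xs) y"
| run_PrimRec_Suc:
    "run f (PrimRec p q) (n # xs) y \<Longrightarrow> run f q (y # n # xs) z
      \<Longrightarrow> run f (PrimRec p q) (Suc n # xs) z"
| run_Mu:
    "run f p (n # xs) 0 \<Longrightarrow> (\<And>m. m < n \<Longrightarrow> \<exists>y. run f p (m # xs) (Suc y)) \<Longrightarrow> run f (Mu p) xs n"

abbreviation run0 :: "prog \<Rightarrow> nat list \<Rightarrow> nat \<Rightarrow> bool" where
  "run0 \<equiv> run (\<lambda>_. 0)"

definition computable_fun :: "(nat \<Rightarrow> nat) \<Rightarrow> bool" where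
  "computable_fun g \<longleftrightarrow> (\<exists>p. \<forall>n. run0 p [n] (g n))"

definition computable_fun2 :: "(nat \<Rightarrow> nat \<Rightarrow> nat) \<Rightarrow> bool" where
  "computable_fun2 g \<longleftrightarrow> (\<exists>p. \<forall>m n. run0 p [m, n] (g m n))"

definition decidable :: "nat set \<Rightarrow> bool" where
  "decidable S \<longleftrightarrow> computable_fun (\<lambda>i. of_bool (i \<in> S))"

text \<open>The class \<open>\<Sigma>\<^sub>n\<close> of the arithmetical hierarchy; \<open>R\<close> below is a \<open>\<Pi>\<^sub>n\<close> relation.\<close>

primrec arith_Sigma :: "nat \<Rightarrow> nat set \<Rightarrow> bool" where
  "arith_Sigma 0 S \<longleftrightarrow> decidable S"
| "arith_Sigma (Suc n) S \<longleftrightarrow>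
     (\<exists>R. arith_Sigma n (- R) \<and> S = {i. \<exists>j. prod_encode (i, j) \<in> R})"

text \<open>
  An enumeration may output \<open>0\<close> to list nothing at that step, and \<open>i + 1\<close> to list \<open>i\<close>;
  in this way the empty set has an enumeration too.
\<close>

definition enumerates :: "(nat \<Rightarrow> nat) \<Rightarrow> nat set \<Rightarrow> bool" where
  "enumerates g S \<longleftrightarrow> S = {i. \<exists>n. g n = Suc i}"


section \<open>Symbolic space\<close>

text \<open>
  The library topology on \<open>nat \<Rightarrow> bool\<close> is the product of the discrete topologies, which is the
  one induced by \<open>seq_dist\<close>; the letter \<open>0\<close> is \<open>False\<close>.
\<close>

type_synonym binseq = "nat \<Rightarrow> bool"

definition seq_dist :: "binseq \<Rightarrow> binseq \<Rightarrow> real" where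
  "seq_dist x y = (if x = y then 0 else (1 / 2) ^ (LEAST n. x n \<noteq> y n))"

definition shift_map :: "binseq \<Rightarrow> binseq" where
  "shift_map x = (\<lambda>i. x (Suc i))"

definition subshift :: "binseq set \<Rightarrow> bool" where
  "subshift A \<longleftrightarrow> closed A \<and> shift_map ` A \<subseteq> A"

definition ideal_point :: "bool list \<Rightarrow> binseq" where
  "ideal_point w = (\<lambda>n. n < length w \<and> w ! n)"

text \<open>
  Index \<open>i\<close> codes a pair (center, radius): the center is the word \<open>w\<close> followed by zeros, where
  \<open>w\<close> is read off modulo 2 from a coded list of naturals, and the radius is \<open>(a + 1) / (b + 1)\<close>.
\<close>

definition ball_center :: "nat \<Rightarrow> binseq" where
  "ball_center i = ideal_point (map odd (list_decode (fst (prod_decode i))))"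

definition ball_radius :: "nat \<Rightarrow> real" where
  "ball_radius i = (case prod_decode (snd (prod_decode i)) of (a, b) \<Rightarrow> real (a + 1) / real (b + 1))"

definition ideal_ball :: "nat \<Rightarrow> binseq set" where
  "ideal_ball i = {x. seq_dist (ball_center i) x < ball_radius i}"

definition ideal_cball :: "nat \<Rightarrow> binseq set" where
  "ideal_cball i = {x. seq_dist (ball_center i) x \<le> ball_radius i}"

definition initial_word :: "binseq \<Rightarrow> nat \<Rightarrow> nat" where
  "initial_word x n = list_encode (map (\<lambda>i. of_bool (x i)) [0..<n])"

text \<open>The algorithm is also told the requested number \<open>n\<close> of output symbols.\<close>

definition computable_map :: "(binseq \<Rightarrow> binseq) \<Rightarrow> bool" where
  "computable_map T \<longleftrightarrow>
     (\<exists>\<phi>. mono \<phi> \<and> computable_fun \<phi> \<and>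
       (\<exists>p. \<forall>x n. run0 p [n, initial_word x (\<phi> n)] (initial_word (T x) n)))"


section \<open>Complexity of compact sets\<close>

definition outer_collection :: "binseq set \<Rightarrow> nat set" where
  "outer_collection K = {i. ideal_cball i \<inter> K = {}}"

definition Pi_compact :: "nat \<Rightarrow> binseq set \<Rightarrow> bool" where
  "Pi_compact n K \<longleftrightarrow> compact K \<and> arith_Sigma n (outer_collection K)"

text \<open>
  One program turns every enumeration of the outer collection of \<open>K\<close>, given as an oracle, into an
  enumeration of the outer collection of \<open>K'\<close>.
\<close>

definition reducible_compact :: "binseq set \<Rightarrow> binseq set \<Rightarrow> bool" where
  "reducible_compact K' K \<longleftrightarrow>
     (\<exists>p. \<forall>f. enumerates f (outer_collection K) \<longrightarrow>
       (\<exists>g. (\<forall>n. run f p [n] (g n)) \<and> enumerates g (outer_collection K')))"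

definition Pi_complete :: "nat \<Rightarrow> binseq set \<Rightarrow> bool" where
  "Pi_complete n K \<longleftrightarrow>
     Pi_compact n K \<and> (\<forall>K'. Pi_compact n K' \<longrightarrow> reducible_compact K' K)"


section \<open>Measures\<close>

definition borel_prob :: "binseq measure \<Rightarrow> bool" where
  "borel_prob \<mu> \<longleftrightarrow> prob_space \<mu> \<and> sets \<mu> = sets borel"

definition invariant_measure :: "(binseq \<Rightarrow> binseq) \<Rightarrow> binseq measure \<Rightarrow> bool" where
  "invariant_measure T \<mu> \<longleftrightarrow> borel_prob \<mu> \<and> T \<in> borel_measurable borel \<and> distr \<mu> borel T = \<mu>"

definition shift_ergodic :: "binseq measure \<Rightarrow> bool" where
  "shift_ergodic \<mu> \<longleftrightarrow> invariant_measure shift_map \<mu> \<and>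
     (\<forall>S\<in>sets borel. shift_map -` S = S \<longrightarrow> measure \<mu> S = 0 \<or> measure \<mu> S = 1)"

definition supp :: "binseq measure \<Rightarrow> binseq set" where
  "supp \<mu> = {x. \<forall>U. open U \<longrightarrow> x \<in> U \<longrightarrow> emeasure \<mu> U > 0}"

text \<open>
  The supremum is taken in the extended reals, so that unboundedness is not an issue; the
  output of the algorithm is read as a rational number through \<open>nat_to_rat_surj\<close>.
\<close>

definition computable_measure :: "binseq measure \<Rightarrow> bool" where
  "computable_measure \<mu> \<longleftrightarrow>
     (\<exists>q. computable_fun2 q \<and>
       (\<forall>is. (SUP k. ereal (real_of_rat (nat_to_rat_surj (q (list_encode is) k))))
              = ereal (measure \<mu> (\<Union>i\<in>set is. ideal_ball i))))"

definition empirical_measure :: "(binseq \<Rightarrow> binseq) \<Rightarrow> binseq \<Rightarrow> nat \<Rightarrow> binseq measure" where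
  "empirical_measure T x n = distr (uniform_count_measure {..<n}) borel (\<lambda>i. (T ^^ i) x)"

definition weak_star_limit :: "(nat \<Rightarrow> binseq measure) \<Rightarrow> binseq measure \<Rightarrow> bool" where
  "weak_star_limit M \<mu> \<longleftrightarrow>
     (\<forall>f :: binseq \<Rightarrow> real. continuous_on UNIV f \<longrightarrow>
        (\<lambda>n. integral\<^sup>L (M n) f) \<longlonglongrightarrow> integral\<^sup>L \<mu> f)"


section \<open>Attractors\<close>

definition omega_limit :: "(binseq \<Rightarrow> binseq) \<Rightarrow> binseq \<Rightarrow> binseq set" where
  "omega_limit T x = {y. \<forall>U. open U \<longrightarrow> y \<in> U \<longrightarrow> (\<exists>\<^sub>\<infinity>n. (T ^^ n) x \<in> U)}"

definition realm :: "(binseq \<Rightarrow> binseq) \<Rightarrow> binseq set \<Rightarrow> binseq set" where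
  "realm T A = {x. omega_limit T x \<subseteq> A}"

definition generic :: "binseq set \<Rightarrow> bool" where
  "generic S \<longleftrightarrow> (\<exists>\<G>. countable \<G> \<and> (\<forall>U\<in>\<G>. open U \<and> closure U = UNIV) \<and> \<Inter>\<G> \<subseteq> S)"

definition meager :: "binseq set \<Rightarrow> bool" where
  "meager S \<longleftrightarrow> generic (- S)"

definition topological_attractor :: "(binseq \<Rightarrow> binseq) \<Rightarrow> binseq set \<Rightarrow> bool" where
  "topological_attractor T A \<longleftrightarrow>
     closed A \<and> generic (realm T A) \<and> \<not> (\<exists>A'. closed A' \<and> A' \<subset> A \<and> \<not> meager (realm T A'))"

text \<open>
  Positive measure of a realm is expressed as the failure of being a null set, because
  \<open>emeasure\<close> is \<open>0\<close> on nonmeasurable sets; for continuous \<open>T\<close> and closed \<open>A'\<close> the realm is Borel.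
\<close>

definition metric_attractor ::
    "(binseq \<Rightarrow> binseq) \<Rightarrow> binseq measure \<Rightarrow> binseq set \<Rightarrow> bool" where
  "metric_attractor T lam A \<longleftrightarrow>
     closed A \<and> (AE x in lam. x \<in> realm T A) \<and>
     \<not> (\<exists>A'. closed A' \<and> A' \<subset> A \<and> \<not> (AE x in lam. x \<notin> realm T A'))"

definition physical_measure ::
    "(binseq \<Rightarrow> binseq) \<Rightarrow> binseq measure \<Rightarrow> binseq set \<Rightarrow> binseq measure \<Rightarrow> bool" where
  "physical_measure T lam A \<mu> \<longleftrightarrow>
     invariant_measure T \<mu> \<and> supp \<mu> = A \<and>
     (AE x in lam. weak_star_limit (empirical_measure T x) \<mu>)"

definition statistical_attractor ::
    "(binseq \<Rightarrow> binseq) \<Rightarrow> binseq measure \<Rightarrow> binseq set \<Rightarrow> bool" where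
  "statistical_attractor T lam A \<longleftrightarrow> closed A \<and> (\<exists>!\<mu>. physical_measure T lam A \<mu>)"

definition strongly_attracting :: "(binseq \<Rightarrow> binseq) \<Rightarrow> binseq set \<Rightarrow> bool" where
  "strongly_attracting T A \<longleftrightarrow>
     (\<exists>U. open U \<and> A \<subseteq> U \<and> T ` closure U \<subseteq> U \<and> A = (\<Inter>n. (T ^^ n) ` U))"


section \<open>Mixing and entropy\<close>

definition topologically_mixing_on :: "(binseq \<Rightarrow> binseq) \<Rightarrow> binseq set \<Rightarrow> bool" where
  "topologically_mixing_on T A \<longleftrightarrow>
     (\<forall>U V. open U \<longrightarrow> open V \<longrightarrow> U \<inter> A \<noteq> {} \<longrightarrow> V \<inter> A \<noteq> {} \<longrightarrow>
        (\<exists>N. \<forall>n\<ge>N. (T ^^ n) ` (U \<inter> A) \<inter> (V \<inter> A) \<noteq> {}))"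

text \<open>Bowen's definition of topological entropy, through separated sets.\<close>

definition separated ::
    "(binseq \<Rightarrow> binseq) \<Rightarrow> nat \<Rightarrow> real \<Rightarrow> binseq set \<Rightarrow> bool" where
  "separated T n \<epsilon> E \<longleftrightarrow>
     (\<forall>x\<in>E. \<forall>y\<in>E. x \<noteq> y \<longrightarrow> (\<exists>i<n. seq_dist ((T ^^ i) x) ((T ^^ i) y) > \<epsilon>))"

definition topological_entropy :: "(binseq \<Rightarrow> binseq) \<Rightarrow> binseq set \<Rightarrow> ereal" where
  "topological_entropy T A =
     (SUP \<epsilon>\<in>{0<..}. limsup (\<lambda>n.
        SUP E\<in>{E. E \<subseteq> A \<and> finite E \<and> separated T n \<epsilon> E}. ereal (ln (real (card E)) / real n)))"

end

theory Submission
  imports Defs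
begin

text \<open>
  Fix a computably enumerable set \<open>H\<close> that is not decidable, with \<open>0 \<in> H\<close>, and let the \<open>k\<close>-th pattern
  be the set of positions \<open>0, 1, 3, 5, \<dots>, 2k + 1, 2k + 2\<close>. The subshift consists of the sequences
  that nowhere carry zeros on all positions of a pattern with number in \<open>H\<close>. Consecutive positions of
  a pattern differ by at most two, so no pattern extends across \<open>11\<close>; this gives mixing and
  makes words easy to join.

  The clock of a point \<open>x\<close> outside the subshift is the largest \<open>n\<close> such that the first \<open>n\<close> symbols carry
  no pattern enumerated into \<open>H\<close> by stage about \<open>\<surd>(2n)\<close>. The map shifts \<open>x\<close>, keeps only a short window
  of it, appends one letter depending on \<open>n\<close>, and pads with ones followed by \<open>000\<close> so placed that
  the clock of the image is \<open>n + 1\<close>. A pattern enumerated late may stop the clock, but only until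
  it has left the window. The letters come in blocks \<open>s = 0, 1, \<dots>\<close> of length \<open>s + 1\<close>, the stage of the enumeration
  being constant in each block; block \<open>s\<close> runs through the periodic sequences \<open>(11w)\<^sup>\<infinity>\<close>, the \<open>i\<close>-th word
  occupying a fraction \<open>1/i - 1/(i + 1)\<close>, and replaces those recognised as forbidden by ones. It ends with
  a window of ones, so once a block has been completed the clock never stops again. Hence every orbit
  outside the subshift, whatever its starting point, is generic for the same convex combination of periodic
  measures, whose support is the subshift. The reference measure enters only through the subshift being
  null.
\<close>

text \<open>The obstacle: one continuous map must be the shift on a set whose membership is
  undecidable, yet send all other points along one common itinerary. A point outside the subshift
  shows it in a finite prefix, so the time can be stored in the point itself; the later the defect
  shows, the longer the window that is merely shifted, which makes the map continuous at the
  subshift. Only finitely much of \<open>H\<close> is known at any time, so forbidden words do get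
  written; they are tried again in later blocks at later stages, and each is rejected from some
  stage on. The pattern has adjacent positions only at its two ends, so their distance reveals
  \<open>k\<close>: zeros on one pattern and ones elsewhere realise no other. Hence the cylinder of
  pattern \<open>k\<close> meets the subshift exactly when \<open>k\<close> is not in
  \<open>H\<close>, and no measure with this support is computable. With 0 in \<open>H\<close> the
  word \<open>000\<close> is forbidden and can mark the end of the clock. The window has order
  n^(1/4) against blocks of order n^(1/2), so windows straddling two pieces do not affect
  averages.\<close>

section \<open>Computable functions of several arguments\<close>

text \<open>
  The program must work with every oracle, hence ignores it. Bound variables are the first entries of
  the argument list, so under binders an outer variable takes the form \<open>tl (\<dots> (tl xs)) ! i\<close>.
\<close>

definition cfun :: "nat \<Rightarrow> (nat list \<Rightarrow> nat) \<Rightarrow> bool" where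
  "cfun n g \<longleftrightarrow> (\<exists>p. \<forall>f xs. length xs = n \<longrightarrow> run f p xs (g xs))"

definition cpred :: "nat \<Rightarrow> (nat list \<Rightarrow> bool) \<Rightarrow> bool" where
  "cpred n P \<longleftrightarrow> cfun n (\<lambda>xs. of_bool (P xs))"

definition accessible :: "nat \<Rightarrow> nat \<Rightarrow> (nat list \<Rightarrow> nat list) \<Rightarrow> bool" where
  "accessible i n e \<longleftrightarrow> (\<exists>k. k + i < n \<and> (\<forall>xs. e xs = drop k xs))"

named_theorems cf

lemma accessible_id [cf]: "i < n \<Longrightarrow> accessible i n (\<lambda>xs. xs)"
  by (auto simp: accessible_def intro: exI[of _ 0])

lemma accessible_tl [cf]: "accessible (Suc i) n e \<Longrightarrow> accessible i n (\<lambda>xs. tl (e xs))"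
  unfolding accessible_def by (metis add_Suc add_Suc_right drop_Suc tl_drop)

lemma cfunI: "(\<And>f xs. length xs = n \<Longrightarrow> run f p xs (g xs)) \<Longrightarrow> cfun n g"
  by (auto simp: cfun_def)

lemma cfun_cong: "cfun n g \<Longrightarrow> (\<And>xs. length xs = n \<Longrightarrow> g xs = h xs) \<Longrightarrow> cfun n h"
  unfolding cfun_def by metis

lemma cpred_cong: "cpred n P \<Longrightarrow> (\<And>xs. length xs = n \<Longrightarrow> P xs = Q xs) \<Longrightarrow> cpred n Q"
  unfolding cpred_def by (erule cfun_cong) simp

lemma cfun_nth [cf]: "accessible i n e \<Longrightarrow> cfun n (\<lambda>xs. e xs ! i)"
  unfolding accessible_def
proof (elim exE conjE)
  fix k assume "k + i < n" "\<forall>xs. e xs = drop k xs"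
  then show ?thesis
    by (intro cfunI[where p = "Proj (k + i)"]) (auto intro: run_Proj)
qed

lemma cfun_comp:
  assumes "cfun (length gs) h" "\<And>g. g \<in> set gs \<Longrightarrow> cfun n g"
  shows "cfun n (\<lambda>xs. h (map (\<lambda>g. g xs) gs))"
proof -
  from assms(1) obtain p where p: "\<And>f xs. length xs = length gs \<Longrightarrow> run f p xs (h xs)"
    by (auto simp: cfun_def)
  have "\<forall>g\<in>set gs. \<exists>q. \<forall>f xs. length xs = n \<longrightarrow> run f q xs (g xs)"
    using assms(2) by (auto simp: cfun_def)
  then obtain Q where Q: "\<And>g f xs. g \<in> set gs \<Longrightarrow> length xs = n \<Longrightarrow> run f (Q g) xs (g xs)"
    by metis
  show ?thesis
    by (rule cfunI[where p = "Comp p (map Q gs)"])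
       (auto intro!: run_Comp[where ys = "map (\<lambda>g. g _) gs"] p Q simp: list_all2_conv_all_nth)
qed

lemma cfun_comp1: "cfun 1 (\<lambda>xs. h (xs ! 0)) \<Longrightarrow> cfun n a \<Longrightarrow> cfun n (\<lambda>xs. h (a xs))"
  using cfun_comp[of "[a]" "\<lambda>xs. h (xs ! 0)" n] by simp

lemma cfun_comp2:
  "cfun 2 (\<lambda>xs. h (xs ! 0) (xs ! 1)) \<Longrightarrow> cfun n a \<Longrightarrow> cfun n b \<Longrightarrow> cfun n (\<lambda>xs. h (a xs) (b xs))"
  using cfun_comp[of "[a, b]" "\<lambda>xs. h (xs ! 0) (xs ! 1)" n] by (auto simp: numeral_2_eq_2)

lemma cfun_comp3:
  "cfun 3 (\<lambda>xs. h (xs ! 0) (xs ! 1) (xs ! 2)) \<Longrightarrow> cfun n a \<Longrightarrow> cfun n b \<Longrightarrow> cfun n c \<Longrightarrow>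
    cfun n (\<lambda>xs. h (a xs) (b xs) (c xs))"
  using cfun_comp[of "[a, b, c]" "\<lambda>xs. h (xs ! 0) (xs ! 1) (xs ! 2)" n]
  by (auto simp: numeral_2_eq_2 numeral_3_eq_3)

lemma cpred_comp2:
  "cpred 2 (\<lambda>xs. h (xs ! 0) (xs ! 1)) \<Longrightarrow> cfun n a \<Longrightarrow> cfun n b \<Longrightarrow> cpred n (\<lambda>xs. h (a xs) (b xs))"
  unfolding cpred_def by (rule cfun_comp2)

lemma cpred_comp3:
  "cpred 3 (\<lambda>xs. h (xs ! 0) (xs ! 1) (xs ! 2)) \<Longrightarrow> cfun n a \<Longrightarrow> cfun n b \<Longrightarrow> cfun n c \<Longrightarrow>
    cpred n (\<lambda>xs. h (a xs) (b xs) (c xs))"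
  unfolding cpred_def by (rule cfun_comp3)

lemma cfun_Suc [cf]: "cfun n a \<Longrightarrow> cfun n (\<lambda>xs. Suc (a xs))"
proof (rule cfun_comp1[of Suc])
  show "cfun 1 (\<lambda>xs. Suc (xs ! 0))"
    by (rule cfunI[where p = Succ]) (auto simp: length_Suc_conv intro: run_Succ)
qed

lemma cfun_const [cf]: "cfun n (\<lambda>_. c)"
  by (induction c) (auto intro: cfunI[where p = Zero] run_Zero cfun_Suc)

text \<open>\<open>PrimRec\<close> runs its step program on \<open>y # n # xs\<close>, so in the
  argument list of the step the accumulator comes first and the index second.\<close>

lemma cfun_rec_nat [cf]:
  assumes "cfun n b" "cfun (Suc (Suc n)) (\<lambda>ys. s (ys ! 1) (ys ! 0) (tl (tl ys)))" "cfun n k"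
  shows "cfun n (\<lambda>xs. rec_nat (b xs) (\<lambda>m r. s m r xs) (k xs))"
proof -
  from assms(1) obtain p where p: "\<And>f xs. length xs = n \<Longrightarrow> run f p xs (b xs)"
    by (auto simp: cfun_def)
  from assms(2) obtain q where
    q: "\<And>f ys. length ys = Suc (Suc n) \<Longrightarrow> run f q ys (s (ys ! 1) (ys ! 0) (tl (tl ys)))"
    by (auto simp: cfun_def)
  have "run f (PrimRec p q) (m # xs) (rec_nat (b xs) (\<lambda>m r. s m r xs) m)" if "length xs = n" for f xs m
  proof (induction m)
    case 0
    show ?case using that by (auto intro: run_PrimRec_0 p)
  next
    case (Suc m)
    show ?case
      using run_PrimRec_Suc[OF Suc.IH q] that by simp
  qed
  then have *: "cfun (Suc n) (\<lambda>ys. rec_nat (b (tl ys)) (\<lambda>m r. s m r (tl ys)) (ys ! 0))"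
    by (intro cfunI[where p = "PrimRec p q"]) (auto simp: length_Suc_conv)
  have proj: "cfun n (\<lambda>xs. xs ! i)" if "i < n" for i
    using that by (intro cfunI[where p = "Proj i"]) (auto intro: run_Proj)
  have "cfun n (\<lambda>xs. (\<lambda>ys. rec_nat (b (tl ys)) (\<lambda>m r. s m r (tl ys)) (ys ! 0))
         (map (\<lambda>g. g xs) (k # map (\<lambda>i xs. xs ! i) [0..<n])))"
    by (rule cfun_comp) (use * assms(3) proj in auto)
  then show ?thesis
    by (rule cfun_cong) (simp add: o_def, metis map_nth)
qed

lemma cfun_add [cf]: "cfun n a \<Longrightarrow> cfun n b \<Longrightarrow> cfun n (\<lambda>xs. a xs + b xs)"
proof (rule cfun_comp2[of "(+)"])
  have "rec_nat a (\<lambda>_ r. Suc r) b = a + b" for a b by (induction b) auto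
  moreover have "cfun 2 (\<lambda>xs. rec_nat (xs ! 0) (\<lambda>_ r. Suc r) (xs ! 1))"
    by (intro cf; simp)
  ultimately show "cfun 2 (\<lambda>xs. xs ! 0 + xs ! 1)" by simp
qed

lemma cfun_pred: "cfun n a \<Longrightarrow> cfun n (\<lambda>xs. a xs - Suc 0)"
proof (rule cfun_comp1[of "\<lambda>a. a - Suc 0"])
  have "rec_nat 0 (\<lambda>m _. m) a = a - Suc 0" for a by (induction a) auto
  moreover have "cfun 1 (\<lambda>xs. rec_nat 0 (\<lambda>m _. m) (xs ! 0))"
    by (intro cf; simp)
  ultimately show "cfun 1 (\<lambda>xs. xs ! 0 - Suc 0)" by simp
qed

lemma cfun_diff [cf]: "cfun n a \<Longrightarrow> cfun n b \<Longrightarrow> cfun n (\<lambda>xs. a xs - b xs)"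
proof (rule cfun_comp2[of "(-)"])
  have "rec_nat a (\<lambda>_ r. r - Suc 0) b = a - b" for a b by (induction b) auto
  moreover have "cfun 2 (\<lambda>xs. rec_nat (xs ! 0) (\<lambda>_ r. r - Suc 0) (xs ! 1))"
    by (intro cf cfun_pred; simp)
  ultimately show "cfun 2 (\<lambda>xs. xs ! 0 - xs ! 1)" by simp
qed

lemma cfun_mult [cf]: "cfun n a \<Longrightarrow> cfun n b \<Longrightarrow> cfun n (\<lambda>xs. a xs * b xs)"
proof (rule cfun_comp2[of "(*)"])
  have "rec_nat 0 (\<lambda>_ r. a + r) b = a * b" for a b :: nat by (induction b) auto
  moreover have "cfun 2 (\<lambda>xs. rec_nat 0 (\<lambda>_ r. xs ! 0 + r) (xs ! 1))"
    by (intro cf; simp)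
  ultimately show "cfun 2 (\<lambda>xs. xs ! 0 * xs ! 1)" by simp
qed

lemma cfun_power [cf]: "cfun n a \<Longrightarrow> cfun n b \<Longrightarrow> cfun n (\<lambda>xs. a xs ^ b xs)"
proof (rule cfun_comp2[of "(^)"])
  have "rec_nat 1 (\<lambda>_ r. a * r) b = a ^ b" for a b :: nat by (induction b) auto
  moreover have "cfun 2 (\<lambda>xs. rec_nat 1 (\<lambda>_ r. xs ! 0 * r) (xs ! 1))"
    by (intro cf; simp)
  ultimately show "cfun 2 (\<lambda>xs. xs ! 0 ^ xs ! 1)" by simp
qed

lemma cpred_le [cf]: "cfun n a \<Longrightarrow> cfun n b \<Longrightarrow> cpred n (\<lambda>xs. a xs \<le> b xs)"
  unfolding cpred_def
  by (rule cfun_cong[of n "\<lambda>xs. 1 - (a xs - b xs)"], (intro cf; simp), simp)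

lemma cpred_not [cf]: "cpred n P \<Longrightarrow> cpred n (\<lambda>xs. \<not> P xs)"
  unfolding cpred_def
  by (rule cfun_cong[of n "\<lambda>xs. 1 - of_bool (P xs)"], (intro cf; simp), simp)

lemma cpred_conj [cf]: "cpred n P \<Longrightarrow> cpred n Q \<Longrightarrow> cpred n (\<lambda>xs. P xs \<and> Q xs)"
  unfolding cpred_def
  by (rule cfun_cong[of n "\<lambda>xs. of_bool (P xs) * of_bool (Q xs)"], (intro cf; simp), simp)

lemma cpred_disj [cf]: "cpred n P \<Longrightarrow> cpred n Q \<Longrightarrow> cpred n (\<lambda>xs. P xs \<or> Q xs)"
  by (rule cpred_cong[of n "\<lambda>xs. \<not> (\<not> P xs \<and> \<not> Q xs)"], (intro cf; simp), simp)

lemma cpred_less [cf]: "cfun n a \<Longrightarrow> cfun n b \<Longrightarrow> cpred n (\<lambda>xs. a xs < b xs)"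
  by (rule cpred_cong[of n "\<lambda>xs. Suc (a xs) \<le> b xs"], (intro cf; simp), auto)

lemma cpred_eq [cf]: "cfun n a \<Longrightarrow> cfun n b \<Longrightarrow> cpred n (\<lambda>xs. a xs = b xs)"
  by (rule cpred_cong[of n "\<lambda>xs. a xs \<le> b xs \<and> b xs \<le> a xs"], (intro cf; simp), auto)

lemma cpred_const [cf]: "cpred n (\<lambda>_. c)"
  unfolding cpred_def by (rule cfun_const)

lemma cfun_of_bool [cf]: "cpred n P \<Longrightarrow> cfun n (\<lambda>xs. of_bool (P xs))"
  by (simp add: cpred_def)

lemma cfun_if [cf]:
  assumes "cpred n P" "cfun n a" "cfun n b"
  shows "cfun n (\<lambda>xs. if P xs then a xs else b xs)"
proof (rule cfun_cong)
  show "cfun n (\<lambda>xs. of_bool (P xs) * a xs + of_bool (\<not> P xs) * b xs)"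
    using assms by (intro cf)
qed auto

lemma cpred_if [cf]:
  "cpred n P \<Longrightarrow> cpred n Q \<Longrightarrow> cpred n R \<Longrightarrow> cpred n (\<lambda>xs. if P xs then Q xs else R xs)"
  by (rule cpred_cong[of n "\<lambda>xs. (P xs \<and> Q xs) \<or> (\<not> P xs \<and> R xs)"], (intro cf; simp), auto)

text \<open>Inside a recursion the argument list is accumulator, index, parameters. Replacing the
  first two entries by one computed head lets a function of index and parameters be used in the
  step.\<close>

lemma cfun_subst_head:
  assumes "cfun (Suc n) (\<lambda>ys. g (ys ! 0) (tl ys))" "cfun (Suc (Suc n)) a"
  shows "cfun (Suc (Suc n)) (\<lambda>ys. g (a ys) (tl (tl ys)))"
proof -
  let ?gs = "a # map (\<lambda>i ys. ys ! Suc (Suc i)) [0..<n]"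
  have "cfun (Suc (Suc n)) (\<lambda>ys. (\<lambda>ys. g (ys ! 0) (tl ys)) (map (\<lambda>g. g ys) ?gs))"
  proof (rule cfun_comp)
    show "cfun (Suc (Suc n)) g" if "g \<in> set ?gs" for g
      using that assms(2) by (auto intro!: cfun_nth accessible_id)
  qed (use assms(1) in simp)
  then show ?thesis
    by (rule cfun_cong) (auto simp: length_Suc_conv o_def map_nth)
qed

lemma cfun_shift:
  "cfun (Suc n) (\<lambda>ys. g (ys ! 0) (tl ys)) \<Longrightarrow> cfun (Suc (Suc n)) (\<lambda>ys. g (ys ! Suc 0) (tl (tl ys)))"
  by (erule cfun_subst_head) (intro cf; simp)

lemma cfun_weaken:
  assumes "cfun n g"
  shows "cfun (Suc n) (\<lambda>ys. g (tl ys))"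
proof -
  let ?gs = "map (\<lambda>i ys. ys ! Suc i) [0..<n]"
  have "cfun (Suc n) (\<lambda>ys. g (map (\<lambda>g. g ys) ?gs))"
    using assms by (intro cfun_comp) (auto intro!: cfun_nth accessible_id)
  then show ?thesis
    by (rule cfun_cong) (auto simp: length_Suc_conv o_def map_nth)
qed

lemma cpred_all_less [cf]:
  assumes "cpred (Suc n) (\<lambda>ys. P (ys ! 0) (tl ys))" "cfun n k"
  shows "cpred n (\<lambda>xs. \<forall>i<k xs. P i xs)"
proof -
  have *: "rec_nat (1::nat) (\<lambda>m r. r * of_bool (P m xs)) k = of_bool (\<forall>i<k. P i xs)" for k xs
    by (induction k) (auto simp: less_Suc_eq)
  have "cfun n (\<lambda>xs. rec_nat 1 (\<lambda>m r. r * of_bool (P m xs)) (k xs))"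
    using cfun_shift[of n "\<lambda>m xs. of_bool (P m xs)"] assms
    by (intro cf) (auto simp: cpred_def intro: cf)
  then show ?thesis unfolding * cpred_def .
qed

lemma cpred_ex_less [cf]:
  assumes "cpred (Suc n) (\<lambda>ys. P (ys ! 0) (tl ys))" "cfun n k"
  shows "cpred n (\<lambda>xs. \<exists>i<k xs. P i xs)"
  by (rule cpred_cong[of n "\<lambda>xs. \<not> (\<forall>i<k xs. \<not> P i xs)"], (intro cf assms), simp)

lemma cpred_all_le [cf]:
  assumes "cpred (Suc n) (\<lambda>ys. P (ys ! 0) (tl ys))" "cfun n k"
  shows "cpred n (\<lambda>xs. \<forall>i\<le>k xs. P i xs)"
  by (rule cpred_cong[of n "\<lambda>xs. \<forall>i<Suc (k xs). P i xs"], (intro cf assms), auto simp: less_Suc_eq_le)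

lemma cpred_ex_le [cf]:
  assumes "cpred (Suc n) (\<lambda>ys. P (ys ! 0) (tl ys))" "cfun n k"
  shows "cpred n (\<lambda>xs. \<exists>i\<le>k xs. P i xs)"
  by (rule cpred_cong[of n "\<lambda>xs. \<exists>i<Suc (k xs). P i xs"], (intro cf assms), auto simp: less_Suc_eq_le)

text \<open>The value \<open>k\<close> is the default when the search fails below \<open>k\<close>.
  The bound makes the search primitive recursive, so no \<open>Mu\<close> and no termination
  argument is involved.\<close>

definition bounded_least :: "nat \<Rightarrow> (nat \<Rightarrow> bool) \<Rightarrow> nat" where
  "bounded_least k P = (LEAST i. i = k \<or> P i)"

lemma bounded_least_eqI: "P m \<Longrightarrow> m \<le> k \<Longrightarrow> (\<And>i. i < m \<Longrightarrow> \<not> P i) \<Longrightarrow> bounded_least k P = m"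
  unfolding bounded_least_def by (rule Least_equality) (auto simp: not_less[symmetric])

lemma cfun_bounded_least [cf]:
  assumes "cpred (Suc n) (\<lambda>ys. P (ys ! 0) (tl ys))" "cfun n k"
  shows "cfun n (\<lambda>xs. bounded_least (k xs) (\<lambda>i. P i xs))"
proof -
  have 1: "bounded_least (Suc k) P = (if bounded_least k P < k \<or> P k then bounded_least k P else Suc k)" for k P
  proof -
    let ?m = "bounded_least k P"
    have m: "?m = k \<or> P ?m" unfolding bounded_least_def by (rule LeastI[where k = k]) simp
    have le: "?m \<le> k" unfolding bounded_least_def by (rule Least_le) simp
    have less: "\<not> P i" if "i < ?m" for i
      using that not_less_Least[of i "\<lambda>i. i = k \<or> P i"] unfolding bounded_least_def by auto
    show ?thesis
    proof (cases "?m < k \<or> P k")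
      case True
      then have "bounded_least (Suc k) P = ?m"
        using m le less by (intro bounded_least_eqI) (cases "?m = k", auto)
      then show ?thesis using True by simp
    next
      case False
      then have "\<not> P i" if "i < Suc k" for i using less le that by (auto simp: less_Suc_eq)
      then have "bounded_least (Suc k) P = Suc k"
        unfolding bounded_least_def by (intro Least_equality) (auto simp: not_less[symmetric])
      then show ?thesis using False by simp
    qed
  qed
  have 0: "bounded_least 0 P = 0" for P unfolding bounded_least_def by (rule Least_equality) auto
  \<comment> \<open>After \<open>m\<close> rounds the accumulator is the least solution below
    \<open>m\<close>, or \<open>m\<close> itself if there is none; \<open>r < m\<close> thus means
    that the search has already succeeded.\<close>
  have *: "rec_nat 0 (\<lambda>m r. if r < m \<or> P m xs then r else Suc m) k = bounded_least k (\<lambda>i. P i xs)" for k xs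
    by (induction k) (simp_all add: 0 1)
  have "cpred (Suc (Suc n)) (\<lambda>ys. P (ys ! 1) (tl (tl ys)))"
    using cfun_shift[of n "\<lambda>m xs. of_bool (P m xs)"] assms(1) by (simp add: cpred_def)
  then have "cfun n (\<lambda>xs. rec_nat 0 (\<lambda>m r. if r < m \<or> P m xs then r else Suc m) (k xs))"
    by (intro cf assms) auto
  then show ?thesis unfolding * .
qed

lemma cfun_div [cf]: "cfun n a \<Longrightarrow> cfun n b \<Longrightarrow> cfun n (\<lambda>xs. a xs div b xs)"
proof (rule cfun_comp2[of "(div)"])
  have *: "(if b = 0 then 0 else bounded_least a (\<lambda>q. a < Suc q * b)) = a div b" for a b :: nat
  proof (cases "b = 0")
    case False
    have "bounded_least a (\<lambda>q. a < Suc q * b) = a div b"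
    proof (rule bounded_least_eqI)
      show "a < Suc (a div b) * b" using False by (simp add: dividend_less_div_times add.commute)
      fix i assume "i < a div b"
      then show "\<not> a < Suc i * b"
        by (metis Suc_leI div_times_less_eq_dividend leD le_trans mult_le_mono1)
    qed auto
    then show ?thesis using False by simp
  qed auto
  have "cfun 2 (\<lambda>xs. if xs ! 1 = 0 then 0 else bounded_least (xs ! 0) (\<lambda>q. xs ! 0 < Suc q * xs ! 1))"
    by (intro cf; simp)
  then show "cfun 2 (\<lambda>xs. xs ! 0 div xs ! 1)" unfolding * .
qed

lemma cfun_mod [cf]: "cfun n a \<Longrightarrow> cfun n b \<Longrightarrow> cfun n (\<lambda>xs. a xs mod b xs)"
  unfolding minus_mult_div_eq_mod[symmetric] by (intro cf)

lemma cpred_odd [cf]: "cfun n a \<Longrightarrow> cpred n (\<lambda>xs. odd (a xs))"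
  unfolding odd_iff_mod_2_eq_one by (intro cf)

lemma cpred_even [cf]: "cfun n a \<Longrightarrow> cpred n (\<lambda>xs. even (a xs))"
  unfolding even_iff_mod_2_eq_zero by (intro cf)

section \<open>Codes of pairs and lists\<close>

text \<open>The diagonal of the Cantor pairing that contains \<open>n\<close>, that is, the largest
  \<open>s\<close> with \<open>triangle s \<le> n\<close>. It later serves as block number and as
  enumeration stage at time \<open>n\<close>.\<close>

definition tri_root :: "nat \<Rightarrow> nat" where
  "tri_root n = fst (prod_decode n) + snd (prod_decode n)"

lemma prod_decode_tri: "prod_decode n = (n - triangle (tri_root n), tri_root n - (n - triangle (tri_root n)))"
  and tri_root_le: "triangle (tri_root n) \<le> n"
  and less_tri_root: "n < triangle (Suc (tri_root n))"
proof -
  obtain a b where ab: "prod_decode n = (a, b)" by fastforce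
  then have "n = triangle (a + b) + a"
    using prod_decode_inverse[of n] by (simp add: prod_encode_def)
  moreover have "tri_root n = a + b"
    by (simp add: tri_root_def ab)
  ultimately show "prod_decode n = (n - triangle (tri_root n), tri_root n - (n - triangle (tri_root n)))"
    "triangle (tri_root n) \<le> n" "n < triangle (Suc (tri_root n))"
    using ab by simp_all
qed

lemma triangle_mono: "m \<le> n \<Longrightarrow> triangle m \<le> triangle n"
  by (rule lift_Suc_mono_le[of triangle]) auto

lemma tri_root_eqI: "triangle s \<le> n \<Longrightarrow> n < triangle (Suc s) \<Longrightarrow> tri_root n = s"
  using tri_root_le[of n] less_tri_root[of n] triangle_mono[of "Suc s" "tri_root n"]
    triangle_mono[of "Suc (tri_root n)" s]
  by (meson Suc_leI leD le_less_trans linorder_neqE_nat)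

lemma le_triangle: "n \<le> triangle n"
  by (induction n) auto

lemma tri_root_le_self: "tri_root n \<le> n"
  by (rule le_trans[OF le_triangle tri_root_le])

lemma cfun_triangle [cf]: "cfun n a \<Longrightarrow> cfun n (\<lambda>xs. triangle (a xs))"
  unfolding triangle_def by (intro cf)

lemma cfun_prod_encode [cf]: "cfun n a \<Longrightarrow> cfun n b \<Longrightarrow> cfun n (\<lambda>xs. prod_encode (a xs, b xs))"
  unfolding prod_encode_def case_prod_conv by (intro cf)

lemma cfun_tri_root [cf]: "cfun n a \<Longrightarrow> cfun n (\<lambda>xs. tri_root (a xs))"
proof (rule cfun_comp1[of tri_root])
  have "bounded_least m (\<lambda>s. m < triangle (Suc s)) = tri_root m" for m
  proof (rule bounded_least_eqI)
    show "m < triangle (Suc (tri_root m))" by (rule less_tri_root)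
    fix i assume "i < tri_root m"
    then show "\<not> m < triangle (Suc i)"
      using tri_root_le[of m] triangle_mono[of "Suc i" "tri_root m"] by linarith
  qed (rule tri_root_le_self)
  moreover have "cfun 1 (\<lambda>xs. bounded_least (xs ! 0) (\<lambda>s. xs ! 0 < triangle (Suc s)))"
    by (intro cf; simp)
  ultimately show "cfun 1 (\<lambda>xs. tri_root (xs ! 0))" by simp
qed

lemma cfun_fst_prod_decode [cf]: "cfun n a \<Longrightarrow> cfun n (\<lambda>xs. fst (prod_decode (a xs)))"
  unfolding prod_decode_tri fst_conv by (intro cf)

lemma cfun_snd_prod_decode [cf]: "cfun n a \<Longrightarrow> cfun n (\<lambda>xs. snd (prod_decode (a xs)))"
  unfolding prod_decode_tri snd_conv by (intro cf)

definition code_tl :: "nat \<Rightarrow> nat" where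
  "code_tl c = list_encode (tl (list_decode c))"

definition code_length :: "nat \<Rightarrow> nat" where
  "code_length c = length (list_decode c)"

definition code_nth :: "nat \<Rightarrow> nat \<Rightarrow> nat" where
  "code_nth c i = (if i < code_length c then list_decode c ! i else 0)"

lemma prod_decode_0: "prod_decode 0 = (0, 0)"
  by (simp add: prod_decode_def prod_decode_aux.simps)

lemma cfun_code_tl [cf]: "cfun n a \<Longrightarrow> cfun n (\<lambda>xs. code_tl (a xs))"
proof -
  have "code_tl c = snd (prod_decode (c - Suc 0))" for c
    by (cases c) (auto simp: code_tl_def prod_decode_0 split: prod.splits)
  then show "cfun n a \<Longrightarrow> ?thesis" by simp (intro cf)
qed

lemma list_decode_eq_Nil [simp]: "list_decode c = [] \<longleftrightarrow> c = 0"
  by (metis list_decode.simps(1) list_decode_inverse list_encode.simps(1))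

lemma rec_nat_code_tl: "list_decode (rec_nat c (\<lambda>_. code_tl) i) = drop i (list_decode c)"
  by (induction i) (auto simp: code_tl_def drop_Suc tl_drop)

lemma length_le_list_encode: "length xs \<le> list_encode xs"
proof (induction xs)
  case (Cons x xs)
  then show ?case using le_prod_encode_2[of "list_encode xs" x] by simp
qed simp

lemma cfun_code_length [cf]: "cfun n a \<Longrightarrow> cfun n (\<lambda>xs. code_length (a xs))"
proof (rule cfun_comp1[of code_length])
  have *: "bounded_least c (\<lambda>i. rec_nat c (\<lambda>_. code_tl) i = 0) = code_length c" for c
    unfolding list_decode_eq_Nil[symmetric] rec_nat_code_tl drop_eq_Nil code_length_def
    by (rule bounded_least_eqI) (use length_le_list_encode[of "list_decode c"] in auto)
  show "cfun 1 (\<lambda>xs. code_length (xs ! 0))"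
    unfolding *[symmetric] by (intro cf; simp)
qed

lemma cfun_code_nth [cf]: "cfun n a \<Longrightarrow> cfun n b \<Longrightarrow> cfun n (\<lambda>xs. code_nth (a xs) (b xs))"
proof (rule cfun_comp2[of code_nth])
  have hd: "fst (prod_decode (c - Suc 0)) = (if c = 0 then 0 else hd (list_decode c))" for c
    by (cases c) (auto simp: prod_decode_0 split: prod.splits)
  have *: "fst (prod_decode (rec_nat c (\<lambda>_. code_tl) i - Suc 0)) = code_nth c i" for c i
    unfolding hd list_decode_eq_Nil[symmetric] rec_nat_code_tl
    by (auto simp: code_nth_def code_length_def hd_drop_conv_nth)
  show "cfun 2 (\<lambda>xs. code_nth (xs ! 0) (xs ! 1))"
    unfolding *[symmetric] by (intro cf; simp)
qed

lemma cfun_list_encode_map_upt [cf]: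
  assumes "cfun (Suc n) (\<lambda>ys. g (ys ! 0) (tl ys))" "cfun n k"
  shows "cfun n (\<lambda>xs. list_encode (map (\<lambda>i. g i xs) [0..<k xs]))"
proof -
  have *: "rec_nat 0 (\<lambda>m r. list_encode (g (k - Suc m) xs # list_decode r)) m
      = list_encode (map (\<lambda>i. g i xs) [k - m..<k])" if "m \<le> k" for k m xs
    using that
  proof (induction m)
    case (Suc m)
    then have "[k - Suc m..<k] = (k - Suc m) # [k - m..<k]"
      by (metis Suc_diff_Suc Suc_le_lessD diff_less lessI less_le_trans upt_conv_Cons zero_less_Suc)
    with Suc show ?case by simp
  qed simp
  have "rec_nat 0 (\<lambda>m r. Suc (prod_encode (g (k - Suc m) xs, r))) k
      = list_encode (map (\<lambda>i. g i xs) [0..<k])" for k xs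
    using *[of k k xs] by simp
  moreover have "cfun n (\<lambda>xs. rec_nat 0 (\<lambda>m r. Suc (prod_encode (g (k xs - Suc m) xs, r))) (k xs))"
  proof (intro cf)
    show "cfun (Suc (Suc n)) (\<lambda>ys. g (k (tl (tl ys)) - Suc (ys ! 1)) (tl (tl ys)))"
    proof (rule cfun_subst_head[OF assms(1)])
      have "cfun (Suc (Suc n)) (\<lambda>ys. k (tl (tl ys)))"
        using cfun_weaken[OF cfun_weaken[OF assms(2)]] .
      then show "cfun (Suc (Suc n)) (\<lambda>ys. k (tl (tl ys)) - Suc (ys ! 1))"
        by (intro cf) simp_all
    qed
  qed (use assms in simp_all)
  ultimately show ?thesis by simp
qed

section \<open>A computably enumerable set that is not decidable\<close>

abbreviation pfst :: "nat \<Rightarrow> nat" where "pfst n \<equiv> fst (prod_decode n)"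
abbreviation psnd :: "nat \<Rightarrow> nat" where "psnd n \<equiv> snd (prod_decode n)"
abbreviation pair :: "nat \<Rightarrow> nat \<Rightarrow> nat" where "pair a b \<equiv> prod_encode (a, b)"

definition item :: "nat \<Rightarrow> nat \<Rightarrow> nat \<Rightarrow> nat" where
  "item c a y = pair c (pair a y)"

text \<open>All tags are positive, so 0 codes no program and may be put into \<open>H\<close> by
  decree.\<close>

fun prog_code :: "prog \<Rightarrow> nat" where
  "prog_code Zero = pair 1 0"
| "prog_code Succ = pair 2 0"
| "prog_code (Proj i) = pair 3 i"
| "prog_code Oracle = pair 4 0"
| "prog_code (Comp p qs) = pair 5 (pair (prog_code p) (list_encode (map prog_code qs)))"
| "prog_code (PrimRec p q) = pair 6 (pair (prog_code p) (prog_code q))"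
| "prog_code (Mu p) = pair 7 (prog_code p)"

text \<open>
  An item codes a claim \<open>run0 p xs y\<close>; \<open>justified S e\<close> says that the claim \<open>e\<close> follows by one
  rule of \<open>run0\<close> from claims in \<open>S\<close>. All quantifiers are bounded by \<open>S\<close> or by numbers.
\<close>

definition justified_item :: "nat set \<Rightarrow> nat \<Rightarrow> nat \<Rightarrow> nat \<Rightarrow> nat \<Rightarrow> bool" where
  "justified_item S t c a y \<longleftrightarrow>
     t = 1 \<and> y = 0 \<or>
     t = 2 \<and> code_length a \<noteq> 0 \<and> y = Suc (code_nth a 0) \<or>
     t = 3 \<and> c < code_length a \<and> y = code_nth a c \<or>
     t = 4 \<and> code_length a \<noteq> 0 \<and> y = 0 \<or>
     t = 5 \<and> (\<exists>s\<in>S. pfst s = pfst c \<and> psnd (psnd s) = y \<and>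
        code_length (pfst (psnd s)) = code_length (psnd c) \<and>
        (\<forall>l<code_length (psnd c). item (code_nth (psnd c) l) a (code_nth (pfst (psnd s)) l) \<in> S)) \<or>
     t = 6 \<and> code_length a \<noteq> 0 \<and>
       (if code_nth a 0 = 0 then item (pfst c) (code_tl a) y \<in> S
        else \<exists>s\<in>S. item (pair 6 c) (Suc (pair (code_nth a 0 - 1) (code_tl a))) (psnd (psnd s)) \<in> S \<and>
          item (psnd c) (Suc (pair (psnd (psnd s)) (Suc (pair (code_nth a 0 - 1) (code_tl a))))) y \<in> S) \<or>
     t = 7 \<and> item c (Suc (pair y a)) 0 \<in> S \<and>
       (\<forall>m<y. \<exists>s\<in>S. psnd (psnd s) \<noteq> 0 \<and> item c (Suc (pair m a)) (psnd (psnd s)) \<in> S)"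

definition justified :: "nat set \<Rightarrow> nat \<Rightarrow> bool" where
  "justified S e \<longleftrightarrow>
     justified_item S (pfst (pfst e)) (psnd (pfst e)) (pfst (psnd e)) (psnd (psnd e))"

definition trace :: "nat list \<Rightarrow> bool" where
  "trace L \<longleftrightarrow> (\<forall>j<length L. justified (set (take j L)) (L ! j))"

section \<open>Soundness and completeness of traces\<close>

lemma item_eq [simp]: "item c a y = item c' a' y' \<longleftrightarrow> c = c' \<and> a = a' \<and> y = y'"
  by (simp add: item_def)

lemma item_sel [simp]: "pfst (item c a y) = c" "psnd (item c a y) = pair a y"
  by (simp_all add: item_def)

lemma code_simps [simp]:
  "code_length (list_encode xs) = length xs"
  "i < length xs \<Longrightarrow> code_nth (list_encode xs) i = xs ! i"
  "code_tl (list_encode xs) = list_encode (tl xs)"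
  by (simp_all add: code_length_def code_nth_def code_tl_def)

lemma justified_item_mono: "justified_item S t c a y \<Longrightarrow> S \<subseteq> S' \<Longrightarrow> justified_item S' t c a y"
  unfolding justified_item_def by (elim disjE; simp split: if_splits; blast)

lemma justified_mono: "justified S e \<Longrightarrow> S \<subseteq> S' \<Longrightarrow> justified S' e"
  unfolding justified_def by (rule justified_item_mono)

lemma trace_append: "trace L \<Longrightarrow> trace L' \<Longrightarrow> trace (L @ L')"
  unfolding trace_def by (auto simp: nth_append intro: justified_mono[OF _ Un_upper2])

lemma trace_snoc: "trace L \<Longrightarrow> justified (set L) e \<Longrightarrow> trace (L @ [e])"
  unfolding trace_def by (auto simp: nth_append less_Suc_eq)

lemma trace_butlast: "trace (L @ [e]) \<Longrightarrow> trace L \<and> justified (set L) e"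
  unfolding trace_def by (auto simp: nth_append less_Suc_eq dest: spec[of _ "length L"])

definition derivable :: "nat \<Rightarrow> bool" where
  "derivable e \<longleftrightarrow> (\<exists>L. trace L \<and> e \<in> set L)"

lemma derivable_finite:
  assumes "finite F" "\<forall>e\<in>F. derivable e"
  shows "\<exists>L. trace L \<and> F \<subseteq> set L"
  using assms
proof (induction F)
  case empty
  show ?case by (intro exI[of _ "[]"]) (simp add: trace_def)
next
  case (insert e F)
  then obtain L L' where "trace L" "F \<subseteq> set L" "trace L'" "e \<in> set L'"
    by (auto simp: derivable_def)
  then show ?case
    by (intro exI[of _ "L @ L'"]) (auto intro: trace_append)
qed

lemma derivableI:
  assumes "finite F" "\<forall>e\<in>F. derivable e" "justified F e"
  shows "derivable e"
proof -
  from derivable_finite[OF assms(1,2)] obtain L where "trace L" "F \<subseteq> set L" by blast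
  then have "trace (L @ [e])" using assms(3) by (blast intro: trace_snoc justified_mono)
  then show ?thesis unfolding derivable_def by (intro exI[of _ "L @ [e]"]) simp
qed

abbreviation claim :: "prog \<Rightarrow> nat list \<Rightarrow> nat \<Rightarrow> nat" where
  "claim p xs y \<equiv> item (prog_code p) (list_encode xs) y"

lemma run0_derivable: "run0 p xs y \<Longrightarrow> derivable (claim p xs y)"
proof (induction rule: run.induct)
  case (run_Zero xs)
  show ?case by (rule derivableI[of "{}"]) (auto simp: justified_def justified_item_def)
next
  case (run_Succ x xs)
  show ?case by (rule derivableI[of "{}"]) (auto simp: justified_def justified_item_def simp del: list_encode.simps)
next
  case (run_Proj i xs)
  then show ?case by (intro derivableI[of "{}"]) (auto simp: justified_def justified_item_def)
next
  case (run_Oracle x xs)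
  show ?case by (rule derivableI[of "{}"]) (auto simp: justified_def justified_item_def simp del: list_encode.simps)
next
  case (run_Comp xs qs ys p z)
  let ?F = "insert (claim p ys z) ((\<lambda>l. claim (qs ! l) xs (ys ! l)) ` {..<length qs})"
  have len: "length ys = length qs" using run_Comp(1) by (simp add: list_all2_lengthD)
  show ?case
  proof (rule derivableI[of ?F])
    show "\<forall>e\<in>?F. derivable e" using run_Comp by (auto simp: list_all2_conv_all_nth)
    show "justified ?F (claim (Comp p qs) xs z)"
      using len by (auto simp: justified_def justified_item_def)
  qed simp
next
  case (run_PrimRec_0 p xs y q)
  then show ?case
    by (intro derivableI[of "{claim p xs y}"])
       (auto simp: justified_def justified_item_def simp del: list_encode.simps)
next
  case (run_PrimRec_Suc p q n xs y z)
  then show ?case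
    by (intro derivableI[of "{claim (PrimRec p q) (n # xs) y, claim q (y # n # xs) z}"])
       (auto simp: justified_def justified_item_def list_encode.simps(2)[symmetric] simp del: list_encode.simps)
next
  case (run_Mu p n xs)
  then obtain Y where Y: "\<And>m. m < n \<Longrightarrow> derivable (claim p (m # xs) (Suc (Y m)))"
    by metis
  let ?F = "insert (claim p (n # xs) 0) ((\<lambda>m. claim p (m # xs) (Suc (Y m))) ` {..<n})"
  show ?case
  proof (rule derivableI[of ?F])
    show "\<forall>e\<in>?F. derivable e" using run_Mu Y by auto
    show "justified ?F (claim (Mu p) xs n)"
      by (auto simp: justified_def justified_item_def list_encode.simps(2)[symmetric] simp del: list_encode.simps)
  qed simp
qed

text \<open>The tag in the program code singles out the rule. Every number is a list code, so an
  item of \<open>S\<close> that starts with a program code is itself a claim and the hypothesis on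
  \<open>S\<close> applies to it.\<close>

lemma justified_run0:
  assumes "justified S (claim p xs y)" and S: "\<And>p xs y. claim p xs y \<in> S \<Longrightarrow> run0 p xs y"
  shows "run0 p xs y"
proof (cases p)
  case Zero
  then show ?thesis using assms(1) by (auto simp: justified_def justified_item_def intro: run_Zero)
next
  case Succ
  then show ?thesis using assms(1)
    by (cases xs) (auto simp: justified_def justified_item_def intro: run_Succ simp del: list_encode.simps)
next
  case (Proj i)
  then show ?thesis using assms(1) by (auto simp: justified_def justified_item_def intro: run_Proj)
next
  case Oracle
  then show ?thesis using assms(1) run_Oracle[of "\<lambda>_. 0"]
    by (cases xs) (auto simp: justified_def justified_item_def simp del: list_encode.simps)
next
  case (Comp p' qs)
  from assms(1) obtain s where s: "s \<in> S" "pfst s = prog_code p'" "psnd (psnd s) = y"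
    "code_length (pfst (psnd s)) = length qs"
    and l: "\<And>l. l < length qs \<Longrightarrow> item (prog_code (qs ! l)) (list_encode xs) (code_nth (pfst (psnd s)) l) \<in> S"
    unfolding Comp by (auto simp: justified_def justified_item_def)
  define ys where "ys = list_decode (pfst (psnd s))"
  have ys: "pfst (psnd s) = list_encode ys" by (simp add: ys_def)
  have "s = claim p' ys y"
    using s(2,3) ys unfolding item_def by (metis prod.collapse prod_decode_inverse)
  with s have "run0 p' ys y" using S by simp
  moreover have "list_all2 (\<lambda>q y. run0 q xs y) qs ys"
    using l s(4) S unfolding ys by (auto simp: list_all2_conv_all_nth)
  ultimately show ?thesis unfolding Comp by (rule run_Comp[rotated])
next
  case (PrimRec p' q)
  show ?thesis
  proof (cases xs)
    case Nil
    then show ?thesis using assms(1) unfolding PrimRec by (auto simp: justified_def justified_item_def code_length_def)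
  next
    case (Cons x xs')
    show ?thesis
    proof (cases x)
      case 0
      then have "claim p' xs' y \<in> S" using assms(1) unfolding PrimRec Cons
        by (auto simp: justified_def justified_item_def simp del: list_encode.simps)
      then show ?thesis unfolding PrimRec Cons 0 by (blast intro: run_PrimRec_0 S)
    next
      case (Suc n)
      with assms(1) obtain z where "claim (PrimRec p' q) (n # xs') z \<in> S" "claim q (z # n # xs') y \<in> S"
        unfolding PrimRec Cons
        by (auto simp: justified_def justified_item_def list_encode.simps(2)[symmetric] simp del: list_encode.simps)
      then show ?thesis unfolding PrimRec Cons Suc by (blast intro: run_PrimRec_Suc S)
    qed
  qed
next
  case (Mu p')
  from assms(1) have 1: "claim p' (y # xs) 0 \<in> S"
    and 2: "\<forall>m<y. \<exists>s\<in>S. psnd (psnd s) \<noteq> 0 \<and> claim p' (m # xs) (psnd (psnd s)) \<in> S"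
    unfolding Mu
    by (auto simp: justified_def justified_item_def list_encode.simps(2)[symmetric] simp del: list_encode.simps)
  from 2 have "\<exists>z. claim p' (m # xs) (Suc z) \<in> S" if "m < y" for m
    using that by (metis not0_implies_Suc)
  then show ?thesis unfolding Mu by (intro run_Mu S[OF 1]) (metis S)
qed

lemma trace_run0: "trace L \<Longrightarrow> claim p xs y \<in> set L \<Longrightarrow> run0 p xs y"
proof (induction L arbitrary: p xs y rule: rev_induct)
  case (snoc e L)
  from trace_butlast[OF snoc.prems(1)] have "trace L" "justified (set L) e" by auto
  then show ?case using snoc.prems(2) snoc.IH justified_run0[of "set L"] by auto
qed simp

text \<open>Kleene's T-predicate on the diagonal: \<open>t\<close> codes a trace containing a claim
  about program \<open>e\<close> on its own code. Positions in \<open>t\<close> are quantified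
  instead of list members, which keeps all quantifiers bounded by numbers.\<close>

definition halts_by :: "nat \<Rightarrow> nat \<Rightarrow> bool" where
  "halts_by e t \<longleftrightarrow>
     (\<forall>j<code_length t. justified (code_nth t ` {..<j}) (code_nth t j)) \<and>
     (\<exists>j<code_length t. pfst (code_nth t j) = e \<and> pfst (psnd (code_nth t j)) = list_encode [e])"

lemma halts_by_prog_code: "(\<exists>t. halts_by (prog_code p) t) \<longleftrightarrow> (\<exists>y. run0 p [prog_code p] y)"
proof -
  have *: "(!) L ` {..<j} = set (take j L)" if "j < length L" for j and L :: "nat list"
    using that nth_image[of j L] by (auto simp: lessThan_atLeast0)
  have **: "halts_by e (list_encode L) \<longleftrightarrow>
      trace L \<and> (\<exists>y. item e (list_encode [e]) y \<in> set L)" for e L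
  proof -
    have "(\<exists>j<length L. pfst (L ! j) = e \<and> pfst (psnd (L ! j)) = a)
        \<longleftrightarrow> (\<exists>s\<in>set L. pfst s = e \<and> pfst (psnd s) = a)" for a
      by (auto simp: set_conv_nth Bex_def)
    also have "(\<exists>s\<in>set L. pfst s = e \<and> pfst (psnd s) = a) \<longleftrightarrow> (\<exists>y. item e a y \<in> set L)" for a
      by (metis item_def item_sel(1,2) prod.collapse prod_decode_inverse prod_encode_inverse fst_conv)
    finally show ?thesis
      unfolding halts_by_def trace_def by (simp add: * del: list_encode.simps cong: conj_cong)
  qed
  show ?thesis
  proof
    assume "\<exists>t. halts_by (prog_code p) t"
    then obtain L where "halts_by (prog_code p) (list_encode L)" by (metis list_decode_inverse)
    then show "\<exists>y. run0 p [prog_code p] y" unfolding ** using trace_run0 by blast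
  next
    assume "\<exists>y. run0 p [prog_code p] y"
    then show "\<exists>t. halts_by (prog_code p) t"
      using run0_derivable ** unfolding derivable_def by blast
  qed
qed

lemma bex_image: "(\<exists>s\<in>f ` {..<j::nat}. P s) \<longleftrightarrow> (\<exists>i<j. P (f i))"
  and mem_image: "x \<in> f ` {..<j} \<longleftrightarrow> (\<exists>i<j. x = f i)"
  by auto

lemma cpred_halts_by [cf]: "cfun n a \<Longrightarrow> cfun n b \<Longrightarrow> cpred n (\<lambda>xs. halts_by (a xs) (b xs))"
proof (rule cpred_comp2[of halts_by])
  show "cpred 2 (\<lambda>xs. halts_by (xs ! 0) (xs ! 1))"
    unfolding halts_by_def justified_def justified_item_def item_def bex_image mem_image list_encode.simps
    by (intro cf; simp)
qed

section \<open>The subshift\<close>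

text \<open>Stage \<open>s\<close> of the enumeration of \<open>H\<close>, the diagonal halting set
  together with 0.\<close>

definition forbidden :: "nat \<Rightarrow> nat \<Rightarrow> bool" where
  "forbidden s k \<longleftrightarrow> k = 0 \<or> (\<exists>t\<le>s. halts_by k t)"

definition has_pattern :: "nat \<Rightarrow> nat \<Rightarrow> binseq \<Rightarrow> bool" where
  "has_pattern k p x \<longleftrightarrow> \<not> x p \<and> (\<forall>j\<le>k. \<not> x (p + 2 * j + 1)) \<and> \<not> x (p + 2 * k + 2)"

text \<open>The bounds on \<open>k\<close> and \<open>p\<close> make this a finite search, so
  \<open>bad\<close> is computable; \<open>badI\<close> gives access without them.\<close>

definition bad :: "nat \<Rightarrow> nat \<Rightarrow> binseq \<Rightarrow> bool" where
  "bad s m x \<longleftrightarrow> (\<exists>k<m. \<exists>p<m. p + 2 * k + 2 < m \<and> forbidden s k \<and> has_pattern k p x)"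

text \<open>The stage is a function of the length. Thus \<open>valid m\<close> is decided by the
  first \<open>m\<close> symbols, and it is antitone in \<open>m\<close> because both length and
  stage grow.\<close>

definition valid :: "nat \<Rightarrow> binseq \<Rightarrow> bool" where
  "valid m x \<longleftrightarrow> \<not> bad (tri_root m) m x"

definition attr :: "binseq set" where
  "attr = {x. \<forall>m. valid m x}"

definition agree :: "nat \<Rightarrow> binseq \<Rightarrow> binseq \<Rightarrow> bool" where
  "agree m x y \<longleftrightarrow> (\<forall>i<m. x i = y i)"

lemma agree_sym: "agree m x y \<Longrightarrow> agree m y x"
  and agree_mono: "agree m x y \<Longrightarrow> m' \<le> m \<Longrightarrow> agree m' x y"
  by (auto simp: agree_def)

lemma tri_root_mono: "m \<le> n \<Longrightarrow> tri_root m \<le> tri_root n"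
  using tri_root_le[of m] less_tri_root[of n] triangle_mono[of "Suc (tri_root n)" "tri_root m"]
  by linarith

lemma forbidden_mono: "forbidden s k \<Longrightarrow> s \<le> s' \<Longrightarrow> forbidden s' k"
  unfolding forbidden_def using le_trans by blast

lemma badI: "has_pattern k p x \<Longrightarrow> forbidden s k \<Longrightarrow> p + 2 * k + 2 < m \<Longrightarrow> bad s m x"
  unfolding bad_def by (rule exI[of _ k], rule conjI, simp, rule exI[of _ p]) simp

lemma badE:
  assumes "bad s m x"
  obtains k p where "has_pattern k p x" "forbidden s k" "p + 2 * k + 2 < m"
  using assms unfolding bad_def by blast

lemma has_pattern_cong:
  assumes "has_pattern k p x" "\<And>d. d \<le> 2 * k + 2 \<Longrightarrow> x (p + d) = y (q + d)"
  shows "has_pattern k q y"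
  using assms(1) assms(2)[of 0] assms(2)[of "2 * j + 1" for j] assms(2)[of "2 * k + 2"]
  unfolding has_pattern_def by (simp add: add.assoc)

lemma bad_cong: "bad s m x \<Longrightarrow> agree m x y \<Longrightarrow> bad s m y"
  by (erule badE, rule badI, erule has_pattern_cong) (auto simp: agree_def)

lemma bad_mono: "bad s m x \<Longrightarrow> s \<le> s' \<Longrightarrow> m \<le> m' \<Longrightarrow> bad s' m' x"
  by (erule badE) (auto intro: badI forbidden_mono)

lemma valid_cong: "agree m x y \<Longrightarrow> valid m x \<longleftrightarrow> valid m y"
  unfolding valid_def using bad_cong agree_sym by blast

lemma valid_antimono: "valid m x \<Longrightarrow> m' \<le> m \<Longrightarrow> valid m' x"
  unfolding valid_def using bad_mono tri_root_mono by blast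

lemma valid_small: "m \<le> 2 \<Longrightarrow> valid m x"
  unfolding valid_def by (auto elim: badE)

lemma tri_root_triangle: "tri_root (triangle s) = s"
  by (rule tri_root_eqI) auto

lemma attr_iff: "x \<in> attr \<longleftrightarrow> (\<forall>s k p. forbidden s k \<longrightarrow> \<not> has_pattern k p x)"
proof
  assume x: "x \<in> attr"
  show "\<forall>s k p. forbidden s k \<longrightarrow> \<not> has_pattern k p x"
  proof (intro allI impI notI)
    fix s k p assume "forbidden s k" "has_pattern k p x"
    moreover have "s \<le> tri_root (triangle s + (p + 2 * k + 3))"
      using tri_root_mono[of "triangle s" "triangle s + (p + 2 * k + 3)"] tri_root_triangle by simp
    ultimately have "bad (tri_root (triangle s + (p + 2 * k + 3))) (triangle s + (p + 2 * k + 3)) x"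
      by (intro badI[OF _ forbidden_mono]) auto
    with x show False unfolding attr_def valid_def by blast
  qed
next
  assume "\<forall>s k p. forbidden s k \<longrightarrow> \<not> has_pattern k p x"
  then show "x \<in> attr" unfolding attr_def valid_def by (blast elim: badE)
qed

text \<open>Of two adjacent positions strictly inside the span, one has odd offset and therefore
  carries a zero.\<close>

lemma pattern_no_cross:
  assumes "has_pattern k p x" "x q" "x (Suc q)"
  shows "Suc q < p \<or> p + 2 * k + 2 < q"
proof (rule ccontr)
  assume *: "\<not> ?thesis"
  have e: "\<not> x (p + 2 * j + 1)" if "j \<le> k" for j using assms(1) that by (simp add: has_pattern_def)
  have "p \<noteq> q" "Suc q \<noteq> p" "q \<noteq> p + 2 * k + 2" using assms by (auto simp: has_pattern_def)
  with * have q: "p < q" "q < p + 2 * k + 2" by auto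
  then obtain d where d: "q = p + d" "0 < d" by (auto simp: less_iff_Suc_add)
  show False
  proof (cases "even d")
    case True
    then obtain j where "d = 2 * j" by blast
    then show False using e[of j] assms(3) q d by auto
  next
    case False
    then obtain j where "d = 2 * j + 1" by (rule oddE)
    then show False using e[of j] assms(2) q d by auto
  qed
qed

definition clock :: "binseq \<Rightarrow> nat" where
  "clock x = (LEAST m. \<not> valid (Suc m) x)"

lemma not_valid_Suc_clock:
  assumes "x \<notin> attr"
  shows "\<not> valid (Suc (clock x)) x"
proof -
  from assms obtain m where "\<not> valid m x" by (auto simp: attr_def)
  then have "\<not> valid (Suc (m - 1)) x" using valid_small[of 0 x] by (cases m) auto
  then show ?thesis unfolding clock_def by (rule LeastI)
qed

lemma valid_iff_le_clock:
  assumes "x \<notin> attr"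
  shows "valid m x \<longleftrightarrow> m \<le> clock x"
proof -
  note * = not_valid_Suc_clock[OF assms]
  show "valid m x \<longleftrightarrow> m \<le> clock x"
  proof
    assume "valid m x" then show "m \<le> clock x"
      using * valid_antimono[of m x "Suc (clock x)"] by (auto simp: not_less_eq_eq[symmetric])
  next
    assume "m \<le> clock x"
    then show "valid m x"
    proof (cases m)
      case (Suc m')
      with \<open>m \<le> clock x\<close> have "m' < clock x" by simp
      then show ?thesis unfolding Suc clock_def using not_less_Least by blast
    qed (simp add: valid_small)
  qed
qed

lemma clock_eqI: "valid n x \<Longrightarrow> \<not> valid (Suc n) x \<Longrightarrow> clock x = n"
  unfolding clock_def
  by (rule Least_equality) (assumption, metis valid_antimono not_less_eq_eq)

lemma clock_ge_2: "x \<notin> attr \<Longrightarrow> 2 \<le> clock x"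
  using valid_iff_le_clock valid_small by blast

text \<open>One symbol beyond the clock decides both that the point lies outside \<open>attr\<close>
  and what its clock is. Closedness of \<open>attr\<close> and continuity of the map rest on
  this.\<close>

lemma clock_cong:
  assumes "x \<notin> attr" "agree (Suc (clock x)) x y"
  shows "y \<notin> attr" "clock y = clock x"
proof -
  have "\<not> valid (Suc (clock x)) y" using assms not_valid_Suc_clock valid_cong by blast
  moreover have "valid (clock x) y"
    using assms valid_iff_le_clock[of x "clock x"] valid_cong agree_mono by (metis le_refl le_SucI)
  ultimately show "y \<notin> attr" "clock y = clock x"
    by (auto simp: attr_def intro: clock_eqI)
qed

section \<open>The letters written at each time\<close>

text \<open>It depends on the block only and is one less than the padding \<open>tri_root s\<close>
  of block \<open>s\<close>: the window may grow by one when the next block begins and is then still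
  covered by that padding.\<close>

definition window :: "nat \<Rightarrow> nat" where
  "window n = tri_root (tri_root n) - 1"

definition word :: "nat \<Rightarrow> binseq" where
  "word i j \<longleftrightarrow> odd (code_nth i j)"

definition piece :: "nat \<Rightarrow> nat \<Rightarrow> nat \<Rightarrow> bool" where
  "piece s i d \<longleftrightarrow> bad s (code_length i) (word i) \<or>
     d mod (code_length i + 2) < 2 \<or> word i (d mod (code_length i + 2) - 2)"

text \<open>
  Inside block \<open>s\<close> the coordinate \<open>b\<close> counts down from \<open>s\<close> to \<open>0\<close>. The piece of word \<open>i\<close> consists of the
  \<open>b\<close> with \<open>s div b = i + 1\<close>; it starts at \<open>b = s div (i + 1)\<close>.
\<close>

definition block_letter :: "nat \<Rightarrow> nat \<Rightarrow> bool" where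
  "block_letter s b \<longleftrightarrow> b < tri_root s \<or> b = 0 \<or>
     piece s (s div b - 1) (s div (s div b) - b)"

definition letter :: "nat \<Rightarrow> bool" where
  "letter n = block_letter (tri_root n) (psnd n)"

lemma psnd_eq: "psnd n = triangle (Suc (tri_root n)) - Suc n"
  using tri_root_le[of n] less_tri_root[of n] by (subst prod_decode_tri) simp

lemma tri_root_psnd_Suc:
  assumes "0 < psnd n"
  shows "tri_root (Suc n) = tri_root n" "psnd (Suc n) = psnd n - 1"
proof -
  show *: "tri_root (Suc n) = tri_root n"
    using assms tri_root_le[of n] unfolding psnd_eq by (intro tri_root_eqI) auto
  show "psnd (Suc n) = psnd n - 1" unfolding psnd_eq * by simp
qed

lemma tri_root_psnd_Suc_0:
  assumes "psnd n = 0"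
  shows "tri_root (Suc n) = Suc (tri_root n)" "psnd (Suc n) = Suc (tri_root n)"
proof -
  have **: "Suc n = triangle (Suc (tri_root n))"
    using assms less_tri_root[of n] unfolding psnd_eq by simp
  show *: "tri_root (Suc n) = Suc (tri_root n)"
    unfolding ** by (rule tri_root_triangle)
  show "psnd (Suc n) = Suc (tri_root n)" unfolding psnd_eq * unfolding ** by simp
qed

lemma psnd_le: "psnd n \<le> tri_root n"
  by (simp add: tri_root_def)

lemma block_letter_start: "block_letter s s"
  unfolding block_letter_def piece_def by (cases "s = 0") auto

text \<open>The \<open>b\<close> with a given quotient form an interval, and decreasing
  \<open>b\<close> enters the next nonempty one at its top, even if some quotients are skipped. So
  every piece starts with offset 0.\<close>

lemma div_div_step:
  assumes "1 < b" "b \<le> (s::nat)" "s div (b - 1) \<noteq> s div b"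
  shows "s div (s div (b - 1)) = b - 1"
proof (rule antisym)
  let ?i = "s div (b - 1)"
  have "s div b \<le> ?i" using assms(1) by (intro div_le_mono2) auto
  with assms(3) have lt: "s div b < ?i" by simp
  show "s div ?i \<le> b - 1"
  proof (rule ccontr)
    assume "\<not> s div ?i \<le> b - 1"
    then have "b \<le> s div ?i" using assms(1) by simp
    moreover have "0 < ?i" using lt by simp
    ultimately have "b * ?i \<le> s" by (simp add: less_eq_div_iff_mult_less_eq)
    then have "?i \<le> s div b" using assms(1) by (simp add: less_eq_div_iff_mult_less_eq mult.commute)
    with lt show False by simp
  qed
  show "b - 1 \<le> s div ?i"
    using lt by (simp add: less_eq_div_iff_mult_less_eq)
qed

lemma div_div_ge: "0 < b \<Longrightarrow> b \<le> (s::nat) \<Longrightarrow> b \<le> s div (s div b)"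
  by (simp add: less_eq_div_iff_mult_less_eq div_greater_zero_iff)

lemma block_offset_step:
  assumes "1 < b" "b \<le> (s::nat)"
  shows "s div (b - 1) = s div b \<and> s div (s div (b - 1)) - (b - 1) = Suc (s div (s div b) - b) \<or>
    s div (s div (b - 1)) - (b - 1) = 0"
  using div_div_step[OF assms] div_div_ge[of b s] assms by (cases "s div (b - 1) = s div b") auto

text \<open>If the piece is cut after the first letter of the separator, what follows is the start
  of another piece or padding, and either supplies the second 1.\<close>

lemma block_letter_11:
  assumes "0 < psnd n" "tri_root (tri_root n) \<le> psnd n"
    "let s = tri_root n; b = psnd n in (s div (s div b) - b) mod (code_length (s div b - 1) + 2) = 0"
  shows "letter n" "letter (Suc n)"
proof -
  let ?s = "tri_root n" let ?b = "psnd n"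
  show "letter n" using assms unfolding letter_def block_letter_def piece_def Let_def by auto
  have "block_letter ?s (?b - 1)"
  proof (cases "1 < ?b")
    case True
    from block_offset_step[OF this psnd_le]
    show ?thesis
    proof (elim disjE conjE)
      assume "?s div (?b - 1) = ?s div ?b" "?s div (?s div (?b - 1)) - (?b - 1) = Suc (?s div (?s div ?b) - ?b)"
      moreover have "Suc d mod (l + 2) < 2" if "d mod (l + 2) = 0" for d l :: nat
        using that by (simp add: mod_Suc)
      ultimately show ?thesis
        using assms(3) unfolding block_letter_def piece_def Let_def by (metis One_nat_def)
    next
      assume "?s div (?s div (?b - 1)) - (?b - 1) = 0"
      then show ?thesis unfolding block_letter_def piece_def by (metis mod_0 pos2)
    qed
  qed (use assms(1) in \<open>simp add: block_letter_def\<close>)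
  then show "letter (Suc n)"
    unfolding letter_def using tri_root_psnd_Suc[OF assms(1)] by simp
qed

text \<open>The letter of time \<open>n\<close> is letter number \<open>r\<close> in a copy of word \<open>i\<close>.\<close>

definition in_copy :: "nat \<Rightarrow> nat \<Rightarrow> nat \<Rightarrow> bool" where
  "in_copy n i r \<longleftrightarrow> (let s = tri_root n; b = psnd n in
     0 < b \<and> tri_root s \<le> b \<and> s div b = Suc i \<and> \<not> bad s (code_length i) (word i) \<and>
     r < code_length i \<and> (s div (s div b) - b) mod (code_length i + 2) = r + 2)"

lemma in_copy_letter: "in_copy n i r \<Longrightarrow> letter n = word i r"
  unfolding in_copy_def letter_def block_letter_def piece_def Let_def by auto

lemma not_letter_in_copy:
  assumes "\<not> letter n"
  shows "\<exists>i r. in_copy n i r"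
proof -
  let ?s = "tri_root n" let ?b = "psnd n"
  define i where "i = ?s div ?b - 1"
  define m where "m = (?s div (?s div ?b) - ?b) mod (code_length i + 2)"
  have b: "0 < ?b" "tri_root ?s \<le> ?b" and p: "\<not> piece ?s i (?s div (?s div ?b) - ?b)"
    using assms unfolding letter_def block_letter_def i_def by auto
  have "?s div ?b \<noteq> 0" using b psnd_le[of n] by (simp add: div_eq_0_iff)
  then have "?s div ?b = Suc i" unfolding i_def by simp
  moreover have "m < code_length i + 2" unfolding m_def by simp
  ultimately have "in_copy n i (m - 2)"
    using b p unfolding in_copy_def piece_def Let_def m_def[symmetric] by auto
  then show ?thesis by blast
qed

text \<open>Leaving a copy always goes through \<open>11\<close>: the separator of the next copy,
  the start of a new piece, or the padding. With \<open>pattern_no_cross\<close> this confines every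
  pattern to a single copy.\<close>

lemma in_copy_step:
  assumes "in_copy n i r"
  shows "in_copy (Suc n) i (Suc r) \<and> tri_root (Suc n) = tri_root n \<or> letter (Suc n) \<and> letter (Suc (Suc n))"
proof -
  let ?s = "tri_root n" let ?b = "psnd n"
  from assms have b: "0 < ?b" "tri_root ?s \<le> ?b" and i: "?s div ?b = Suc i"
    and w: "\<not> bad ?s (code_length i) (word i)" and r: "r < code_length i"
    and m: "(?s div (?s div ?b) - ?b) mod (code_length i + 2) = r + 2"
    unfolding in_copy_def Let_def by auto
  note s1 = tri_root_psnd_Suc[OF b(1)]
  show ?thesis
  proof (cases "?b - 1 < tri_root ?s \<or> ?b = 1")
    case True
    \<comment> \<open>With \<open>b = 1\<close> only one letter of the block is left; the second 1
      is then the first letter of the next block.\<close>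
    have "letter (Suc (Suc n))"
    proof (cases "?b = 1")
      case True
      with s1 have "psnd (Suc n) = 0" by simp
      from tri_root_psnd_Suc_0[OF this] show ?thesis
        unfolding letter_def by (simp add: block_letter_start)
    next
      case False
      with b s1 have "0 < psnd (Suc n)" by simp
      from tri_root_psnd_Suc[OF this] True False s1 show ?thesis
        unfolding letter_def block_letter_def by auto
    qed
    moreover have "letter (Suc n)"
      using True s1 unfolding letter_def block_letter_def by auto
    ultimately show ?thesis by simp
  next
    case False
    then have b1: "1 < ?b" "tri_root ?s \<le> ?b - 1" using b by auto
    let ?d = "?s div (?s div (?b - 1)) - (?b - 1)"
    from block_offset_step[OF b1(1) psnd_le] show ?thesis
    proof (elim disjE conjE)
      assume *: "?s div (?b - 1) = ?s div ?b" "?d = Suc (?s div (?s div ?b) - ?b)"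
      have md: "?d mod (code_length i + 2) = (if Suc r = code_length i then 0 else Suc r + 2)"
        using m r unfolding *(2) by (auto simp: mod_Suc)
      show ?thesis
      proof (cases "Suc r = code_length i")
        case True
        have "letter (Suc n)" "letter (Suc (Suc n))"
          by (rule block_letter_11; use s1 b1 * md True i in simp)+
        then show ?thesis by simp
      next
        case False
        then have "in_copy (Suc n) i (Suc r)"
          unfolding in_copy_def Let_def s1 using b1 *(1) i w r md by auto
        then show ?thesis using s1 by simp
      qed
    next
      assume "?d = 0"
      have "letter (Suc n)" "letter (Suc (Suc n))"
        by (rule block_letter_11; use s1 b1 \<open>?d = 0\<close> in simp)+
      then show ?thesis by simp
    qed
  qed
qed

text \<open>The slack of 3 leaves at least two ones between the window and the zeros at
  \<open>n - 1\<close>, \<open>n\<close>, \<open>n + 1\<close> of the image, so no pattern reaches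
  from one to the other.\<close>

lemma window_le: "window n = 0 \<or> window n + 3 \<le> n"
proof -
  have *: "triangle r \<ge> r + 3" if "r \<ge> 3" for r
    using that by (induction r rule: dec_induct) (auto simp: numeral_3_eq_3)
  show ?thesis
  proof (cases "tri_root n \<ge> 3")
    case True
    then show ?thesis
      using *[OF True] tri_root_le[of n] tri_root_le_self[of "tri_root n"] unfolding window_def by linarith
  next
    case False
    then have "tri_root (tri_root n) \<le> tri_root 2" by (intro tri_root_mono) simp
    also have "tri_root 2 = 1" by (rule tri_root_eqI) (auto simp: numeral_2_eq_2)
    finally show ?thesis unfolding window_def by simp
  qed
qed

lemma tri_root_Suc_le: "tri_root (Suc n) \<le> Suc (tri_root n)"
  using tri_root_psnd_Suc tri_root_psnd_Suc_0 by (metis le_Suc_eq neq0_conv order_refl)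

lemma letter_padding: "psnd n < tri_root (tri_root n) \<Longrightarrow> letter n"
  unfolding letter_def block_letter_def by simp

text \<open>The window is no longer than the preceding padding, so a zero that starts a pattern in
  it comes from the current block; the pattern then stays within one copy, whose word was tested at
  the stage of that block. The stage at \<open>Suc n\<close> differs from it only when the whole
  window consists of padding.\<close>

lemma letter_window_valid: "\<not> bad (tri_root (Suc n)) (window n) (\<lambda>j. letter (Suc n - window n + j))"
proof
  assume "bad (tri_root (Suc n)) (window n) (\<lambda>j. letter (Suc n - window n + j))"
  then obtain k p where kp: "has_pattern k p (\<lambda>j. letter (Suc n - window n + j))"
    "forbidden (tri_root (Suc n)) k" "p + 2 * k + 2 < window n"
    by (rule badE)
  define s where "s = tri_root n"
  define q where "q = Suc n - window n + p"
  have win: "window n + 3 \<le> n" using kp(3) window_le[of n] by auto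
  have qn: "q + 2 * k + 2 \<le> n" "n < q + window n" using win kp(3) unfolding q_def by auto
  have pat: "has_pattern k q letter"
    using kp(1) by (rule has_pattern_cong) (simp add: q_def algebra_simps)
  then have q: "\<not> letter q" by (simp add: has_pattern_def)
  have ws: "window n = tri_root s - 1" by (simp add: window_def s_def)
  have n: "triangle s \<le> n" "n < triangle (Suc s)"
    unfolding s_def by (rule tri_root_le, rule less_tri_root)
  have tq: "triangle s \<le> q"
  proof (rule ccontr)
    assume lt: "\<not> triangle s \<le> q"
    then obtain s' where s': "s = Suc s'" by (cases s) auto
    have w: "window n \<le> tri_root s'" unfolding ws s' using tri_root_Suc_le[of s'] by simp
    with tri_root_le_self[of s'] have "window n \<le> s'" by simp
    then have sq: "tri_root q = s'"
      using lt n qn unfolding s' by (intro tri_root_eqI) auto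
    have "letter q"
      by (rule letter_padding) (use n qn w lt in \<open>simp add: psnd_eq sq s'\<close>)
    with q show False by simp
  qed
  then have sq: "tri_root q = s" using n qn by (intro tri_root_eqI) auto
  have "tri_root (Suc n) = s"
  proof (rule ccontr)
    assume "tri_root (Suc n) \<noteq> s"
    then have "psnd n = 0" using tri_root_psnd_Suc(1)[of n] s_def by auto
    then have "psnd q < tri_root s" using n qn ws unfolding psnd_eq sq s_def[symmetric] by simp
    then show False using q letter_padding[of q] sq by simp
  qed
  with kp(2) have forb: "forbidden s k" by simp
  from not_letter_in_copy[OF q] obtain i r where ir: "in_copy q i r" by blast
  have copy: "in_copy (q + d) i (r + d) \<and> tri_root (q + d) = s" if "d \<le> 2 * k + 2" for d
    using that
  proof (induction d)
    case (Suc d)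
    then have IH: "in_copy (q + d) i (r + d)" "tri_root (q + d) = s" by auto
    from in_copy_step[OF IH(1)] show ?case
    proof
      assume "letter (Suc (q + d)) \<and> letter (Suc (Suc (q + d)))"
      with pattern_no_cross[OF pat, of "Suc (q + d)"] Suc.prems show ?thesis by simp
    qed (use IH in simp)
  qed (use ir sq in simp)
  have "has_pattern k r (word i)"
  proof (rule has_pattern_cong[OF pat])
    fix d assume "d \<le> 2 * k + 2"
    then show "letter (q + d) = word i (r + d)"
      using in_copy_letter copy[of d] by simp
  qed
  moreover have "r + 2 * k + 2 < code_length i"
    using copy[of "2 * k + 2"] unfolding in_copy_def Let_def by simp
  ultimately have "bad s (code_length i) (word i)"
    using forb by (intro badI)
  then show False using ir sq unfolding in_copy_def Let_def by simp
qed

section \<open>The map\<close>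

text \<open>
  \<open>bad\<close> tests the kept symbols followed by a zero. Turning a zero into a one never creates a pattern,
  so writing a one is always safe.
\<close>

definition new_letter :: "nat \<Rightarrow> binseq \<Rightarrow> bool" where
  "new_letter n x \<longleftrightarrow>
     letter n \<or> bad (tri_root (Suc n)) (window n) (\<lambda>i. Suc i < window n \<and> x (Suc i))"

text \<open>The three zeros at \<open>n - 1\<close>, \<open>n\<close>, \<open>n + 1\<close> set the clock of the image.\<close>

definition rewrite_at :: "nat \<Rightarrow> binseq \<Rightarrow> binseq" where
  "rewrite_at n x i \<longleftrightarrow>
     (if Suc i < window n then x (Suc i)
      else if Suc i = window n then new_letter n x
      else \<not> (n - 1 \<le> i \<and> i \<le> n + 1))"

definition attr_map :: "binseq \<Rightarrow> binseq" where
  "attr_map x = (if x \<in> attr then shift_map x else rewrite_at (clock x) x)"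

lemma shift_map_attr: "x \<in> attr \<Longrightarrow> shift_map x \<in> attr"
  unfolding attr_iff
proof (intro allI impI notI)
  fix s k p
  assume *: "\<forall>s k p. forbidden s k \<longrightarrow> \<not> has_pattern k p x" "forbidden s k"
    "has_pattern k p (shift_map x)"
  have "has_pattern k (Suc p) x"
    using *(3) by (rule has_pattern_cong) (simp add: shift_map_def)
  with * show False by blast
qed

text \<open>Below \<open>Suc n\<close> only two of the three final zeros are visible, and ones fill
  the gap between them and the window, so a pattern must lie in the window.\<close>

lemma bad_rewrite_cases:
  assumes "bad s m (rewrite_at n x)" "1 \<le> n" "m \<le> Suc n"
  shows "bad s (window n) (rewrite_at n x)"
  using assms(1)
proof (rule badE)
  let ?y = "rewrite_at n x"
  fix k p assume kp: "has_pattern k p ?y" "forbidden s k" "p + 2 * k + 2 < m"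
  have "\<not> ?y p" "\<not> ?y (p + 1)" "\<not> ?y (p + 2 * k + 2)"
    using kp(1) unfolding has_pattern_def by (auto dest: spec[of _ 0])
  have ones: "?y i" if "window n \<le> i" "i < n - 1" for i
    using that unfolding rewrite_at_def by auto
  have "p < n - 1" using kp(3) assms(3) by simp
  show "bad s (window n) ?y"
  proof (cases "p + 2 * k + 2 < window n")
    case True
    then show ?thesis using kp badI by blast
  next
    case False
    have "window n \<noteq> 0"
    proof
      assume "window n = 0"
      then show False using ones[of p] \<open>\<not> ?y p\<close> \<open>p < n - 1\<close> by simp
    qed
    then have w: "window n + 3 \<le> n" using window_le[of n] by simp
    have "?y (n - 3)" "?y (Suc (n - 3))" using w by (auto intro: ones)
    from pattern_no_cross[OF kp(1) this] show ?thesis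
    proof
      assume "Suc (n - 3) < p"
      then show ?thesis using kp(3) assms(3) w by simp
    next
      assume "p + 2 * k + 2 < n - 3"
      then have "?y (p + 2 * k + 2)" using False by (intro ones) auto
      with \<open>\<not> ?y (p + 2 * k + 2)\<close> show ?thesis by simp
    qed
  qed
qed

text \<open>The three zeros form pattern 0, which makes length \<open>n + 2\<close> invalid. At
  length \<open>n\<close> the image is valid at the old stage: either the new symbol is a zero that
  passed the test, or it is a one and any pattern would already occur in \<open>x\<close>, shifted
  by one. So the clock becomes \<open>n\<close> or \<open>n + 1\<close>, and it stands still exactly
  when the window violates the stage at \<open>n + 1\<close>.\<close>

lemma
  assumes "x \<notin> attr"
  defines "n \<equiv> clock x" and "y \<equiv> attr_map x"
  shows attr_map_not_in_attr: "y \<notin> attr"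
    and clock_attr_map: "clock y = (if bad (tri_root (Suc n)) (window n) y then n else Suc n)"
proof -
  have y: "y = rewrite_at n x" using assms by (simp add: attr_map_def)
  have n: "2 \<le> n" using clock_ge_2 assms by simp
  have 2: "\<not> valid (Suc (Suc n)) y"
  proof -
    have z: "\<not> y i" if "n - 1 \<le> i" "i \<le> n + 1" for i
      using that window_le[of n] n unfolding y rewrite_at_def by auto
    have "has_pattern 0 (n - 1) y" unfolding has_pattern_def using z n by auto
    then show ?thesis unfolding valid_def using n by (auto intro!: badI simp: forbidden_def)
  qed
  then show "y \<notin> attr" by (auto simp: attr_def)
  have 1: "valid (Suc n) y \<longleftrightarrow> \<not> bad (tri_root (Suc n)) (window n) y"
  proof -
    have "bad s (Suc n) y \<Longrightarrow> bad s (window n) y" for s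
      unfolding y by (rule bad_rewrite_cases[of s "Suc n"]) (use n in auto)
    moreover have "bad s (window n) y \<Longrightarrow> bad s (Suc n) y" for s
      by (rule bad_mono[of s "window n" y s]) (use window_le[of n] in auto)
    ultimately show ?thesis unfolding valid_def by blast
  qed
  have 0: "valid n y"
    unfolding valid_def
  proof
    assume "bad (tri_root n) n y"
    then have b: "bad (tri_root n) (window n) y"
      unfolding y using n by (intro bad_rewrite_cases[of _ n]) auto
    then have w: "window n \<noteq> 0" by (auto elim: badE)
    then have w3: "window n + 3 \<le> n" using window_le[of n] by simp
    show False
    proof (cases "y (window n - 1)")
      case False
      then have "\<not> new_letter n x" unfolding y rewrite_at_def using w by auto
      then have "\<not> bad (tri_root (Suc n)) (window n) (\<lambda>i. Suc i < window n \<and> x (Suc i))"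
        by (simp add: new_letter_def)
      moreover have "agree (window n) y (\<lambda>i. Suc i < window n \<and> x (Suc i))"
        unfolding agree_def y rewrite_at_def using \<open>\<not> new_letter n x\<close> by auto
      ultimately show False
        using b bad_cong bad_mono[of "tri_root n" "window n" y "tri_root (Suc n)" "window n"]
          tri_root_mono[of n "Suc n"] by auto
    next
      case True
      from b obtain k p where kp: "has_pattern k p y" "forbidden (tri_root n) k" "p + 2 * k + 2 < window n"
        by (rule badE)
      then have "p + 2 * k + 2 \<noteq> window n - 1" using True by (auto simp: has_pattern_def)
      with kp(3) have less: "p + 2 * k + 3 < window n" by simp
      have "has_pattern k (Suc p) x"
        using kp(1) by (rule has_pattern_cong) (use less in \<open>auto simp: y rewrite_at_def\<close>)
      then have "bad (tri_root n) n x" using kp(2) less w3 by (intro badI) auto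
      moreover have "valid n x" using valid_iff_le_clock assms by simp
      ultimately show False by (simp add: valid_def)
    qed
  qed
  show "clock y = (if bad (tri_root (Suc n)) (window n) y then n else Suc n)"
    using 0 1 2 by (auto intro: clock_eqI)
qed

lemma orbit_Suc: "(f ^^ Suc k) x = f ((f ^^ k) x)"
  by simp

lemma orbit_add: "(f ^^ (j + k)) x = (f ^^ j) ((f ^^ k) x)"
  by (simp add: funpow_add)

lemma orbit_not_in_attr: "x \<notin> attr \<Longrightarrow> (attr_map ^^ k) x \<notin> attr"
  by (induction k) (auto simp: attr_map_not_in_attr)

lemma clock_orbit_mono: "x \<notin> attr \<Longrightarrow> clock ((attr_map ^^ k) x) \<le> clock ((attr_map ^^ (k + j)) x)"
  by (induction j) (auto simp: clock_attr_map orbit_not_in_attr intro: le_SucI)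

text \<open>As long as the clock stands still, only ones are appended: a zero is appended only if
  the window passes the test, and then the clock advances. After \<open>window n\<close> steps the
  window is all ones and carries no pattern.\<close>

lemma clock_advances:
  assumes "x \<notin> attr"
  shows "\<exists>j\<le>Suc (window (clock x)). clock x < clock ((attr_map ^^ j) x)"
proof (rule ccontr)
  define n where "n = clock x"
  assume "\<not> ?thesis"
  then have stall: "clock ((attr_map ^^ j) x) = n" if "j \<le> Suc (window n)" for j
    using clock_orbit_mono[OF assms, of 0 j] that unfolding n_def by (force simp: not_less)
  have ones: "\<forall>i<window n. window n \<le> i + j \<longrightarrow> (attr_map ^^ j) x i" if "j \<le> window n" for j
    using that
  proof (induction j)
    case (Suc j)
    let ?y = "(attr_map ^^ j) x"
    have y: "?y \<notin> attr" "clock ?y = n" using assms Suc.prems by (auto simp: orbit_not_in_attr stall)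
    have eq: "(attr_map ^^ Suc j) x = rewrite_at n ?y" using y by (simp add: attr_map_def)
    have "clock (attr_map ?y) = n" using stall[of "Suc j"] Suc.prems by simp
    then have b: "bad (tri_root (Suc n)) (window n) (rewrite_at n ?y)"
      using clock_attr_map[OF y(1)] y eq by (simp split: if_splits)
    have "new_letter n ?y"
    proof (rule ccontr)
      assume "\<not> new_letter n ?y"
      then have "agree (window n) (rewrite_at n ?y) (\<lambda>i. Suc i < window n \<and> ?y (Suc i))"
        unfolding agree_def rewrite_at_def by auto
      with b have "new_letter n ?y" unfolding new_letter_def using bad_cong by blast
      with \<open>\<not> new_letter n ?y\<close> show False by simp
    qed
    then show ?case using Suc unfolding eq rewrite_at_def by auto
  qed auto
  let ?y = "(attr_map ^^ window n) x"
  have y: "?y \<notin> attr" "clock ?y = n" using assms by (auto simp: orbit_not_in_attr stall)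
  have "clock (attr_map ?y) = n" using stall[of "Suc (window n)"] by simp
  then have "bad (tri_root (Suc n)) (window n) (rewrite_at n ?y)"
    using clock_attr_map[OF y(1)] y by (simp add: attr_map_def split: if_splits)
  then obtain k p where kp: "has_pattern k p (rewrite_at n ?y)" "p + 2 * k + 2 < window n"
    by (rule badE)
  then have "\<not> rewrite_at n ?y p" by (simp add: has_pattern_def)
  then show False using ones[of "window n"] kp(2) unfolding rewrite_at_def by auto
qed

text \<open>The delay at clock \<open>N\<close> is at most \<open>window N + 1\<close> steps
  whatever the point, so one \<open>J\<close> serves all points; strong attraction needs this
  uniformity.\<close>

lemma clock_unbounded: "\<exists>J. \<forall>x. x \<notin> attr \<longrightarrow> N \<le> clock ((attr_map ^^ J) x)"
proof (induction N)
  case (Suc N)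
  then obtain J where J: "\<And>x. x \<notin> attr \<Longrightarrow> N \<le> clock ((attr_map ^^ J) x)" by blast
  have "Suc N \<le> clock ((attr_map ^^ (J + Suc (window N))) x)" if x: "x \<notin> attr" for x
  proof (cases "clock ((attr_map ^^ J) x) = N")
    case True
    from clock_advances[OF orbit_not_in_attr[OF x], of J] obtain j
      where j: "j \<le> Suc (window N)" "N < clock ((attr_map ^^ (j + J)) x)"
      unfolding orbit_add True by blast
    then show ?thesis
      using clock_orbit_mono[OF x, of "J + j" "Suc (window N) - j"] by (simp add: add.commute)
  next
    case False
    with J[OF x] clock_orbit_mono[OF x, of J "Suc (window N)"] show ?thesis by simp
  qed
  then show ?case by blast
qed simp

text \<open>The clock rises by at most one per step, so it skips no value.\<close>

lemma clock_orbit_eq: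
  assumes "x \<notin> attr" "clock x \<le> N"
  shows "\<exists>k. clock ((attr_map ^^ k) x) = N"
proof -
  have ex: "\<exists>k. N \<le> clock ((attr_map ^^ k) x)" using clock_unbounded assms(1) by blast
  define k where "k = (LEAST k. N \<le> clock ((attr_map ^^ k) x))"
  have k: "N \<le> clock ((attr_map ^^ k) x)" unfolding k_def by (rule LeastI_ex[OF ex])
  have "clock ((attr_map ^^ k) x) \<le> N"
  proof (cases k)
    case 0
    then show ?thesis using assms by simp
  next
    case (Suc k')
    then have "clock ((attr_map ^^ k') x) < N" 
      using not_less_Least[of k' "\<lambda>k. N \<le> clock ((attr_map ^^ k) x)"]
      unfolding k_def by (simp add: not_le)
    then show ?thesis
      unfolding Suc orbit_Suc clock_attr_map[OF orbit_not_in_attr[OF assms(1)]] by auto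
  qed
  with k show ?thesis by (intro exI[of _ k]) simp
qed

section \<open>Every orbit outside the subshift eventually follows the letters\<close>

definition tracks :: "binseq \<Rightarrow> bool" where
  "tracks x \<longleftrightarrow> x \<notin> attr \<and> (\<forall>j<window (clock x). x j = letter (clock x - window (clock x) + j))"

lemma window_block: "tri_root (Suc n) = tri_root n \<Longrightarrow> window (Suc n) = window n"
  by (simp add: window_def)

lemma window_Suc_le_padding: "window (Suc n) \<le> tri_root (tri_root n)"
  using tri_root_Suc_le[of "tri_root n"] tri_root_mono[OF tri_root_Suc_le[of n]]
  unfolding window_def by linarith

lemma window_Suc_le: "window (Suc n) \<le> Suc (window n)"
  using window_Suc_le_padding[of n] unfolding window_def by linarith

lemma letter_end_of_block:
  assumes "tri_root (Suc n) \<noteq> tri_root n" "i \<le> n" "n < i + tri_root (tri_root n)"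
  shows "letter i"
proof -
  have "psnd n = 0" using assms(1) tri_root_psnd_Suc(1)[of n] by auto
  then have n: "Suc n = triangle (Suc (tri_root n))" using less_tri_root[of n] unfolding psnd_eq by simp
  have "tri_root i = tri_root n"
    using assms(2,3) n tri_root_le_self[of "tri_root n"] by (intro tri_root_eqI) auto
  then show ?thesis
    using assms(2,3) n by (intro letter_padding) (simp add: psnd_eq)
qed

text \<open>At the end of a block the image has only ones below \<open>n - 1\<close>. A new stage
  finds no pattern there, so the clock advances, and ones are also the letters of the padding, so
  tracking starts here whatever the past of the orbit.\<close>

lemma window_boundary:
  assumes ne: "tri_root (Suc n) \<noteq> tri_root n" and "x \<notin> attr" "clock x = n"
    and ones: "\<And>j. j < window n \<Longrightarrow> 0 < j \<Longrightarrow> x j"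
  shows "tracks (attr_map x) \<and> clock (attr_map x) = Suc n"
proof -
  let ?y = "attr_map x"
  have y: "?y = rewrite_at n x" using assms by (simp add: attr_map_def)
  have n2: "2 \<le> n" using clock_ge_2 assms by blast
  have "letter n"
  proof (rule letter_end_of_block[OF ne])
    have "tri_root 1 = 1" by (rule tri_root_eqI) auto
    moreover from this have "1 \<le> tri_root n" using tri_root_mono[of 1 n] n2 by simp
    ultimately show "n < n + tri_root (tri_root n)" using tri_root_mono[of 1 "tri_root n"] by simp
  qed simp
  then have y1: "?y j" if "j < window n \<or> j < n - 1" for j
    unfolding y rewrite_at_def new_letter_def using that ones[of "Suc j"] window_le[of n]
    by (auto split: if_splits)
  have "\<not> bad (tri_root (Suc n)) (window n) ?y"
  proof
    assume "bad (tri_root (Suc n)) (window n) ?y"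
    then obtain k p where "has_pattern k p ?y" "p + 2 * k + 2 < window n" by (rule badE)
    then show False using y1[of p] by (simp add: has_pattern_def)
  qed
  then have c: "clock ?y = Suc n" using clock_attr_map assms by simp
  have "?y j = letter (Suc n - window (Suc n) + j)" if j: "j < window (Suc n)" for j
  proof -
    have "window (Suc n) \<le> tri_root (tri_root n)"
      by (rule window_Suc_le_padding)
    moreover have "window (Suc n) \<le> n" using window_le[of "Suc n"] j by auto
    ultimately have "letter (Suc n - window (Suc n) + j)"
      using j by (intro letter_end_of_block[OF ne]) auto
    moreover have "?y j"
      using j window_Suc_le[of n] window_le[of n] n2 by (intro y1) auto
    ultimately show ?thesis by simp
  qed
  then show ?thesis using c attr_map_not_in_attr assms by (simp add: tracks_def)
qed

text \<open>Inside a block \<open>letter_window_valid\<close> says that \<open>letter n\<close>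
  passes the test, so it is written and the clock advances; at the end of a block
  \<open>window_boundary\<close> applies.\<close>

lemma tracks_step:
  assumes "tracks x"
  shows "tracks (attr_map x) \<and> clock (attr_map x) = Suc (clock x)"
proof -
  define n where "n = clock x"
  let ?y = "attr_map x"
  have x: "x \<notin> attr" "\<And>j. j < window n \<Longrightarrow> x j = letter (n - window n + j)"
    using assms by (auto simp: tracks_def n_def)
  show ?thesis
  proof (cases "tri_root (Suc n) = tri_root n")
    case False
    have "x j" if "j < window n" for j
      unfolding x(2)[OF that]
    proof (rule letter_end_of_block[OF False])
      show "n < n - window n + j + tri_root (tri_root n)" using that unfolding window_def by linarith
    qed (use that window_le[of n] in auto)
    then show ?thesis using window_boundary[OF False x(1)] n_def by blast
  next
    case True
    have y: "?y = rewrite_at n x" using x by (simp add: attr_map_def n_def)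
    have eq: "?y j = letter (Suc n - window n + j)" if j: "j < window n" for j
    proof (cases "Suc j < window n")
      case True
      then show ?thesis unfolding y rewrite_at_def using x(2)[of "Suc j"] window_le[of n]
        by (auto simp: Suc_diff_le)
    next
      case False
      with j have j: "Suc j = window n" by simp
      then have n: "Suc n - window n + j = n" using window_le[of n] by auto
      have "new_letter n x \<longleftrightarrow> letter n"
      proof
        assume *: "new_letter n x"
        show "letter n"
        proof (rule ccontr)
          assume nl: "\<not> letter n"
          with * have "bad (tri_root (Suc n)) (window n) (\<lambda>i. Suc i < window n \<and> x (Suc i))"
            by (simp add: new_letter_def)
          moreover have "agree (window n) (\<lambda>i. Suc i < window n \<and> x (Suc i)) (\<lambda>j. letter (Suc n - window n + j))"
            unfolding agree_def
          proof (intro allI impI)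
            fix i assume i: "i < window n"
            show "(Suc i < window n \<and> x (Suc i)) = letter (Suc n - window n + i)"
            proof (cases "Suc i < window n")
              case True
              then show ?thesis using x(2)[of "Suc i"] window_le[of n] by (auto simp: Suc_diff_le)
            next
              case False
              with i j have "i = j" by simp
              with nl n False show ?thesis by simp
            qed
          qed
          ultimately show False using letter_window_valid bad_cong by blast
        qed
      qed (simp add: new_letter_def)
      then show ?thesis using j unfolding n unfolding y rewrite_at_def by simp
    qed
    have "agree (window n) ?y (\<lambda>j. letter (Suc n - window n + j))"
      using eq by (simp add: agree_def)
    then have "\<not> bad (tri_root (Suc n)) (window n) ?y" using letter_window_valid bad_cong by blast
    then have "clock ?y = Suc n" using clock_attr_map x n_def by simp
    then show ?thesis
      using eq window_block[OF True] attr_map_not_in_attr x(1) by (simp add: tracks_def n_def)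
  qed
qed

text \<open>The orbit is followed from clock \<open>n0\<close>, where the padding of block
  \<open>s\<close> begins, to the end of the block. In between only ones are appended, also while
  the clock stands still, and \<open>window_boundary\<close> then takes over.\<close>

lemma eventually_tracks:
  assumes "x \<notin> attr"
  shows "\<exists>k. tracks ((attr_map ^^ k) x)"
proof -
  define s where "s = Suc (clock x)"
  define n0 where "n0 = triangle (Suc s) - tri_root s"
  have s1: "tri_root s \<le> s" by (rule tri_root_le_self)
  have "clock x \<le> triangle s" using le_triangle[of s] s_def by simp
  then have "clock x \<le> n0" using s1 unfolding n0_def by simp
  from clock_orbit_eq[OF assms this] obtain k1 where k1: "clock ((attr_map ^^ k1) x) = n0" by blast
  let ?z = "\<lambda>j. (attr_map ^^ (j + k1)) x"
  have z: "?z j \<notin> attr" for j by (rule orbit_not_in_attr[OF assms])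
  \<comment> \<open>The last \<open>clock y - n0\<close> symbols of the window are ones, written
    additively to avoid truncated subtraction. A step without progress of the clock only adds
    ones.\<close>
  define R where "R y \<longleftrightarrow> n0 \<le> clock y \<and> clock y < triangle (Suc s) \<and>
    (\<forall>j<window (clock y). window (clock y) + n0 \<le> j + clock y \<longrightarrow> y j)" for y
  have n0: "n0 < triangle (Suc s)" "triangle s \<le> n0"
    using s1 tri_root_mono[of 1 s] tri_root_eqI[of 1 1] unfolding n0_def s_def by auto
  have step: "R (?z (Suc j)) \<or> tracks (?z (Suc j))" if "R (?z j)" for j
  proof -
    let ?y = "?z j"
    define n where "n = clock ?y"
    have n: "n0 \<le> n" "n < triangle (Suc s)"
      and ones: "\<And>j. j < window n \<Longrightarrow> window n + n0 \<le> j + n \<Longrightarrow> ?y j"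
      using that by (auto simp: R_def n_def)
    have sn: "tri_root n = s" using n n0 by (intro tri_root_eqI) auto
    show ?thesis
    proof (cases "tri_root (Suc n) = tri_root n")
      case False
      then have "psnd n = 0" using tri_root_psnd_Suc(1)[of n] by auto
      then have n': "Suc n = triangle (Suc s)" using n(2) sn unfolding psnd_eq by simp
      have "window n = tri_root s - 1" by (simp add: window_def sn)
      then have "?y j" if "j < window n" "0 < j" for j
        using that n' s1 le_triangle[of "Suc s"] n0_def by (intro ones) linarith+
      from window_boundary[OF False z _ this] show ?thesis using n_def by simp
    next
      case True
      have "psnd n < tri_root s" using n unfolding psnd_eq sn n0_def by simp
      then have "letter n" using letter_padding sn by simp
      then have "new_letter n ?y" by (simp add: new_letter_def)
      have eq: "?z (Suc j) = rewrite_at n ?y" using z by (simp add: attr_map_def n_def)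
      have c: "clock (?z (Suc j)) = n \<or> clock (?z (Suc j)) = Suc n"
        using clock_attr_map[OF z, of j] by (auto simp: n_def)
      have "Suc n < triangle (Suc s)"
        using True sn less_tri_root[of "Suc n"] by simp
      moreover have "?z (Suc j) i" if "i < window n" "window n + n0 \<le> i + Suc n" for i
        unfolding eq rewrite_at_def using that \<open>new_letter n ?y\<close> ones[of "Suc i"] by auto
      ultimately have "R (?z (Suc j))"
        unfolding R_def using c n window_block[OF True] by auto
      then show ?thesis by simp
    qed
  qed
  have "R (?z j) \<or> (\<exists>i. tracks (?z i))" for j
  proof (induction j)
    case 0
    then show ?case unfolding R_def using k1 n0 by simp
  qed (use step in blast)
  \<comment> \<open>\<open>R\<close> bounds the clock by the end of the block, so it cannot
    persist.\<close>
  moreover obtain J where "triangle (Suc s) \<le> clock ((attr_map ^^ J) x)"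
    using clock_unbounded assms by blast
  then have "\<not> R (?z J)"
    using clock_orbit_mono[OF assms, of J k1] unfolding R_def by simp
  ultimately show ?thesis by blast
qed

lemma tracks_orbit:
  assumes "tracks x"
  shows "tracks ((attr_map ^^ k) x)" "clock ((attr_map ^^ k) x) = clock x + k"
  using assms tracks_step by (induction k) auto

section \<open>Topology of the symbolic space\<close>

lemma agree_refl: "agree m x x"
  by (simp add: agree_def)

lemma open_cylinder: "open {y. agree m x y}"
proof -
  have "open {f :: binseq. \<forall>i\<in>{..<m}. f i \<in> {x i}}"
    by (rule product_topology_basis') (auto simp: Topological_Spaces.open_discrete)
  also have "{f :: binseq. \<forall>i\<in>{..<m}. f i \<in> {x i}} = {y. agree m x y}"
    by (auto simp: agree_def)
  finally show ?thesis .
qed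

lemma open_iff_cylinder: "open U \<longleftrightarrow> (\<forall>x\<in>U. \<exists>m. \<forall>y. agree m x y \<longrightarrow> y \<in> U)"
proof
  assume U: "open U"
  show "\<forall>x\<in>U. \<exists>m. \<forall>y. agree m x y \<longrightarrow> y \<in> U"
  proof
    fix x assume "x \<in> U"
    with U have "openin (product_topology (\<lambda>i. euclidean) UNIV) U" "x \<in> U"
      unfolding open_fun_def by auto
    from product_topology_open_contains_basis[OF this]
    obtain X where X: "x \<in> (\<Pi>\<^sub>E i\<in>UNIV. X i)" "finite {i. X i \<noteq> UNIV}" "(\<Pi>\<^sub>E i\<in>UNIV. X i) \<subseteq> U"
      by auto
    obtain m where m: "\<And>i. X i \<noteq> UNIV \<Longrightarrow> i < m"
      using X(2) finite_nat_iff_bounded[of "{i. X i \<noteq> UNIV}"] by blast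
    have "y \<in> U" if "agree m x y" for y
    proof -
      have "y i \<in> X i" for i
        using that PiE_mem[OF X(1), of i] m[of i] by (cases "X i = UNIV") (auto simp: agree_def)
      then show ?thesis using X(3) by auto
    qed
    then show "\<exists>m. \<forall>y. agree m x y \<longrightarrow> y \<in> U" by blast
  qed
next
  assume *: "\<forall>x\<in>U. \<exists>m. \<forall>y. agree m x y \<longrightarrow> y \<in> U"
  show "open U"
    unfolding open_subopen[of U]
  proof
    fix x assume "x \<in> U"
    with * obtain m where "\<forall>y. agree m x y \<longrightarrow> y \<in> U" by blast
    then show "\<exists>T. open T \<and> x \<in> T \<and> T \<subseteq> U"
      by (intro exI[of _ "{y. agree m x y}"] conjI open_cylinder) (simp_all add: agree_refl subset_iff)
  qed
qed

lemma compact_UNIV_binseq: "compact (UNIV :: binseq set)"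
proof -
  have "compact_space (product_topology (\<lambda>i::nat. euclidean :: bool topology) UNIV)"
    unfolding compact_space_product_topology by (simp add: compact_space_def finite_imp_compact)
  then show ?thesis unfolding euclidean_product_topology by (simp add: compact_space_def)
qed

lemma Baire_binseq:
  assumes "countable \<G>" "\<And>U. U \<in> \<G> \<Longrightarrow> open U \<and> closure U = (UNIV :: binseq set)"
  shows "closure (\<Inter>\<G>) = UNIV"
proof -
  have "compact_space (euclidean :: binseq topology)"
    using compact_UNIV_binseq by (simp add: compact_space_def)
  moreover have "Hausdorff_space (euclidean :: bool topology)"
    unfolding Hausdorff_space_def
  proof (intro allI impI)
    fix x y :: bool
    assume "x \<in> topspace euclidean \<and> y \<in> topspace euclidean \<and> x \<noteq> y"
    then show "\<exists>U V. openin euclidean U \<and> openin euclidean V \<and> x \<in> U \<and> y \<in> V \<and> disjnt U V"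
      by (intro exI[of _ "{x}"] exI[of _ "{y}"]) (simp add: Topological_Spaces.open_discrete)
  qed
  then have "Hausdorff_space (product_topology (\<lambda>i::nat. euclidean :: bool topology) UNIV)"
    by (simp add: Hausdorff_space_product_topology)
  ultimately have "locally_compact_space (euclidean :: binseq topology) \<and> regular_space (euclidean :: binseq topology)"
    unfolding euclidean_product_topology
    by (simp add: compact_imp_locally_compact_space compact_Hausdorff_imp_regular_space)
  then have "euclidean closure_of \<Inter>\<G> = topspace euclidean"
    using assms by (intro Baire_category) auto
  then show ?thesis by simp
qed

lemma continuous_agree:
  fixes f :: "binseq \<Rightarrow> real"
  assumes "continuous_on UNIV f" "0 < e"
  shows "\<exists>m. \<forall>x y. agree m x y \<longrightarrow> \<bar>f x - f y\<bar> < e"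
proof -
  have "\<exists>m. \<forall>y. agree m x y \<longrightarrow> \<bar>f y - f x\<bar> < e / 2" for x
  proof -
    have "open (f -` ball (f x) (e / 2))"
      using assms(1) by (simp add: continuous_on_open_vimage)
    then show ?thesis
      using assms(2) unfolding open_iff_cylinder by (force simp: dist_real_def abs_minus_commute)
  qed
  then obtain m where m: "\<And>x y. agree (m x) x y \<Longrightarrow> \<bar>f y - f x\<bar> < e / 2" by metis
  have "UNIV \<subseteq> (\<Union>x\<in>UNIV. {y. agree (m x) x y})" by (auto simp: agree_def)
  from compactE_image[OF compact_UNIV_binseq _ this]
  obtain C where C: "finite C" "UNIV \<subseteq> (\<Union>x\<in>C. {y. agree (m x) x y})"
    using open_cylinder by metis
  have "\<bar>f x - f y\<bar> < e" if "agree (\<Sum>x\<in>C. m x) x y" for x y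
  proof -
    from C(2) obtain z where z: "z \<in> C" "agree (m z) z x" by auto
    have "m z \<le> (\<Sum>x\<in>C. m x)" using C(1) z(1) by (simp add: member_le_sum)
    then have "agree (m z) z y" using that z(2) unfolding agree_def by auto
    then show ?thesis using m[OF z(2)] m[of z y] by linarith
  qed
  then show ?thesis by blast
qed

lemma continuous_onI_agree:
  fixes f :: "binseq \<Rightarrow> 'a::topological_space"
  assumes "\<And>x. \<exists>m. \<forall>y. agree m x y \<longrightarrow> f y = f x"
  shows "continuous_on UNIV f"
proof -
  have "open (f -` U)" if "open U" for U
    unfolding open_iff_cylinder
  proof
    fix x assume "x \<in> f -` U"
    moreover from assms obtain m where "\<forall>y. agree m x y \<longrightarrow> f y = f x" by blast
    ultimately show "\<exists>m. \<forall>y. agree m x y \<longrightarrow> y \<in> f -` U" by (intro exI[of _ m]) simp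
  qed
  then show ?thesis by (simp add: continuous_on_open_vimage)
qed

lemma continuous_bounded_binseq:
  fixes f :: "binseq \<Rightarrow> real"
  assumes "continuous_on UNIV f"
  shows "\<exists>M>0. \<forall>x. \<bar>f x\<bar> \<le> M"
proof -
  have "bounded (range f)"
    using compact_continuous_image[OF assms compact_UNIV_binseq] by (rule compact_imp_bounded)
  then show ?thesis unfolding bounded_pos by auto
qed

lemma continuous_map_agree:
  fixes T :: "binseq \<Rightarrow> binseq"
  assumes "\<And>m x. \<exists>n. \<forall>y. agree n x y \<longrightarrow> agree m (T x) (T y)"
  shows "continuous_on UNIV T"
proof -
  have "open (T -` U)" if "open U" for U
    unfolding open_iff_cylinder
  proof
    fix x assume "x \<in> T -` U"
    with that obtain m where m: "\<forall>y. agree m (T x) y \<longrightarrow> y \<in> U" unfolding open_iff_cylinder by auto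
    from assms obtain n where "\<forall>y. agree n x y \<longrightarrow> agree m (T x) (T y)" by blast
    with m show "\<exists>m. \<forall>y. agree m x y \<longrightarrow> y \<in> T -` U" by (intro exI[of _ n]) simp
  qed
  then show ?thesis by (simp add: continuous_on_open_vimage)
qed

section \<open>Continuity of the map\<close>

lemma shift_map_funpow: "(shift_map ^^ n) x = (\<lambda>i. x (n + i))"
  by (induction n arbitrary: x) (auto simp: shift_map_def fun_eq_iff)

lemma closed_attr: "closed attr"
  unfolding closed_def open_iff_cylinder
proof
  fix x assume "x \<in> - attr"
  then have "x \<notin> attr" by simp
  from clock_cong(1)[OF this] show "\<exists>m. \<forall>y. agree m x y \<longrightarrow> y \<in> - attr" by blast
qed

text \<open>Inverts the double root in \<open>window\<close>: a clock of at least
  \<open>modulus m\<close> leaves more than \<open>m\<close> symbols in the window, so the first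
  \<open>m\<close> output symbols are those of the shift.\<close>

definition modulus :: "nat \<Rightarrow> nat" where
  "modulus m = triangle (triangle (m + 2))"

lemma window_modulus: "window (modulus m) = Suc m"
  unfolding window_def modulus_def tri_root_triangle by simp

lemma window_mono: "m \<le> n \<Longrightarrow> window m \<le> window n"
  unfolding window_def using tri_root_mono by (meson diff_le_mono)

lemma modulus_ge: "m + 2 \<le> modulus m"
  unfolding modulus_def using le_triangle order_trans by blast

lemma mono_modulus: "mono modulus"
  unfolding modulus_def by (intro monoI triangle_mono) simp

lemma attr_map_shift:
  assumes "valid (modulus m) x" "i < m"
  shows "attr_map x i = x (Suc i)"
proof (cases "x \<in> attr")
  case False
  with assms have "modulus m \<le> clock x" by (simp add: valid_iff_le_clock)
  then have "Suc i < window (clock x)" using window_mono[of "modulus m" "clock x"] window_modulus assms(2) by simp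
  then show ?thesis using False by (simp add: attr_map_def rewrite_at_def)
qed (simp add: attr_map_def shift_map_def)

lemma rewrite_at_cong: "agree n x y \<Longrightarrow> 2 \<le> n \<Longrightarrow> rewrite_at n x = rewrite_at n y"
  unfolding rewrite_at_def new_letter_def agree_def fun_eq_iff using window_le[of n]
  by (auto cong: conj_cong if_cong)

text \<open>Membership in \<open>attr\<close> never has to be decided. A valid prefix of length
  \<open>modulus m\<close> forces the shift on the first \<open>m\<close> output symbols in either
  case; an invalid one determines the clock and contains all symbols that the rewriting reads. The
  algorithm in \<open>computable_attr_map\<close> makes the same distinction.\<close>

lemma attr_map_agree:
  assumes "agree (modulus m) x y"
  shows "agree m (attr_map x) (attr_map y)"
proof (cases "valid (modulus m) x")
  case True
  then have "valid (modulus m) y" using assms valid_cong by blast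
  with True show ?thesis
    using modulus_ge[of m] assms by (auto simp: agree_def attr_map_shift)
next
  case False
  then have x: "x \<notin> attr" by (auto simp: attr_def)
  with False have "Suc (clock x) \<le> modulus m" by (simp add: valid_iff_le_clock)
  with assms have a: "agree (Suc (clock x)) x y" by (rule agree_mono)
  from clock_cong[OF x a] have "y \<notin> attr" "clock y = clock x" by auto
  moreover have "rewrite_at (clock x) x = rewrite_at (clock x) y"
    using agree_mono[OF a] clock_ge_2[OF x] by (intro rewrite_at_cong) auto
  ultimately show ?thesis using x by (simp add: attr_map_def agree_def)
qed

lemma continuous_attr_map: "continuous_on UNIV attr_map"
  by (rule continuous_map_agree) (blast intro: attr_map_agree)

section \<open>Computability of the map and of the subshift\<close>

lemma computable_funI: "cfun 1 (\<lambda>xs. g (xs ! 0)) \<Longrightarrow> computable_fun g"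
  unfolding cfun_def computable_fun_def by (metis One_nat_def length_Cons list.size(3) nth_Cons_0)

text \<open>The zero oracle is simulated by \<open>Zero\<close>. Unlike \<open>Oracle\<close> it
  also halts on the empty list, so \<open>run_drop_oracle\<close> is an implication only.\<close>

primrec drop_oracle :: "prog \<Rightarrow> prog" where
  "drop_oracle Zero = Zero"
| "drop_oracle Succ = Succ"
| "drop_oracle (Proj i) = Proj i"
| "drop_oracle Oracle = Zero"
| "drop_oracle (Comp p qs) = Comp (drop_oracle p) (map drop_oracle qs)"
| "drop_oracle (PrimRec p q) = PrimRec (drop_oracle p) (drop_oracle q)"
| "drop_oracle (Mu p) = Mu (drop_oracle p)"

lemma run_drop_oracle: "run0 p xs y \<Longrightarrow> run f (drop_oracle p) xs y"
proof (induction rule: run.induct)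
  case (run_Comp xs qs ys p z)
  then show ?case
    by (auto simp: list_all2_conv_all_nth intro!: run.run_Comp[of f _ _ ys])
next
  case (run_Mu p n xs)
  then show ?case by (auto intro!: run.run_Mu)
qed (auto intro: run.intros)

lemma cfun_computable_fun:
  assumes "computable_fun g" shows "cfun 1 (\<lambda>xs. g (xs ! 0))"
proof -
  from assms obtain p where "\<And>n. run0 p [n] (g n)" by (auto simp: computable_fun_def)
  then show ?thesis
    by (intro cfunI[where p = "drop_oracle p"]) (auto simp: length_Suc_conv intro: run_drop_oracle)
qed

lemma cfun_computable_fun2:
  assumes "computable_fun2 g" shows "cfun 2 (\<lambda>xs. g (xs ! 0) (xs ! 1))"
proof -
  from assms obtain p where "\<And>m n. run0 p [m, n] (g m n)" by (auto simp: computable_fun2_def)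
  then show ?thesis
    by (intro cfunI[where p = "drop_oracle p"])
       (auto simp: length_Suc_conv numeral_2_eq_2 intro: run_drop_oracle)
qed

lemma cpred_word [cf]: "cfun n a \<Longrightarrow> cfun n b \<Longrightarrow> cpred n (\<lambda>xs. word (a xs) (b xs))"
  unfolding word_def by (intro cf)

lemma cpred_bad_word [cf]:
  "cfun n s \<Longrightarrow> cfun n m \<Longrightarrow> cfun n w \<Longrightarrow> cpred n (\<lambda>xs. bad (s xs) (m xs) (word (w xs)))"
proof (rule cpred_comp3[of "\<lambda>s m w. bad s m (word w)"])
  show "cpred 3 (\<lambda>xs. bad (xs ! 0) (xs ! 1) (word (xs ! 2)))"
    unfolding bad_def forbidden_def has_pattern_def by (intro cf; simp)
qed

lemma agree_word_initial: "agree m x (word (initial_word x m))"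
  unfolding agree_def word_def initial_word_def by auto

lemma agree_word_encode: "agree m X (word (list_encode (map (\<lambda>i. of_bool (X i)) [0..<m])))"
  using agree_word_initial unfolding initial_word_def .

lemma bad_agree: "agree m x y \<Longrightarrow> bad s m x \<longleftrightarrow> bad s m y"
  using bad_cong agree_sym by blast

lemma cpred_bad [cf]:
  assumes "cpred (Suc n) (\<lambda>ys. X (ys ! 0) (tl ys))" "cfun n s" "cfun n m"
  shows "cpred n (\<lambda>xs. bad (s xs) (m xs) (\<lambda>i. X i xs))"
proof (rule cpred_cong)
  show "cpred n (\<lambda>xs. bad (s xs) (m xs) (word (list_encode (map (\<lambda>i. of_bool (X i xs)) [0..<m xs]))))"
    by (intro cf assms)
qed (rule bad_agree[OF agree_sym[OF agree_word_encode]])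

lemma cpred_valid_word [cf]: "cfun n m \<Longrightarrow> cfun n w \<Longrightarrow> cpred n (\<lambda>xs. valid (m xs) (word (w xs)))"
  unfolding valid_def by (intro cf)

lemma cfun_window [cf]: "cfun n a \<Longrightarrow> cfun n (\<lambda>xs. window (a xs))"
  unfolding window_def by (intro cf)

lemma cpred_letter [cf]: "cfun n a \<Longrightarrow> cpred n (\<lambda>xs. letter (a xs))"
  unfolding letter_def block_letter_def piece_def by (intro cf)

lemma cpred_rewrite_at_word [cf]:
  "cfun n a \<Longrightarrow> cfun n w \<Longrightarrow> cfun n i \<Longrightarrow> cpred n (\<lambda>xs. rewrite_at (a xs) (word (w xs)) (i xs))"
proof (rule cpred_comp3[of "\<lambda>a w i. rewrite_at a (word w) i"])
  show "cpred 3 (\<lambda>xs. rewrite_at (xs ! 0) (word (xs ! 1)) (xs ! 2))"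
    unfolding rewrite_at_def new_letter_def by (intro cf; simp)
qed

lemma computable_attr_map: "computable_map attr_map"
proof -
  \<comment> \<open>On an invalid prefix the clock is at most \<open>modulus m\<close>, which bounds
    the search for it.\<close>
  define out where "out m w i \<longleftrightarrow>
    (if valid (modulus m) (word w) then word w (Suc i)
     else rewrite_at (bounded_least (modulus m) (\<lambda>n. \<not> valid (Suc n) (word w))) (word w) i)" for m w i
  have out: "out m w i = attr_map (word w) i" if "i < m" for m w i
  proof (cases "valid (modulus m) (word w)")
    case True
    then show ?thesis using that by (simp add: out_def attr_map_shift)
  next
    case False
    then have w: "word w \<notin> attr" by (auto simp: attr_def)
    with False have "clock (word w) \<le> modulus m" by (simp add: valid_iff_le_clock)
    then have "bounded_least (modulus m) (\<lambda>n. \<not> valid (Suc n) (word w)) = clock (word w)"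
      using w by (intro bounded_least_eqI) (auto simp: valid_iff_le_clock)
    then show ?thesis using False w by (simp add: out_def attr_map_def)
  qed
  have "cfun 1 (\<lambda>xs. modulus (xs ! 0))" unfolding modulus_def by (intro cf; simp)
  then have \<phi>: "computable_fun modulus" by (rule computable_funI)
  have "cfun 2 (\<lambda>xs. list_encode (map (\<lambda>i. of_bool (out (xs ! 0) (xs ! 1) i)) [0..<xs ! 0]))"
    unfolding out_def modulus_def by (intro cf; simp)
  then obtain p where p: "\<And>m w. run0 p [m, w] (list_encode (map (\<lambda>i. of_bool (out m w i)) [0..<m]))"
    by (force simp: cfun_def dest: spec[of _ "\<lambda>_. 0"] spec[of _ "[_, _]"])
  have "run0 p [m, initial_word x (modulus m)] (initial_word (attr_map x) m)" for m x
  proof -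
    have "out m (initial_word x (modulus m)) i = attr_map x i" if "i < m" for i
      using attr_map_agree[OF agree_word_initial, of m x] that by (simp add: out agree_def)
    then have "map (\<lambda>i. of_bool (out m (initial_word x (modulus m)) i) :: nat) [0..<m]
        = map (\<lambda>i. of_bool (attr_map x i)) [0..<m]" by simp
    then show ?thesis
      using p[of m "initial_word x (modulus m)"] unfolding initial_word_def[of "attr_map x"] by metis
  qed
  then show ?thesis unfolding computable_map_def using mono_modulus \<phi> by blast
qed

section \<open>Closed balls as cylinders and the outer collection of the subshift\<close>

lemma seq_dist_le_iff:
  assumes "x \<noteq> y"
  shows "seq_dist x y \<le> (1/2) ^ m \<longleftrightarrow> agree m x y"
proof -
  have "(LEAST n. x n \<noteq> y n) \<ge> m \<longleftrightarrow> agree m x y"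
  proof
    assume "m \<le> (LEAST n. x n \<noteq> y n)"
    then show "agree m x y" unfolding agree_def using not_less_Least less_le_trans by blast
  next
    assume a: "agree m x y"
    from assms have "\<exists>n. x n \<noteq> y n" by auto
    then have "x (LEAST n. x n \<noteq> y n) \<noteq> y (LEAST n. x n \<noteq> y n)" by (rule LeastI_ex)
    with a show "m \<le> (LEAST n. x n \<noteq> y n)" unfolding agree_def by (meson not_le)
  qed
  then show ?thesis using assms by (simp add: seq_dist_def power_decreasing_iff)
qed

text \<open>The least \<open>l\<close> with \<open>2^-l\<close> at most the radius
  \<open>(a + 1) / (b + 1)\<close>, written with integers; \<open>l = b + 1\<close> always
  qualifies. Positive distances are powers of 1/2, so the closed ball is a cylinder of this
  depth.\<close>

definition ball_depth :: "nat \<Rightarrow> nat" where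
  "ball_depth i = bounded_least (Suc (psnd (psnd i)))
     (\<lambda>l. Suc (psnd (psnd i)) \<le> Suc (pfst (psnd i)) * 2 ^ l)"

lemma ball_center_word: "ball_center i = word (pfst i)"
  by (auto simp: ball_center_def ideal_point_def word_def code_nth_def code_length_def fun_eq_iff)

lemma ideal_cball_eq: "ideal_cball i = {x. agree (ball_depth i) (word (pfst i)) x}"
proof -
  define a where "a = pfst (psnd i)"
  define b where "b = psnd (psnd i)"
  define P where "P l \<longleftrightarrow> Suc b \<le> Suc a * 2 ^ l" for l :: nat
  have r: "ball_radius i = real (Suc a) / real (Suc b)"
    by (simp add: ball_radius_def a_def b_def split: prod.splits)
  have "Suc b \<le> 2 ^ Suc b" using less_exp[of "Suc b"] by simp
  also have "\<dots> \<le> Suc a * 2 ^ Suc b" by simp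
  finally have Pb: "P (Suc b)" by (simp add: P_def)
  define l where "l = (LEAST l. P l)"
  have Pl: "P l" unfolding l_def using Pb by (rule LeastI)
  have l_le: "P d \<Longrightarrow> l \<le> d" for d unfolding l_def by (rule Least_le)
  have "ball_depth i = l"
    unfolding ball_depth_def a_def[symmetric] b_def[symmetric] P_def[symmetric]
    using Pl l_le Pb by (intro bounded_least_eqI) (auto simp: not_le[symmetric])
  have mono: "P d" if "l \<le> d" for d
  proof -
    have "Suc a * 2 ^ l \<le> Suc a * 2 ^ d" using that by (intro mult_le_mono2 power_increasing) auto
    with Pl show ?thesis unfolding P_def by linarith
  qed
  have half: "(1/2) ^ d \<le> ball_radius i \<longleftrightarrow> l \<le> d" for d
  proof -
    have "(1/2) ^ d \<le> ball_radius i \<longleftrightarrow> real (Suc b) \<le> real (Suc a) * 2 ^ d"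
      unfolding r by (simp add: field_simps)
    also have "\<dots> \<longleftrightarrow> real (Suc b) \<le> real (Suc a * 2 ^ d)" by (simp add: algebra_simps)
    also have "\<dots> \<longleftrightarrow> P d" unfolding P_def by (rule of_nat_le_iff)
    finally show ?thesis using mono l_le by blast
  qed
  have "seq_dist c x \<le> ball_radius i \<longleftrightarrow> agree l c x" for c x
  proof (cases "c = x")
    case True
    then show ?thesis by (simp add: seq_dist_def r agree_def)
  next
    case False
    have "seq_dist c x \<le> ball_radius i \<longleftrightarrow> seq_dist c x \<le> (1/2) ^ l"
      using False half by (simp add: seq_dist_def power_decreasing_iff)
    then show ?thesis using seq_dist_le_iff[OF False] by simp
  qed
  then show ?thesis
    unfolding ideal_cball_def ball_center_word \<open>ball_depth i = l\<close> by simp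
qed

text \<open>Continuing a word by ones creates no pattern, so a cylinder misses \<open>attr\<close>
  only if the word itself carries a forbidden pattern. A stage at which the pattern is recognised is
  the existential witness that \<open>\<Sigma>\<^sub>1\<close> asks for.\<close>

lemma outer_collection_attr:
  "outer_collection attr = {i. \<exists>s. bad s (ball_depth i) (word (pfst i))}"
proof -
  have "ideal_cball i \<inter> attr = {} \<longleftrightarrow> (\<exists>s. bad s (ball_depth i) (word (pfst i)))" for i
  proof
    let ?m = "ball_depth i" and ?c = "word (pfst i)"
    assume *: "ideal_cball i \<inter> attr = {}"
    define y where "y j \<longleftrightarrow> (j < ?m \<longrightarrow> ?c j)" for j
    have a: "agree ?m ?c y" by (simp add: agree_def y_def)
    with * have "y \<notin> attr" unfolding ideal_cball_eq by blast
    then obtain s k p where k: "forbidden s k" "has_pattern k p y" by (auto simp: attr_iff)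
    then have "\<not> y (p + 2 * k + 2)" by (simp add: has_pattern_def)
    then have "p + 2 * k + 2 < ?m" by (auto simp: y_def)
    with k have "bad s ?m y" by (intro badI)
    then show "\<exists>s. bad s ?m ?c" using bad_cong agree_sym[OF a] by blast
  next
    assume "\<exists>s. bad s (ball_depth i) (word (pfst i))"
    then obtain s where s: "bad s (ball_depth i) (word (pfst i))" ..
    show "ideal_cball i \<inter> attr = {}"
    proof (intro equals0I)
      fix x assume x: "x \<in> ideal_cball i \<inter> attr"
      with s have "bad s (ball_depth i) x" unfolding ideal_cball_eq using bad_cong by blast
      moreover have "x \<in> attr" using x by simp
      ultimately show False unfolding attr_iff by (meson badE)
    qed
  qed
  then show ?thesis by (simp add: outer_collection_def)
qed

lemma closed_cylinder: "closed {y. agree m x y}"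
  unfolding closed_def open_iff_cylinder by (intro ballI exI[of _ m]) (auto simp: agree_def)

lemma Pi_compact_attr: "Pi_compact 1 attr"
proof -
  let ?R = "{n. bad (psnd n) (ball_depth (pfst n)) (word (pfst (pfst n)))}"
  have "cfun 1 (\<lambda>xs. of_bool (\<not> bad (psnd (xs ! 0)) (ball_depth (pfst (xs ! 0))) (word (pfst (pfst (xs ! 0))))))"
    unfolding ball_depth_def by (intro cf; simp)
  then have "decidable (- ?R)"
    unfolding decidable_def by (intro computable_funI) simp
  moreover have "outer_collection attr = {i. \<exists>j. prod_encode (i, j) \<in> ?R}"
    by (simp add: outer_collection_attr)
  ultimately have "arith_Sigma 1 (outer_collection attr)"
    unfolding One_nat_def arith_Sigma.simps by blast
  moreover have "compact attr"
    using compact_Int_closed[OF compact_UNIV_binseq closed_attr] by simp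
  ultimately show ?thesis by (simp add: Pi_compact_def)
qed

text \<open>
  A \<open>\<Sigma>\<^sub>1\<close> outer collection can be enumerated without consulting the oracle at all, so every
  \<open>\<Pi>\<^sub>1\<close> compact set reduces to any other.
\<close>

lemma reducible_compact_Pi_1:
  assumes "Pi_compact 1 K'" shows "reducible_compact K' K"
proof -
  from assms obtain R where R: "decidable (- R)" "outer_collection K' = {i. \<exists>j. prod_encode (i, j) \<in> R}"
    unfolding Pi_compact_def One_nat_def arith_Sigma.simps by auto
  have "cpred 1 (\<lambda>xs. xs ! 0 \<in> - R)"
    unfolding cpred_def using R(1) unfolding decidable_def by (rule cfun_computable_fun)
  then have "cfun 1 (\<lambda>xs. if xs ! 0 \<in> - R then 0 else Suc (pfst (xs ! 0)))"
    by (rule cfun_if) (intro cf; simp)+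
  then obtain p where p': "\<And>f xs. length xs = 1 \<Longrightarrow> run f p xs (if xs ! 0 \<in> - R then 0 else Suc (pfst (xs ! 0)))"
    unfolding cfun_def by blast
  have p: "run f p [n] (if n \<in> R then Suc (pfst n) else 0)" for f n
    using p'[of "[n]" f] by (cases "n \<in> R") simp_all
  have "enumerates (\<lambda>n. if n \<in> R then Suc (pfst n) else 0) (outer_collection K')"
  proof -
    have "(\<exists>j. pair i j \<in> R) \<longleftrightarrow> (\<exists>n. (if n \<in> R then Suc (pfst n) else 0) = Suc i)" for i
    proof
      assume "\<exists>j. pair i j \<in> R"
      then obtain j where "pair i j \<in> R" ..
      then show "\<exists>n. (if n \<in> R then Suc (pfst n) else 0) = Suc i" by (intro exI[of _ "pair i j"]) simp
    next
      assume "\<exists>n. (if n \<in> R then Suc (pfst n) else 0) = Suc i"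
      then obtain n where "n \<in> R" "pfst n = i" by (auto split: if_splits)
      then show "\<exists>j. pair i j \<in> R" by (intro exI[of _ "psnd n"]) auto
    qed
    then show ?thesis by (simp add: enumerates_def R(2))
  qed
  with p show ?thesis
    unfolding reducible_compact_def
    by (intro exI[of _ p] allI impI exI[of _ "\<lambda>n. if n \<in> R then Suc (pfst n) else 0"] conjI)
qed

lemma Pi_complete_attr: "Pi_complete 1 attr"
  unfolding Pi_complete_def using Pi_compact_attr reducible_compact_Pi_1 by blast

section \<open>A measure supported on the subshift is not computable\<close>

inductive_cases run_ZeroE: "run f Zero xs y"
  and run_SuccE: "run f Succ xs y"
  and run_ProjE: "run f (Proj i) xs y"
  and run_OracleE: "run f Oracle xs y"
  and run_CompE: "run f (Comp p qs) xs y"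
  and run_PrimRec_0E: "run f (PrimRec p q) (0 # xs) y"
  and run_PrimRec_SucE: "run f (PrimRec p q) (Suc n # xs) y"
  and run_MuE: "run f (Mu p) xs y"

lemma run_deterministic: "run f p xs y \<Longrightarrow> run f p xs z \<Longrightarrow> y = z"
proof (induction arbitrary: z rule: run.induct)
  case (run_Comp xs qs ys p w)
  from run_Comp.prems obtain ys' where ys': "list_all2 (\<lambda>q y. run f q xs y) qs ys'" "run f p ys' z"
    by (rule run_CompE)
  have "ys = ys'"
    using run_Comp.IH(1) ys'(1) by (auto simp: list_all2_conv_all_nth intro!: nth_equalityI)
  with ys' run_Comp.IH(2) show ?case by blast
next
  case (run_Mu p n xs)
  from run_Mu.prems have z: "run f p (z # xs) 0" "\<And>m. m < z \<Longrightarrow> \<exists>y. run f p (m # xs) (Suc y)"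
    by (auto elim!: run_MuE)
  show ?case
  proof (cases n z rule: linorder_cases)
    case less
    with z(2) run_Mu.IH(1) show ?thesis by blast
  next
    case greater
    with z(1) run_Mu.IH(2) show ?thesis by blast
  qed
next
  case (run_PrimRec_0 p xs y q)
  from run_PrimRec_0.prems show ?case by (rule run_PrimRec_0E) (rule run_PrimRec_0.IH)
next
  case (run_PrimRec_Suc p q n xs y w)
  from run_PrimRec_Suc.prems obtain y' where "run f (PrimRec p q) (n # xs) y'" "run f q (y' # n # xs) z"
    by (rule run_PrimRec_SucE)
  with run_PrimRec_Suc.IH show ?case by blast
qed (auto elim: run_ZeroE run_SuccE run_ProjE run_OracleE)

definition pattern_word :: "nat \<Rightarrow> binseq" where
  "pattern_word k i \<longleftrightarrow> even i \<and> 0 < i \<and> i \<noteq> 2 * k + 2"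

text \<open>The radius is \<open>2^-(2k+2)\<close>; the strict inequality of the open ball adds one
  symbol, which gives the pattern length \<open>2k+3\<close>.\<close>

definition pattern_ball :: "nat \<Rightarrow> nat" where
  "pattern_ball k = pair (list_encode (map (\<lambda>i. of_bool (pattern_word k i)) [0..<2 * k + 3]))
     (pair 0 (2 ^ (2 * k + 2) - 1))"

lemma seq_dist_less_iff: "seq_dist x y < (1/2) ^ m \<longleftrightarrow> agree (Suc m) x y"
proof (cases "x = y")
  case False
  have "seq_dist x y < (1/2) ^ m \<longleftrightarrow> seq_dist x y \<le> (1/2) ^ Suc m"
    using False by (simp add: seq_dist_def power_strict_decreasing_iff Suc_le_eq
      power_decreasing_iff[of "1/2 :: real" _ "Suc m", simplified])
  then show ?thesis unfolding seq_dist_le_iff[OF False] .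
qed (simp add: seq_dist_def agree_def)

lemma ideal_ball_pattern: "ideal_ball (pattern_ball k) = {x. agree (2 * k + 3) (pattern_word k) x}"
proof -
  have "ball_radius (pattern_ball k) = (1/2) ^ (2 * k + 2)"
    by (simp add: ball_radius_def pattern_ball_def power_divide)
  then have "ideal_ball (pattern_ball k) = {x. agree (Suc (2 * k + 2)) (ball_center (pattern_ball k)) x}"
    unfolding ideal_ball_def by (simp only: seq_dist_less_iff)
  also have "Suc (2 * k + 2) = 2 * k + 3" by simp
  finally show ?thesis
    unfolding ball_center_word pattern_ball_def
    using agree_word_encode[of "2 * k + 3" "pattern_word k"] by (auto simp: agree_def)
qed

text \<open>Every pattern begins and ends with two adjacent zeros. The word of pattern
  \<open>k\<close> followed by ones has adjacent zeros only at 0 and at \<open>2k+1\<close>, so the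
  only pattern it can carry is \<open>k\<close> itself.\<close>

lemma pattern_ball_attr:
  assumes "0 < k"
  shows "ideal_ball (pattern_ball k) \<inter> attr \<noteq> {} \<longleftrightarrow> \<not> (\<exists>s. forbidden s k)"
proof
  assume "ideal_ball (pattern_ball k) \<inter> attr \<noteq> {}"
  then obtain x where x: "agree (2 * k + 3) (pattern_word k) x" "x \<in> attr"
    unfolding ideal_ball_pattern by blast
  have "has_pattern k 0 (pattern_word k)" by (auto simp: has_pattern_def pattern_word_def)
  then have "has_pattern k 0 x"
    by (rule has_pattern_cong) (use x(1) in \<open>auto simp: agree_def\<close>)
  with x(2) show "\<not> (\<exists>s. forbidden s k)" unfolding attr_iff by blast
next
  assume k: "\<not> (\<exists>s. forbidden s k)"
  define y where "y i \<longleftrightarrow> pattern_word k i \<or> 2 * k + 2 < i" for i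
  have "agree (2 * k + 3) (pattern_word k) y" by (auto simp: agree_def y_def)
  moreover have "y \<in> attr"
    unfolding attr_iff
  proof (intro allI impI notI)
    fix s k' p assume f: "forbidden s k'" and "has_pattern k' p y"
    then have p: "\<not> y p" "\<not> y (p + 1)" "\<not> y (p + 2 * k' + 1)" "\<not> y (p + 2 * k' + 2)"
      unfolding has_pattern_def by (auto dest: spec[of _ 0])
    have adj: "i = 0 \<or> i = 2 * k + 1" if "\<not> y i" "\<not> y (i + 1)" for i
      using that unfolding y_def pattern_word_def by (cases "even i") auto
    have "p = 0 \<or> p = 2 * k + 1" using adj p by blast
    moreover have "p + 2 * k' + 1 = 0 \<or> p + 2 * k' + 1 = 2 * k + 1" using adj[of "p + 2 * k' + 1"] p by simp
    ultimately have "k' = k" using assms by auto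
    with f k show False by blast
  qed
  ultimately show "ideal_ball (pattern_ball k) \<inter> attr \<noteq> {}"
    unfolding ideal_ball_pattern by blast
qed

text \<open>\<open>int_decode\<close> sends even numbers to the non-negative integers and odd
  numbers to the negative ones, so the sign of a coded rational is a parity test and hence
  computable.\<close>

lemma nat_to_rat_surj_pos:
  "0 < nat_to_rat_surj n \<longleftrightarrow>
     even (pfst n) \<and> 0 < pfst n \<and> even (psnd n) \<and> 0 < psnd n \<or> odd (pfst n) \<and> odd (psnd n)"
proof -
  have pos: "0 < int_decode m \<longleftrightarrow> even m \<and> 0 < m" for m
    by (auto simp: int_decode_def sum_decode_def elim!: evenE)
  have neg: "int_decode m < 0 \<longleftrightarrow> odd m" for m
    by (auto simp: int_decode_def sum_decode_def)
  show ?thesis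
    by (auto simp: nat_to_rat_surj_def Fract_of_int_quotient zero_less_divide_iff pos neg split: prod.splits)
qed

text \<open>
  If the measure were computable, the complement of the halting set would be semi-decidable:
  search for a positive lower bound of the measure of the cylinder of the \<open>k\<close>-th pattern.
\<close>

lemma not_computable_measure_supp_attr:
  assumes \<mu>: "prob_space \<mu>" "sets \<mu> = sets borel" "supp \<mu> = attr"
  shows "\<not> computable_measure \<mu>"
proof
  assume "computable_measure \<mu>"
  then obtain q where q: "computable_fun2 q"
    "\<And>is. (SUP k. ereal (real_of_rat (nat_to_rat_surj (q (list_encode is) k))))
              = ereal (measure \<mu> (\<Union>i\<in>set is. ideal_ball i))"
    unfolding computable_measure_def by blast
  interpret prob_space \<mu> by (rule \<mu>)
  define pos where "pos k j \<longleftrightarrow> 0 < nat_to_rat_surj (q (list_encode [pattern_ball k]) j)" for k j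
  have pos: "(\<exists>j. pos k j) \<longleftrightarrow> \<not> (\<exists>s. forbidden s k)" if "0 < k" for k
  proof -
    let ?B = "ideal_ball (pattern_ball k)"
    have "(\<exists>j. pos k j) \<longleftrightarrow> 0 < (SUP j. ereal (real_of_rat (nat_to_rat_surj (q (list_encode [pattern_ball k]) j))))"
      unfolding pos_def less_SUP_iff by simp
    also have "\<dots> \<longleftrightarrow> 0 < measure \<mu> ?B" unfolding q(2) by simp
    also have "\<dots> \<longleftrightarrow> 0 < emeasure \<mu> ?B" by (simp add: emeasure_eq_measure)
    also have "\<dots> \<longleftrightarrow> ?B \<inter> attr \<noteq> {}"
    proof
      assume "?B \<inter> attr \<noteq> {}"
      then obtain x where "x \<in> ?B" "x \<in> supp \<mu>" using \<mu>(3) by blast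
      moreover have "open ?B" unfolding ideal_ball_pattern by (rule open_cylinder)
      ultimately show "0 < emeasure \<mu> ?B" unfolding supp_def by blast
    next
      assume less: "0 < emeasure \<mu> ?B"
      show "?B \<inter> attr \<noteq> {}"
      proof
        assume "?B \<inter> attr = {}"
        then have "\<exists>U. open U \<and> x \<in> U \<and> emeasure \<mu> U = 0" if "x \<in> ?B" for x
          using that \<mu>(3) unfolding supp_def by (auto simp: zero_less_iff_neq_zero)
        then obtain U where U: "\<And>x. x \<in> ?B \<Longrightarrow> open (U x) \<and> x \<in> U x \<and> emeasure \<mu> (U x) = 0"
          by metis
        \<comment> \<open>The cylinder is compact, so finitely many of the null neighbourhoods cover
          it and it is null as well.\<close>
        have "closed ?B"
          unfolding ideal_ball_pattern by (rule closed_cylinder)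
        then have "compact ?B" using compact_Int_closed[OF compact_UNIV_binseq] by simp
        from compactE_image[OF this, of ?B U] U
        obtain C where C: "C \<subseteq> ?B" "finite C" "?B \<subseteq> \<Union>(U ` C)" by blast
        have sets: "U x \<in> sets \<mu>" if "x \<in> C" for x using U C(1) that \<mu>(2) by auto
        have "emeasure \<mu> (\<Union>(U ` C)) \<le> (\<Sum>x\<in>C. emeasure \<mu> (U x))"
          using sets C(2) by (intro emeasure_subadditive_finite) auto
        also have "\<dots> = 0" using U C by (intro sum.neutral) auto
        finally have "emeasure \<mu> ?B = 0"
          using emeasure_mono[OF C(3), of \<mu>] sets C(2) by (simp add: sets.finite_UN)
        with less show False by simp
      qed
    qed
    also have "\<dots> \<longleftrightarrow> \<not> (\<exists>s. forbidden s k)" by (rule pattern_ball_attr[OF that])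
    finally show ?thesis .
  qed
  note [cf] = cfun_comp2[OF cfun_computable_fun2[OF q(1)]]
  have "cpred 2 (\<lambda>xs. \<not> pos (xs ! 1) (xs ! 0))"
    unfolding pos_def nat_to_rat_surj_pos list_encode.simps pattern_ball_def pattern_word_def by (intro cf; simp)
  \<comment> \<open>\<open>Mu\<close> looks for the value 0, so \<open>r\<close> returns 0 on
    success.\<close>
  then obtain r where r: "\<And>j k. run0 r [j, k] (of_bool (\<not> pos k j))"
    unfolding cpred_def cfun_def by (force dest: spec[of _ "[_, _]"])
  have halt: "(\<exists>y. run0 (Mu r) [k] y) \<longleftrightarrow> (\<exists>j. pos k j)" for k
  proof
    assume "\<exists>y. run0 (Mu r) [k] y"
    then obtain y where "run0 r [y, k] 0" by (auto elim: run_MuE)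
    with r[of y k] have "of_bool (\<not> pos k y) = (0::nat)" by (rule run_deterministic)
    then show "\<exists>j. pos k j" by (auto split: if_splits)
  next
    assume ex: "\<exists>j. pos k j"
    define j where "j = (LEAST j. pos k j)"
    have "pos k j" unfolding j_def by (rule LeastI_ex[OF ex])
    then have "run0 r [j, k] 0" using r[of j k] by simp
    moreover have "\<exists>y. run0 r [m, k] (Suc y)" if "m < j" for m
      using that not_less_Least[of m "pos k"] r[of m k] unfolding j_def by (intro exI[of _ 0]) simp
    ultimately have "run0 (Mu r) [k] j" by (rule run_Mu)
    then show "\<exists>y. run0 (Mu r) [k] y" ..
  qed
  \<comment> \<open>Diagonal argument: the search program halts on its own code exactly when that
    code is not in \<open>H\<close>, that is, when it does not halt on it.\<close>
  define e where "e = prog_code (Mu r)"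
  have "0 < e" using le_prod_encode_1[of 7 "prog_code r"] by (simp add: e_def)
  then have "(\<exists>s. forbidden s e) \<longleftrightarrow> (\<exists>t. halts_by e t)"
    unfolding forbidden_def by auto
  also have "\<dots> \<longleftrightarrow> (\<exists>y. run0 (Mu r) [e] y)" unfolding e_def by (rule halts_by_prog_code)
  also have "\<dots> \<longleftrightarrow> \<not> (\<exists>s. forbidden s e)" unfolding halt using pos \<open>0 < e\<close> by blast
  finally show False by blast
qed

section \<open>Averages along the letters\<close>

lemma tri_root_at_top: "filterlim tri_root at_top sequentially"
  unfolding filterlim_at_top eventually_sequentially
  using tri_root_mono tri_root_triangle by metis

lemma tri_root_ratio: "(\<lambda>n. real (tri_root n) / real n) \<longlonglongrightarrow> 0"
proof (rule tendsto_sandwich[of "\<lambda>_. 0" _ _ "\<lambda>n. 2 / real (tri_root n)"])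
  have "real (tri_root n) / real n \<le> 2 / real (tri_root n)" for n
  proof (cases "tri_root n = 0")
    case False
    have "tri_root n * tri_root n \<le> 2 * triangle (tri_root n)" unfolding triangle_def by simp
    also have "\<dots> \<le> 2 * n" using tri_root_le[of n] by simp
    finally have "real (tri_root n) * real (tri_root n) \<le> 2 * real n"
      using of_nat_mono by fastforce
    moreover have "0 < n" using False tri_root_le_self[of n] by simp
    ultimately show ?thesis using False by (simp add: field_simps)
  qed simp
  then show "\<forall>\<^sub>F n in sequentially. real (tri_root n) / real n \<le> 2 / real (tri_root n)" by simp
  have "filterlim (\<lambda>n. real (tri_root n)) at_top sequentially"
    using tri_root_at_top filterlim_compose filterlim_real_sequentially by blast
  then show "(\<lambda>n. 2 / real (tri_root n)) \<longlonglongrightarrow> 0"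
    by (rule tendsto_divide_0[OF tendsto_const filterlim_at_top_imp_at_infinity])
qed auto

lemma const_ratio: "(\<lambda>n. c / real n) \<longlonglongrightarrow> 0"
  by (rule tendsto_divide_0[OF tendsto_const filterlim_at_top_imp_at_infinity[OF filterlim_real_sequentially]])

lemma real_div_le: "real (s div k) \<le> real s / real k"
proof (cases "k = 0")
  case False
  have "real (s div k * k) \<le> real s" using div_times_less_eq_dividend of_nat_le_iff by blast
  then show ?thesis using False by (simp add: field_simps)
qed simp

lemma div_ratio:
  assumes "0 < k"
  shows "(\<lambda>s. real (s div k) / real s) \<longlonglongrightarrow> 1 / real k"
proof (rule tendsto_sandwich)
  have bounds: "1 / real k - 1 / real s \<le> real (s div k) / real s \<and> real (s div k) / real s \<le> 1 / real k"
    if "0 < s" for s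
  proof -
    have "s div k * k \<le> s" "s \<le> s div k * k + k"
      using div_mult_mod_eq[of s k] mod_less_divisor[OF assms, of s] by linarith+
    then have "real (s div k) * real k \<le> real s" "real s \<le> real (s div k) * real k + real k"
      by (metis of_nat_le_iff of_nat_mult, metis of_nat_le_iff of_nat_mult of_nat_add)
    then have q: "real s / real k - 1 \<le> real (s div k)" "real (s div k) \<le> real s / real k"
      using assms by (simp_all add: field_simps)
    show ?thesis
      using divide_right_mono[OF q(1), of "real s"] divide_right_mono[OF q(2), of "real s"] that
      by (simp add: diff_divide_distrib)
  qed
  then show "\<forall>\<^sub>F s in sequentially. 1 / real k - 1 / real s \<le> real (s div k) / real s"
    "\<forall>\<^sub>F s in sequentially. real (s div k) / real s \<le> 1 / real k"
    by (auto intro: eventually_mono[OF eventually_gt_at_top[of 0]])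
  show "(\<lambda>s. 1 / real k - 1 / real s) \<longlonglongrightarrow> 1 / real k"
    using tendsto_diff[OF tendsto_const const_ratio] by fastforce
qed simp

lemma sum_lessThan_add:
  fixes g :: "nat \<Rightarrow> real"
  shows "(\<Sum>d<m + n. g d) = (\<Sum>d<m. g d) + (\<Sum>d<n. g (m + d))"
  by (induction n) auto

lemma abs_sum_bound:
  fixes g :: "nat \<Rightarrow> real"
  assumes "\<And>n. \<bar>g n\<bar> \<le> M"
  shows "\<bar>sum g A\<bar> \<le> real (card A) * M"
  by (rule order_trans[OF sum_abs sum_bounded_above]) (rule assms)

text \<open>Complete periods contribute their mean exactly; fewer than \<open>P\<close> terms
  remain, and each of them and its share of the mean are at most \<open>M\<close> in absolute
  value.\<close>

lemma periodic_sum_bound: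
  fixes h :: "nat \<Rightarrow> real"
  assumes per: "\<And>d. h (d + P) = h d" and P: "0 < P" and M: "\<And>d. \<bar>h d\<bar> \<le> M"
  defines "a \<equiv> (\<Sum>d<P. h d) / real P"
  shows "\<bar>(\<Sum>d<n. h d) - real n * a\<bar> \<le> 2 * M * real P"
proof -
  define q r where "q = n div P" and "r = n mod P"
  have n: "n = q * P + r" and r: "r < P" using P by (auto simp: q_def r_def)
  have per': "h (m * P + d) = h d" for m d
  proof (induction m)
    case (Suc m)
    have "h (Suc m * P + d) = h (m * P + d + P)" by (simp add: algebra_simps)
    then show ?case using per Suc.IH by simp
  qed simp
  have M0: "0 \<le> M" using M[of 0] by linarith
  have "(\<Sum>d<q * P. h d) = real q * (\<Sum>d<P. h d)"
  proof (induction q)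
    case (Suc q)
    have "(\<Sum>d<Suc q * P. h d) = (\<Sum>d<q * P + P. h d)" by (simp add: add.commute)
    also have "\<dots> = (\<Sum>d<q * P. h d) + (\<Sum>d<P. h d)" by (simp only: sum_lessThan_add per')
    finally show ?case using Suc.IH by (simp add: distrib_right)
  qed simp
  also have "\<dots> = real (q * P) * a" using P by (simp add: a_def)
  finally have 1: "(\<Sum>d<q * P. h d) = real (q * P) * a" .
  have "(\<Sum>d<n. h d) = (\<Sum>d<q * P. h d) + (\<Sum>d<r. h d)"
    unfolding n by (simp add: sum_lessThan_add per')
  then have "(\<Sum>d<n. h d) - real n * a = (\<Sum>d<r. h d) - real r * a"
    unfolding 1 by (simp add: n algebra_simps)
  moreover have "\<bar>\<Sum>d<r. h d\<bar> \<le> real r * M"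
    using abs_sum_bound[where A = "{..<r}", OF M] by simp
  moreover have "\<bar>real r * a\<bar> \<le> real r * M"
  proof -
    have "\<bar>a\<bar> \<le> M"
      using abs_sum_bound[where A = "{..<P}", OF M] P unfolding a_def by (simp add: field_simps)
    then show ?thesis by (simp add: abs_mult mult_left_mono)
  qed
  moreover have "real r * M \<le> real P * M" using r M0 by (intro mult_right_mono) auto
  ultimately have "\<bar>(\<Sum>d<n. h d) - real n * a\<bar> \<le> 2 * (real P * M)" by linarith
  then show ?thesis by (simp add: algebra_simps)
qed

text \<open>In block \<open>s\<close> the piece has length \<open>N s\<close>; up to offset
  \<open>F s\<close> the observable \<open>G\<close> is merely bounded, after that it is close to
  the periodic \<open>h\<close>. The error is at most
  \<open>2 * F s * M + e * s + 2 * M * P\<close>, and after division by \<open>s\<close> only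
  \<open>e\<close> survives in the limit.\<close>

lemma piece_average:
  fixes G :: "nat \<Rightarrow> nat \<Rightarrow> real"
  assumes per: "\<And>d. h (d + P) = h d" and P: "0 < P" and h: "\<And>d. \<bar>h d\<bar> \<le> M"
    and G: "\<And>s d. \<bar>G s d\<bar> \<le> M"
    and F: "(\<lambda>s. real (F s) / real s) \<longlonglongrightarrow> 0" and N: "(\<lambda>s. real (N s) / real s) \<longlonglongrightarrow> w"
    and N_le: "\<And>s. N s \<le> s"
    and near: "\<And>e. 0 < e \<Longrightarrow> \<forall>\<^sub>F s in sequentially. \<forall>d. F s \<le> d \<longrightarrow> d < N s \<longrightarrow> \<bar>G s d - h (d - F s)\<bar> \<le> e"
  defines "a \<equiv> (\<Sum>d<P. h d) / real P"
  shows "(\<lambda>s. (\<Sum>d<N s. G s d) / real s) \<longlonglongrightarrow> w * a"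
proof -
  have M0: "0 \<le> M" using h[of 0] by linarith
  have a: "\<bar>a\<bar> \<le> M"
    using abs_sum_bound[where A = "{..<P}", OF h] P unfolding a_def by (simp add: field_simps)
  have bound: "\<bar>(\<Sum>d<N s. G s d) - real (N s) * a\<bar> \<le> 2 * (real (F s) * M) + e * real s + 2 * M * real P"
    if e: "0 < e" and near: "\<forall>d. F s \<le> d \<longrightarrow> d < N s \<longrightarrow> \<bar>G s d - h (d - F s)\<bar> \<le> e" for s e
  proof (cases "N s \<le> F s")
    case True
    have "\<bar>\<Sum>d<N s. G s d\<bar> \<le> real (N s) * M" using abs_sum_bound[where A = "{..<N s}", OF G] by simp
    moreover have "\<bar>real (N s) * a\<bar> \<le> real (N s) * M" using a by (simp add: abs_mult mult_left_mono)
    moreover have "real (N s) * M \<le> real (F s) * M" using True M0 by (intro mult_right_mono) auto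
    moreover have "0 \<le> e * real s" "0 \<le> 2 * M * real P" using e M0 by auto
    ultimately show ?thesis by linarith
  next
    case False
    then obtain L where L: "N s = F s + L" using le_Suc_ex[of "F s" "N s"] by auto
    have "(\<Sum>d<N s. G s d) = (\<Sum>d<F s. G s d) + (\<Sum>d<L. G s (F s + d))"
      unfolding L by (rule sum_lessThan_add)
    moreover have "\<bar>\<Sum>d<F s. G s d\<bar> \<le> real (F s) * M" using abs_sum_bound[where A = "{..<F s}", OF G] by simp
    moreover have "\<bar>(\<Sum>d<L. G s (F s + d)) - (\<Sum>d<L. h d)\<bar> \<le> real L * e"
    proof -
      have "\<bar>(\<Sum>d<L. G s (F s + d)) - (\<Sum>d<L. h d)\<bar> \<le> (\<Sum>d<L. \<bar>G s (F s + d) - h d\<bar>)"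
        unfolding sum_subtractf[symmetric] by (rule sum_abs)
      also have "\<dots> \<le> real (card {..<L}) * e"
      proof (rule sum_bounded_above)
        fix d assume "d \<in> {..<L}"
        then show "\<bar>G s (F s + d) - h d\<bar> \<le> e" using near[rule_format, of "F s + d"] L by simp
      qed
      finally show ?thesis by simp
    qed
    moreover have "real L * e \<le> e * real s"
    proof -
      have "L \<le> s" using L N_le[of s] by simp
      then show ?thesis using e by (simp add: mult.commute)
    qed
    moreover have "\<bar>(\<Sum>d<L. h d) - real L * a\<bar> \<le> 2 * M * real P"
      unfolding a_def by (rule periodic_sum_bound) (rule per P h)+
    moreover have "\<bar>real (F s) * a\<bar> \<le> real (F s) * M" using a by (simp add: abs_mult mult_left_mono)
    moreover have "real (N s) * a = real (F s) * a + real L * a" by (simp add: L algebra_simps)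
    ultimately show ?thesis by linarith
  qed
  have "(\<lambda>s. (\<Sum>d<N s. G s d) / real s - real (N s) / real s * a) \<longlonglongrightarrow> 0"
  proof (rule tendstoI)
    fix e :: real assume e: "0 < e"
    have "(\<lambda>s. 2 * M * (real (F s) / real s) + 2 * M * real P / real s) \<longlonglongrightarrow> 2 * M * 0 + 0"
      by (intro tendsto_intros F const_ratio)
    then have "\<forall>\<^sub>F s in sequentially. 2 * M * (real (F s) / real s) + 2 * M * real P / real s < e / 2"
      using e by (intro order_tendstoD) auto
    moreover have "0 < e / 2" using e by simp
    note near[OF this]
    ultimately show "\<forall>\<^sub>F s in sequentially. dist ((\<Sum>d<N s. G s d) / real s - real (N s) / real s * a) 0 < e"
      using eventually_gt_at_top[of 0]
    proof eventually_elim
      case (elim s)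
      have "\<bar>(\<Sum>d<N s. G s d) - real (N s) * a\<bar> / real s \<le> (2 * (real (F s) * M) + e / 2 * real s + 2 * M * real P) / real s"
        using bound[of "e / 2" s] e elim by (intro divide_right_mono) auto
      also have "\<dots> = 2 * M * (real (F s) / real s) + 2 * M * real P / real s + e / 2"
        using elim by (simp add: field_simps)
      also have "\<dots> < e" using elim by simp
      finally have "\<bar>(\<Sum>d<N s. G s d) - real (N s) * a\<bar> / real s < e" .
      moreover have "(\<Sum>d<N s. G s d) / real s - real (N s) / real s * a = ((\<Sum>d<N s. G s d) - real (N s) * a) / real s"
        by (simp add: diff_divide_distrib)
      ultimately show ?case by (simp only: dist_real_def diff_zero abs_divide abs_of_nat)
    qed
  qed
  from tendsto_add[OF this tendsto_mult[OF N tendsto_const[of a]]] show ?thesis by simp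
qed

text \<open>Piece \<open>i\<close> starts \<open>s - s div Suc i\<close> letters into the block.
  After the first \<open>I\<close> pieces at most \<open>s / (I + 1) + 1\<close> letters are left,
  for every \<open>s\<close>, so finitely many pieces determine the average up to a small
  error.\<close>

lemma block_average:
  fixes g :: "nat \<Rightarrow> real"
  assumes g: "\<And>n. \<bar>g n\<bar> \<le> M" and E: "b sums E"
    and pieces: "\<And>i. (\<lambda>s. (\<Sum>d<s div Suc i - s div Suc (Suc i). g (triangle s + (s - s div Suc i) + d)) / real s)
      \<longlonglongrightarrow> b i"
  shows "(\<lambda>s. (\<Sum>d\<le>s. g (triangle s + d)) / real s) \<longlonglongrightarrow> E"
proof (rule tendstoI)
  fix e :: real assume e: "0 < e"
  define S where "S s i = (\<Sum>d<s div Suc i - s div Suc (Suc i). g (triangle s + (s - s div Suc i) + d))" for s i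
  have M0: "0 \<le> M" using g[of 0] by linarith
  have split: "(\<Sum>d<s - s div Suc I. g (triangle s + d)) = (\<Sum>i<I. S s i)" for s I
  proof (induction I)
    case (Suc I)
    have le: "s div Suc (Suc I) \<le> s div Suc I" by (rule div_le_mono2) auto
    then have "s - s div Suc (Suc I) = (s - s div Suc I) + (s div Suc I - s div Suc (Suc I))"
      using div_le_dividend[of s "Suc I"] by linarith
    then have "(\<Sum>d<s - s div Suc (Suc I). g (triangle s + d)) =
        (\<Sum>d<s - s div Suc I. g (triangle s + d)) + S s I"
      unfolding S_def by (simp only: sum_lessThan_add add.assoc)
    then show ?case using Suc.IH by simp
  qed simp
  have "(\<lambda>I. M / real (Suc I)) \<longlonglongrightarrow> 0" by (rule LIMSEQ_Suc[OF const_ratio])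
  then have "\<forall>\<^sub>F I in sequentially. M / real (Suc I) < e / 4" using e by (intro order_tendstoD) auto
  moreover have "\<forall>\<^sub>F I in sequentially. dist (\<Sum>i<I. b i) E < e / 4"
    using E e unfolding sums_def by (intro tendstoD) auto
  ultimately have "\<forall>\<^sub>F I in sequentially. M / real (Suc I) < e / 4 \<and> dist (\<Sum>i<I. b i) E < e / 4"
    by eventually_elim simp
  then obtain I where I: "M / real (Suc I) < e / 4" "dist (\<Sum>i<I. b i) E < e / 4"
    using eventually_happens[of _ sequentially] by auto
  have "(\<lambda>s. \<Sum>i<I. S s i / real s) \<longlonglongrightarrow> (\<Sum>i<I. b i)"
    using pieces unfolding S_def by (intro tendsto_sum)
  then have "\<forall>\<^sub>F s in sequentially. dist (\<Sum>i<I. S s i / real s) (\<Sum>i<I. b i) < e / 4"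
    using e by (intro tendstoD) auto
  moreover have "\<forall>\<^sub>F s in sequentially. M / real s < e / 4"
    using e const_ratio[of M] by (intro order_tendstoD) auto
  ultimately show "\<forall>\<^sub>F s in sequentially. dist ((\<Sum>d\<le>s. g (triangle s + d)) / real s) E < e"
    using eventually_gt_at_top[of 0]
  proof eventually_elim
    case (elim s)
    let ?c = "s - s div Suc I"
    have "{..s} = {..<?c} \<union> {?c..s}" by auto
    then have "(\<Sum>d\<le>s. g (triangle s + d)) = (\<Sum>d<?c. g (triangle s + d)) + (\<Sum>d=?c..s. g (triangle s + d))"
      by (simp add: sum.union_disjoint ivl_disj_int)
    then have "(\<Sum>d\<le>s. g (triangle s + d)) / real s =
        (\<Sum>i<I. S s i / real s) + (\<Sum>d=?c..s. g (triangle s + d)) / real s"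
      unfolding split by (simp add: add_divide_distrib sum_divide_distrib)
    moreover have "\<bar>(\<Sum>d=?c..s. g (triangle s + d)) / real s\<bar> \<le> M / real (Suc I) + M / real s"
    proof -
      have "\<bar>\<Sum>d=?c..s. g (triangle s + d)\<bar> \<le> real (card {?c..s}) * M"
        by (rule abs_sum_bound) (rule g)
      also have "card {?c..s} = Suc (s div Suc I)" using div_le_dividend[of s "Suc I"] by simp
      also have "real (Suc (s div Suc I)) * M \<le> (real s / real (Suc I) + 1) * M"
        using real_div_le[of s "Suc I"] M0 by (intro mult_right_mono) auto
      finally have "\<bar>\<Sum>d=?c..s. g (triangle s + d)\<bar> / real s \<le> (real s / real (Suc I) + 1) * M / real s"
        by (rule divide_right_mono) simp
      also have "\<dots> = M / real (Suc I) + M / real s" using elim by (simp add: field_simps)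
      finally show ?thesis by (simp add: abs_divide)
    qed
    ultimately show ?case using I elim unfolding dist_real_def by linarith
  qed
qed

text \<open>The incomplete last block contributes at most \<open>tri_root R\<close> terms, which is
  negligible against \<open>R\<close>; complete blocks are controlled by \<open>blocks\<close>
  except for finitely many early ones, collected in \<open>C\<close>.\<close>

lemma cesaro_blocks:
  fixes g :: "nat \<Rightarrow> real"
  assumes g: "\<And>n. \<bar>g n\<bar> \<le> M"
    and blocks: "(\<lambda>s. (\<Sum>d\<le>s. g (triangle s + d)) / real s) \<longlonglongrightarrow> E"
  shows "(\<lambda>R. (\<Sum>n<R. g n) / real R) \<longlonglongrightarrow> E"
proof (rule tendstoI)
  fix e :: real assume e: "0 < e"
  define h where "h n = g n - E" for n
  define M' where "M' = M + \<bar>E\<bar>"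
  have h: "\<bar>h n\<bar> \<le> M'" for n using g[of n] unfolding h_def M'_def by linarith
  define Q where "Q s = (\<Sum>d\<le>s. h (triangle s + d))" for s
  have Q_eq: "Q s = (\<Sum>d\<le>s. g (triangle s + d)) - (real s + 1) * E" for s
    by (simp add: Q_def h_def sum_subtractf)
  have "(\<lambda>s. (\<Sum>d\<le>s. g (triangle s + d)) / real s - E - E / real s) \<longlonglongrightarrow> E - E - 0"
    by (intro tendsto_intros blocks const_ratio)
  then have "\<forall>\<^sub>F s in sequentially. \<bar>(\<Sum>d\<le>s. g (triangle s + d)) / real s - E - E / real s\<bar> < e / 4"
    using e by (auto dest!: tendstoD[where e = "e / 4"] simp: dist_real_def)
  then have "\<forall>\<^sub>F s in sequentially. \<bar>Q s\<bar> \<le> e / 4 * real s"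
    using eventually_gt_at_top[of 0]
  proof eventually_elim
    case (elim s)
    have "Q s = real s * ((\<Sum>d\<le>s. g (triangle s + d)) / real s - E - E / real s)"
      using elim unfolding Q_eq by (simp add: field_simps)
    then show ?case using elim by (simp add: abs_mult mult.commute mult_left_mono)
  qed
  then obtain s0 where s0: "\<And>s. s0 \<le> s \<Longrightarrow> \<bar>Q s\<bar> \<le> e / 4 * real s"
    unfolding eventually_sequentially by blast
  define C where "C = (\<Sum>s<s0. \<bar>Q s\<bar>)"
  have tri: "(\<Sum>n<triangle S. h n) = (\<Sum>s<S. Q s)" for S
  proof (induction S)
    case (Suc S)
    have "(\<Sum>n<triangle (Suc S). h n) = (\<Sum>n<triangle S. h n) + (\<Sum>d<Suc S. h (triangle S + d))"
      unfolding triangle_Suc by (rule sum_lessThan_add)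
    then show ?case using Suc.IH by (simp only: Q_def lessThan_Suc_atMost[symmetric] sum.lessThan_Suc)
  qed simp
  have gauss: "(\<Sum>s<S. real s) \<le> real (triangle S)" for S
    by (induction S) auto
  have blocks_bound: "\<bar>\<Sum>n<triangle S. h n\<bar> \<le> C + e / 4 * real (triangle S)" for S
  proof -
    have "\<bar>\<Sum>s<S. Q s\<bar> \<le> (\<Sum>s<S. (if s < s0 then \<bar>Q s\<bar> else 0) + e / 4 * real s)"
      using e by (intro order_trans[OF sum_abs] sum_mono) (use s0 in \<open>auto simp: not_less\<close>)
    also have "\<dots> = (\<Sum>s<S. if s < s0 then \<bar>Q s\<bar> else 0) + e / 4 * (\<Sum>s<S. real s)"
      by (simp add: sum.distrib sum_distrib_left)
    also have "(\<Sum>s<S. if s < s0 then \<bar>Q s\<bar> else 0) = (\<Sum>s\<in>{..<S} \<inter> {..<s0}. \<bar>Q s\<bar>)"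
      by (simp add: sum.If_cases lessThan_def)
    also have "\<dots> \<le> C" unfolding C_def by (rule sum_mono2) auto
    also have "e / 4 * (\<Sum>s<S. real s) \<le> e / 4 * real (triangle S)"
      using gauss[of S] e by (intro mult_left_mono) auto
    finally show ?thesis unfolding tri by simp
  qed
  have "(\<lambda>R. C / real R + M' * (real (tri_root R) / real R)) \<longlonglongrightarrow> 0 + M' * 0"
    by (intro tendsto_intros const_ratio tri_root_ratio)
  then have "\<forall>\<^sub>F R in sequentially. C / real R + M' * (real (tri_root R) / real R) < e / 4"
    using e by (intro order_tendstoD) auto
  then show "\<forall>\<^sub>F R in sequentially. dist ((\<Sum>n<R. g n) / real R) E < e"
    using eventually_gt_at_top[of 0]
  proof eventually_elim
    case (elim R)
    define S where "S = tri_root R"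
    have S: "triangle S \<le> R" "R < triangle (Suc S)"
      unfolding S_def by (rule tri_root_le, rule less_tri_root)
    then obtain d where d: "R = triangle S + d" using le_Suc_ex by blast
    have "(\<Sum>n<R. h n) = (\<Sum>n<triangle S. h n) + (\<Sum>j<d. h (triangle S + j))"
      unfolding d by (rule sum_lessThan_add)
    moreover have "\<bar>\<Sum>j<d. h (triangle S + j)\<bar> \<le> real d * M'"
      using abs_sum_bound[where g = "\<lambda>j. h (triangle S + j)" and M = "M'" and A = "{..<d}"] h by simp
    moreover have "real d * M' \<le> real S * M'"
      using S d h[of 0] by (intro mult_right_mono) auto
    moreover have "e / 4 * real (triangle S) \<le> e / 4 * real R" using S e by simp
    ultimately have "\<bar>\<Sum>n<R. h n\<bar> \<le> C + e / 4 * real R + real S * M'"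
      using blocks_bound[of S] by linarith
    then have "\<bar>\<Sum>n<R. h n\<bar> / real R \<le> (C + e / 4 * real R + real S * M') / real R"
      by (rule divide_right_mono) simp
    also have "\<dots> = C / real R + M' * (real S / real R) + e / 4"
      using elim by (simp add: field_simps)
    also have "\<dots> < e" using elim(1) e unfolding S_def by linarith
    finally have "\<bar>(\<Sum>n<R. h n) / real R\<bar> < e" by (simp add: abs_divide)
    moreover have "(\<Sum>n<R. h n) / real R = (\<Sum>n<R. g n) / real R - E"
      using elim by (simp add: h_def sum_subtractf field_simps)
    ultimately show ?case by (simp add: dist_real_def)
  qed
qed


lemma cesaro_shift_iff:
  fixes g :: "nat \<Rightarrow> real"
  assumes g: "\<And>n. \<bar>g n\<bar> \<le> M"
  shows "(\<lambda>R. (\<Sum>n<R. g (a + n)) / real R) \<longlonglongrightarrow> E \<longleftrightarrow> (\<lambda>R. (\<Sum>n<R. g n) / real R) \<longlonglongrightarrow> E"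
proof -
  have "(\<lambda>R. (\<Sum>n<R. g (a + n)) / real R - (\<Sum>n<R. g n) / real R) \<longlonglongrightarrow> 0"
  proof (rule Lim_null_comparison)
    have "norm ((\<Sum>n<R. g (a + n)) / real R - (\<Sum>n<R. g n) / real R) \<le> (2 * real a * M) / real R" for R
    proof -
      have "(\<Sum>n<a. g n) + (\<Sum>n<R. g (a + n)) = (\<Sum>n<R. g n) + (\<Sum>n<a. g (R + n))"
        using sum_lessThan_add[of g a R] sum_lessThan_add[of g R a] by (simp add: add.commute)
      moreover have "\<bar>\<Sum>n<a. g n\<bar> \<le> real a * M" "\<bar>\<Sum>n<a. g (R + n)\<bar> \<le> real a * M"
        using abs_sum_bound[where g = g and M = M and A = "{..<a}"] abs_sum_bound[where g = "\<lambda>n. g (R + n)" and M = M and A = "{..<a}"] g by auto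
      ultimately have "\<bar>(\<Sum>n<R. g (a + n)) - (\<Sum>n<R. g n)\<bar> \<le> 2 * real a * M" by linarith
      then have "\<bar>(\<Sum>n<R. g (a + n)) - (\<Sum>n<R. g n)\<bar> / real R \<le> 2 * real a * M / real R"
        by (rule divide_right_mono) simp
      moreover have "(\<Sum>n<R. g (a + n)) / real R - (\<Sum>n<R. g n) / real R = ((\<Sum>n<R. g (a + n)) - (\<Sum>n<R. g n)) / real R"
        by (simp add: diff_divide_distrib)
      ultimately show ?thesis by (simp only: real_norm_def abs_divide abs_of_nat)
    qed
    then show "\<forall>\<^sub>F R in sequentially. norm ((\<Sum>n<R. g (a + n)) / real R - (\<Sum>n<R. g n) / real R) \<le> (2 * real a * M) / real R"
      by simp
  qed (rule const_ratio)
  then show ?thesis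
    by (auto dest: Lim_transform Lim_transform2)
qed

section \<open>The physical measure\<close>

text \<open>The limit of \<open>piece s i\<close> as the stage \<open>s\<close> grows; rejection at
  stage \<open>s\<close> becomes rejection at some stage.\<close>

definition orbit_point :: "nat \<Rightarrow> binseq" where
  "orbit_point i d \<longleftrightarrow> (\<exists>s. bad s (code_length i) (word i)) \<or>
     d mod (code_length i + 2) < 2 \<or> word i (d mod (code_length i + 2) - 2)"

lemma orbit_point_periodic: "orbit_point i (d + (code_length i + 2)) = orbit_point i d"
  unfolding orbit_point_def mod_add_self2 ..

lemma orbit_point_in_attr: "orbit_point i \<in> attr"
  unfolding attr_iff
proof (intro allI impI notI)
  fix s k p assume f: "forbidden s k" and pat: "has_pattern k p (orbit_point i)"
  let ?P = "code_length i + 2"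
  define r where "r = p mod ?P - 2"
  have "\<not> orbit_point i p" using pat by (simp add: has_pattern_def)
  then have nb: "\<not> bad s' (code_length i) (word i)" and r: "p mod ?P = r + 2" for s'
    unfolding orbit_point_def r_def by auto
  have copy: "r + d < code_length i \<and> (p + d) mod ?P = r + d + 2" if "d \<le> 2 * k + 2" for d
    using that
  proof (induction d)
    case 0
    have "p mod ?P < ?P" by (rule mod_less_divisor) simp
    then have "r < code_length i" unfolding r by linarith
    then show ?case using r by simp
  next
    case (Suc d)
    then have IH: "r + d < code_length i" "(p + d) mod ?P = r + d + 2" by auto
    have "r + Suc d < code_length i"
    proof (rule ccontr)
      assume "\<not> ?thesis"
      with IH have "Suc ((p + d) mod ?P) = ?P" by simp
      then have m0: "Suc (p + d) mod ?P = 0" by (simp add: mod_Suc)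
      then have "Suc (Suc (p + d)) mod ?P = 1" by (simp add: mod_Suc)
      with m0 have "orbit_point i (Suc (p + d))" "orbit_point i (Suc (Suc (p + d)))"
        by (simp_all add: orbit_point_def)
      from pattern_no_cross[OF pat this] Suc.prems show False by simp
    qed
    moreover from this IH have "(p + Suc d) mod ?P = r + Suc d + 2" by (simp add: mod_Suc)
    ultimately show ?case by simp
  qed
  have "has_pattern k r (word i)"
  proof (rule has_pattern_cong[OF pat])
    fix d assume "d \<le> 2 * k + 2"
    with copy[OF this] nb show "orbit_point i (p + d) = word i (r + d)" by (simp add: orbit_point_def)
  qed
  with f copy[of "2 * k + 2"] have "bad s (code_length i) (word i)" by (intro badI) auto
  with nb show False by blast
qed

lemma shift_funpow_in_attr: "x \<in> attr \<Longrightarrow> (shift_map ^^ d) x \<in> attr"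
  by (induction d) (auto intro: shift_map_attr)

text \<open>The weight of \<open>i\<close> is the limiting fraction of block \<open>s\<close> on
  which \<open>s div b = i + 1\<close>.\<close>

definition weight_pmf :: "nat pmf" where
  "weight_pmf = embed_pmf (\<lambda>i. 1 / real (Suc i) - 1 / real (Suc (Suc i)))"

lemma weight_sums: "(\<lambda>i. 1 / real (Suc i) - 1 / real (Suc (Suc i))) sums 1"
  using telescope_sums'[of "\<lambda>i. 1 / real (Suc i)" 0] LIMSEQ_Suc[OF const_ratio[of 1]] by simp

lemma pmf_weight: "pmf weight_pmf i = 1 / real (Suc i) - 1 / real (Suc (Suc i))"
  unfolding weight_pmf_def
proof (rule pmf_embed_pmf)
  show nonneg: "0 \<le> 1 / real (Suc i) - 1 / real (Suc (Suc i))" for i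
    by (simp add: frac_le)
  show "(\<integral>\<^sup>+ i. ennreal (1 / real (Suc i) - 1 / real (Suc (Suc i))) \<partial>count_space UNIV) = 1"
    unfolding nn_integral_count_space_nat using suminf_ennreal_eq[OF nonneg weight_sums] by simp
qed

lemma set_weight_pmf: "set_pmf weight_pmf = UNIV"
proof -
  have "1 / real (Suc (Suc i)) < 1 / real (Suc i)" for i by (rule divide_strict_left_mono) auto
  then have "pmf weight_pmf i \<noteq> 0" for i by (simp only: pmf_weight) (metis less_irrefl right_minus_eq)
  then show ?thesis by (auto simp: set_pmf_iff)
qed

definition phys_pmf :: "binseq pmf" where
  "phys_pmf = bind_pmf weight_pmf (\<lambda>i. map_pmf (\<lambda>d. (shift_map ^^ d) (orbit_point i))
     (pmf_of_set {..<code_length i + 2}))"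

text \<open>\<open>measure_pmf\<close> measures all sets; \<open>distr\<close> restricts it to the
  Borel sets.\<close>

definition phys :: "binseq measure" where
  "phys = distr (measure_pmf phys_pmf) borel (\<lambda>x. x)"

lemma lessThan_add_2_nonempty: "{..<n + 2} \<noteq> ({} :: nat set)"
  by auto

lemma set_phys_pmf: "set_pmf phys_pmf = {(shift_map ^^ d) (orbit_point i) | d i. d < code_length i + 2}"
  unfolding phys_pmf_def by (auto simp: set_pmf_of_set[OF lessThan_add_2_nonempty] set_weight_pmf simp del: add_2_eq_Suc')

lemma set_phys_pmf_attr: "set_pmf phys_pmf \<subseteq> attr"
  unfolding set_phys_pmf using orbit_point_in_attr shift_funpow_in_attr by auto

lemma prob_space_phys: "prob_space phys"
  unfolding phys_def by (rule measure_pmf.prob_space_distr) simp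

lemma sets_phys [simp]: "sets phys = sets borel"
  by (simp add: phys_def)

lemma emeasure_phys: "B \<in> sets borel \<Longrightarrow> emeasure phys B = emeasure (measure_pmf phys_pmf) B"
  unfolding phys_def by (simp add: emeasure_distr)

text \<open>A prefix of a point of \<open>attr\<close> is a word that is never rejected, so it
  occurs, right after \<open>11\<close>, in a periodic orbit of positive weight. Conversely all
  atoms lie in the closed set \<open>attr\<close>.\<close>

lemma supp_phys: "supp phys = attr"
proof (intro equalityI subsetI)
  fix x assume x: "x \<in> supp phys"
  show "x \<in> attr"
  proof (rule ccontr)
    assume "x \<notin> attr"
    moreover have "open (- attr)" using closed_attr by (simp add: open_Compl)
    ultimately have "0 < emeasure phys (- attr)" using x by (auto simp: supp_def)
    moreover have "emeasure phys (- attr) = 0"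
      using set_phys_pmf_attr \<open>open (- attr)\<close>
      by (auto simp: emeasure_phys measure_pmf.emeasure_eq_measure measure_pmf_zero_iff)
    ultimately show False by simp
  qed
next
  fix x assume x: "x \<in> attr"
  show "x \<in> supp phys"
    unfolding supp_def
  proof (intro CollectI allI impI)
    fix U assume U: "open U" "x \<in> U"
    then obtain m where m: "\<And>y. agree m x y \<Longrightarrow> y \<in> U" unfolding open_iff_cylinder by blast
    define i where "i = initial_word x m"
    have len: "code_length i = m" by (simp add: i_def initial_word_def code_length_def)
    have w: "agree m x (word i)" unfolding i_def by (rule agree_word_initial)
    have nb: "\<not> bad s m (word i)" for s
    proof
      assume "bad s m (word i)"
      then have "bad s m x" using bad_agree[OF w] by simp
      then show False using x unfolding attr_iff by (meson badE)
    qed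
    have "agree m x ((shift_map ^^ 2) (orbit_point i))"
      using w nb unfolding agree_def shift_map_funpow orbit_point_def len by simp
    then have "(shift_map ^^ 2) (orbit_point i) \<in> U" by (rule m)
    \<comment> \<open>For \<open>m = 0\<close> the period is 2 and the shift by 2 is outside the
      listed range of \<open>d\<close>; any atom then lies in \<open>U\<close>.\<close>
    moreover have "(shift_map ^^ 2) (orbit_point i) \<in> set_pmf phys_pmf \<or> m = 0"
      unfolding set_phys_pmf using len by force
    moreover have "orbit_point i \<in> set_pmf phys_pmf"
      unfolding set_phys_pmf by (intro CollectI exI[of _ 0] exI[of _ i]) simp
    moreover have "m = 0 \<Longrightarrow> orbit_point i \<in> U" by (rule m) (simp add: agree_def)
    ultimately have "set_pmf phys_pmf \<inter> U \<noteq> {}" by blast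
    then show "0 < emeasure phys U"
      using U by (auto simp: emeasure_phys measure_pmf.emeasure_eq_measure measure_pmf_zero_iff
          zero_less_measure_iff)
  qed
qed

lemma map_pmf_attr_map_phys: "map_pmf attr_map phys_pmf = phys_pmf"
proof -
  have "map_pmf attr_map phys_pmf = map_pmf shift_map phys_pmf"
    using set_phys_pmf_attr by (intro map_pmf_cong) (auto simp: attr_map_def)
  also have "\<dots> = phys_pmf"
    unfolding phys_pmf_def map_bind_pmf
  proof (intro bind_pmf_cong refl)
    fix i
    let ?P = "code_length i + 2" and ?g = "\<lambda>d. (shift_map ^^ d) (orbit_point i)"
    have "bij_betw (\<lambda>d. Suc d mod ?P) {..<?P} {..<?P}"
    proof (rule bij_betw_imageI)
      show "inj_on (\<lambda>d. Suc d mod ?P) {..<?P}"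
        by (auto simp: inj_on_def mod_Suc split: if_splits)
      then show "(\<lambda>d. Suc d mod ?P) ` {..<?P} = {..<?P}"
        by (intro card_subset_eq) (auto simp: card_image)
    qed
    then have bij: "map_pmf (\<lambda>d. Suc d mod ?P) (pmf_of_set {..<?P}) = pmf_of_set {..<?P}"
      using lessThan_add_2_nonempty by (rule map_pmf_of_set_bij_betw) simp
    have "shift_map (?g d) = ?g (Suc d mod ?P)" if "d < ?P" for d
    proof (cases "Suc d = ?P")
      case True
      then have "shift_map (?g d) = (\<lambda>j. orbit_point i (j + ?P))"
        by (auto simp: shift_map_funpow shift_map_def fun_eq_iff add.commute)
      then show ?thesis using True by (simp only: orbit_point_periodic mod_self funpow_0 id_apply)
    next
      case False
      with that show ?thesis by simp
    qed
    then have "map_pmf shift_map (map_pmf ?g (pmf_of_set {..<?P})) =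
        map_pmf ?g (map_pmf (\<lambda>d. Suc d mod ?P) (pmf_of_set {..<?P}))"
      unfolding map_pmf_comp
      by (intro map_pmf_cong refl) (simp only: set_pmf_of_set[OF lessThan_add_2_nonempty finite_lessThan] lessThan_iff)
    then show "map_pmf shift_map (map_pmf ?g (pmf_of_set {..<?P})) = map_pmf ?g (pmf_of_set {..<?P})"
      unfolding bij .
  qed
  finally show ?thesis .
qed

lemma measurable_attr_map: "attr_map \<in> borel_measurable borel"
  by (rule borel_measurable_continuous_onI[OF continuous_attr_map])

lemma invariant_phys: "invariant_measure attr_map phys"
proof -
  have "distr phys borel attr_map = distr (measure_pmf phys_pmf) borel (\<lambda>x. attr_map x)"
    unfolding phys_def using measurable_attr_map by (subst distr_distr) (auto simp: o_def)
  also have "\<dots> = distr (measure_pmf (map_pmf attr_map phys_pmf)) borel (\<lambda>x. x)"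
    unfolding map_pmf_rep_eq by (subst distr_distr) (auto simp: o_def)
  finally have "distr phys borel attr_map = phys"
    unfolding map_pmf_attr_map_phys phys_def .
  then show ?thesis
    using prob_space_phys measurable_attr_map by (simp add: invariant_measure_def borel_prob_def)
qed

lemma integral_phys_sums:
  fixes f :: "binseq \<Rightarrow> real"
  assumes f: "f \<in> borel_measurable borel" and M: "\<And>x. \<bar>f x\<bar> \<le> M"
  shows "(\<lambda>i. (1 / real (Suc i) - 1 / real (Suc (Suc i))) *
      ((\<Sum>d<code_length i + 2. f ((shift_map ^^ d) (orbit_point i))) / real (code_length i + 2)))
    sums integral\<^sup>L phys f"
proof -
  define a where "a i = (\<Sum>d<code_length i + 2. f ((shift_map ^^ d) (orbit_point i))) / real (code_length i + 2)" for i
  have "integral\<^sup>L phys f = measure_pmf.expectation phys_pmf f"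
    unfolding phys_def using f by (subst integral_distr) auto
  also have "\<dots> = measure_pmf.expectation weight_pmf (\<lambda>i. measure_pmf.expectation
      (map_pmf (\<lambda>d. (shift_map ^^ d) (orbit_point i)) (pmf_of_set {..<code_length i + 2})) f)"
    unfolding phys_pmf_def measure_pmf_bind
    by (rule integral_bind[where K = "count_space UNIV" and B' = 1 and B = M])
       (auto intro!: M measure_pmf.finite_measure simp: measure_pmf_in_subprob_algebra measure_pmf.emeasure_space_1)
  also have "\<dots> = measure_pmf.expectation weight_pmf a"
    unfolding a_def integral_map_pmf
      integral_pmf_of_set[OF lessThan_add_2_nonempty finite_lessThan] card_lessThan ..
  finally have E: "integral\<^sup>L phys f = measure_pmf.expectation weight_pmf a" .
  have "\<bar>a i\<bar> \<le> M" for i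
  proof -
    have "\<bar>\<Sum>d<code_length i + 2. f ((shift_map ^^ d) (orbit_point i))\<bar> \<le> real (card {..<code_length i + 2}) * M"
      by (rule abs_sum_bound) (rule M)
    then show ?thesis unfolding a_def by (simp add: field_simps)
  qed
  then have "integrable (measure_pmf weight_pmf) a"
    by (intro measure_pmf.integrable_const_bound[where B = M]) auto
  then have "integrable (count_space UNIV) (\<lambda>i. pmf weight_pmf i * a i)"
    unfolding measure_pmf_eq_density by (simp add: integrable_density)
  from sums_integral_count_space_nat[OF this]
  have "(\<lambda>i. pmf weight_pmf i * a i) sums integral\<^sup>L (count_space UNIV) (\<lambda>i. pmf weight_pmf i * a i)" .
  also have "integral\<^sup>L (count_space UNIV) (\<lambda>i. pmf weight_pmf i * a i) = measure_pmf.expectation weight_pmf a"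
    unfolding measure_pmf_eq_density by (subst integral_density) auto
  finally show ?thesis unfolding E a_def pmf_weight .
qed

section \<open>Equidistribution of the orbits outside the subshift\<close>

lemma letter_piece:
  assumes d: "d < s div Suc i - s div Suc (Suc i)" and pad: "tri_root s \<le> s div Suc (Suc i)"
  shows "letter (triangle s + (s - s div Suc i) + d) = piece s i d"
proof -
  let ?n = "triangle s + (s - s div Suc i) + d"
  define b where "b = s div Suc i - d"
  have le: "s div Suc i \<le> s" by (rule div_le_dividend)
  have r: "tri_root ?n = s" using d le triangle_Suc[of s] by (intro tri_root_eqI) linarith+
  have p: "psnd ?n = b" unfolding psnd_eq r b_def using d le triangle_Suc[of s] by linarith
  have b: "s div Suc (Suc i) < b" "b \<le> s div Suc i" using d by (auto simp: b_def)
  \<comment> \<open>\<open>pad\<close> places the padding after the whole of piece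
    \<open>i\<close>.\<close>
  then have b0: "0 < b" "tri_root s \<le> b" using pad by auto
  have "s div b = Suc i"
  proof (rule antisym)
    show "Suc i \<le> s div b"
      using b b0 by (simp add: less_eq_div_iff_mult_less_eq mult.commute)
    show "s div b \<le> Suc i"
    proof (rule ccontr)
      assume "\<not> s div b \<le> Suc i"
      then have "Suc (Suc i) \<le> s div b" by simp
      then have "b \<le> s div Suc (Suc i)"
        using b0 by (simp add: less_eq_div_iff_mult_less_eq mult.commute del: mult_Suc mult_Suc_right)
      with b show False by simp
    qed
  qed
  moreover have "s div Suc i - b = d" using d by (simp add: b_def)
  ultimately show ?thesis using b0 unfolding letter_def r p block_letter_def by simp
qed

lemma eventually_piece: "\<forall>\<^sub>F s in sequentially. \<forall>d. piece s i d = orbit_point i d"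
proof (cases "\<exists>s. bad s (code_length i) (word i)")
  case True
  then obtain s0 where s0: "bad s0 (code_length i) (word i)" ..
  from eventually_ge_at_top[of s0] show ?thesis
  proof eventually_elim
    case (elim s)
    with s0 have "bad s (code_length i) (word i)" by (rule bad_mono) simp
    then show ?case by (auto simp: piece_def orbit_point_def)
  qed
next
  case False
  then show ?thesis by (auto simp: piece_def orbit_point_def)
qed

lemma eventually_no_padding: "\<forall>\<^sub>F s in sequentially. tri_root s \<le> s div Suc (Suc i)"
proof -
  define c where "c = 1 / (2 * real (Suc (Suc i)))"
  have "\<forall>\<^sub>F s in sequentially. real (tri_root s) / real s < c"
    using tri_root_ratio by (rule order_tendstoD) (simp add: c_def)
  moreover have "\<forall>\<^sub>F s in sequentially. c < real (s div Suc (Suc i)) / real s"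
    using div_ratio[of "Suc (Suc i)"] by (rule order_tendstoD) (auto simp: c_def field_simps)
  ultimately show ?thesis using eventually_gt_at_top[of 0]
  proof eventually_elim
    case (elim s)
    then have "real (tri_root s) / real s < real (s div Suc (Suc i)) / real s" by linarith
    then have "real (tri_root s) < real (s div Suc (Suc i))" using elim(3) by (simp add: divide_less_cancel)
    then show ?case by linarith
  qed
qed

text \<open>At time \<open>n\<close> a tracking point shows the letters from
  \<open>n - window n\<close> to \<open>n - 1\<close>. Once the window lies inside piece
  \<open>i\<close>, the point is therefore close to a shift of \<open>orbit_point i\<close>, delayed
  by the window length; entering the piece takes as long as the window, which is o(s).\<close>

lemma tracking_average:
  fixes f :: "binseq \<Rightarrow> real"
  assumes y: "tracks y" and f: "continuous_on UNIV f"
  shows "(\<lambda>R. (\<Sum>n<R. f ((attr_map ^^ n) y)) / real R) \<longlonglongrightarrow> integral\<^sup>L phys f"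
proof -
  obtain M where M: "\<And>x. \<bar>f x\<bar> \<le> M" using continuous_bounded_binseq[OF f] by blast
  define n0 where "n0 = clock y"
  define X where "X n = (attr_map ^^ (n - n0)) y" for n
  define g where "g n = f (X n)" for n
  have X: "X n j = letter (n - window n + j)" if "n0 \<le> n" "j < window n" for n j
    using tracks_orbit[OF y, of "n - n0"] that unfolding X_def tracks_def n0_def by simp
  have pieces: "(\<lambda>s. (\<Sum>d<s div Suc i - s div Suc (Suc i). g (triangle s + (s - s div Suc i) + d)) / real s)
      \<longlonglongrightarrow> (1 / real (Suc i) - 1 / real (Suc (Suc i))) *
      ((\<Sum>d<code_length i + 2. f ((shift_map ^^ d) (orbit_point i))) / real (code_length i + 2))" for i
  proof (rule piece_average[where F = "\<lambda>s. tri_root s - 1" and M = M])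
    fix d show "f ((shift_map ^^ (d + (code_length i + 2))) (orbit_point i)) = f ((shift_map ^^ d) (orbit_point i))"
      using orbit_point_periodic[of i] by (simp only: shift_map_funpow) (metis add.assoc add.commute)
  next
    show "(\<lambda>s. real (tri_root s - 1) / real s) \<longlonglongrightarrow> 0"
    proof (rule tendsto_sandwich[OF _ _ tendsto_const tri_root_ratio])
      show "\<forall>\<^sub>F s in sequentially. real (tri_root s - 1) / real s \<le> real (tri_root s) / real s"
        by (auto intro!: always_eventually divide_right_mono)
    qed simp
    have "(\<lambda>s. real (s div Suc i) / real s - real (s div Suc (Suc i)) / real s)
        \<longlonglongrightarrow> 1 / real (Suc i) - 1 / real (Suc (Suc i))"
      by (intro tendsto_diff div_ratio) auto
    moreover have "real (s div Suc i - s div Suc (Suc i)) / real s =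
        real (s div Suc i) / real s - real (s div Suc (Suc i)) / real s" for s
    proof -
      have "s div Suc (Suc i) \<le> s div Suc i" by (rule div_le_mono2) auto
      then show ?thesis by (simp add: of_nat_diff diff_divide_distrib)
    qed
    ultimately show "(\<lambda>s. real (s div Suc i - s div Suc (Suc i)) / real s)
        \<longlonglongrightarrow> 1 / real (Suc i) - 1 / real (Suc (Suc i))" by simp
    fix e :: real assume "0 < e"
    from continuous_agree[OF f this] obtain m where m: "\<And>x y. agree m x y \<Longrightarrow> \<bar>f x - f y\<bar> < e" by blast
    have "\<forall>\<^sub>F s in sequentially. m \<le> tri_root s - 1"
      using tri_root_at_top unfolding filterlim_at_top
      by (auto dest!: spec[of _ "Suc m"] elim!: eventually_mono)
    moreover have "\<forall>\<^sub>F s in sequentially. n0 \<le> triangle s"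
      using eventually_ge_at_top[of n0] by eventually_elim (use le_triangle le_trans in blast)
    ultimately show "\<forall>\<^sub>F s in sequentially. \<forall>d. tri_root s - 1 \<le> d \<longrightarrow>
        d < s div Suc i - s div Suc (Suc i) \<longrightarrow>
        \<bar>g (triangle s + (s - s div Suc i) + d) - f ((shift_map ^^ (d - (tri_root s - 1))) (orbit_point i))\<bar> \<le> e"
      using eventually_piece[of i] eventually_no_padding[of i]
    proof eventually_elim
      case (elim s)
      show ?case
      proof (intro allI impI)
        fix d assume d: "tri_root s - 1 \<le> d" "d < s div Suc i - s div Suc (Suc i)"
        let ?F = "tri_root s - 1" and ?n = "triangle s + (s - s div Suc i) + d"
        have "s div Suc i \<le> s" by (rule div_le_dividend)
        then have "tri_root ?n = s" using d triangle_Suc[of s] by (intro tri_root_eqI) linarith+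
        then have w: "window ?n = ?F" by (simp add: window_def)
        have "agree ?F (X ?n) ((shift_map ^^ (d - ?F)) (orbit_point i))"
          unfolding agree_def
        proof (intro allI impI)
          fix j assume j: "j < ?F"
          have "X ?n j = letter (?n - window ?n + j)"
          proof (rule X)
            show "n0 \<le> ?n" using elim(2) by linarith
          qed (simp only: w j)
          also have "?n - window ?n + j = triangle s + (s - s div Suc i) + (d - ?F + j)"
            unfolding w using d by linarith
          also have "letter (triangle s + (s - s div Suc i) + (d - ?F + j)) = piece s i (d - ?F + j)" by (rule letter_piece) (use d j elim in auto)
          also have "\<dots> = orbit_point i (d - ?F + j)" using elim by simp
          finally show "X ?n j = (shift_map ^^ (d - ?F)) (orbit_point i) j" by (simp add: shift_map_funpow)
        qed
        then have "agree m (X ?n) ((shift_map ^^ (d - ?F)) (orbit_point i))"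
          using elim(1) by (rule agree_mono)
        from m[OF this] show "\<bar>g ?n - f ((shift_map ^^ (d - ?F)) (orbit_point i))\<bar> \<le> e"
          unfolding g_def by simp
      qed
    qed
  qed (use M in \<open>auto simp: g_def intro: order_trans[OF diff_le_self div_le_dividend]\<close>)
  have g: "\<bar>g n\<bar> \<le> M" for n using M by (simp add: g_def)
  have "(\<lambda>R. (\<Sum>n<R. g n) / real R) \<longlonglongrightarrow> integral\<^sup>L phys f"
    using borel_measurable_continuous_onI[OF f] M
    by (intro cesaro_blocks[OF g] block_average[OF g _ pieces] integral_phys_sums)
  then have "(\<lambda>R. (\<Sum>n<R. g (n0 + n)) / real R) \<longlonglongrightarrow> integral\<^sup>L phys f"
    using cesaro_shift_iff[where g = g, OF g] by blast
  then show ?thesis by (simp add: g_def X_def)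
qed

lemma orbit_average:
  fixes f :: "binseq \<Rightarrow> real"
  assumes x: "x \<notin> attr" and f: "continuous_on UNIV f"
  shows "(\<lambda>R. (\<Sum>n<R. f ((attr_map ^^ n) x)) / real R) \<longlonglongrightarrow> integral\<^sup>L phys f"
proof -
  obtain M where M: "\<And>x. \<bar>f x\<bar> \<le> M" using continuous_bounded_binseq[OF f] by blast
  from eventually_tracks[OF x] obtain k where "tracks ((attr_map ^^ k) x)" by blast
  from tracking_average[OF this f]
  have "(\<lambda>R. (\<Sum>n<R. f ((attr_map ^^ (k + n)) x)) / real R) \<longlonglongrightarrow> integral\<^sup>L phys f"
    by (simp add: orbit_add[symmetric] add.commute)
  then show ?thesis
    using cesaro_shift_iff[where g = "\<lambda>n. f ((attr_map ^^ n) x)"] M by blast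
qed

lemma weak_star_limit_phys:
  assumes x: "x \<notin> attr"
  shows "weak_star_limit (empirical_measure attr_map x) phys"
  unfolding weak_star_limit_def
proof (intro allI impI)
  fix f :: "binseq \<Rightarrow> real" assume f: "continuous_on UNIV f"
  have "integral\<^sup>L (empirical_measure attr_map x n) f = (\<Sum>i<n. f ((attr_map ^^ i) x)) / real n" if "0 < n" for n
    unfolding empirical_measure_def using borel_measurable_continuous_onI[OF f]
    by (subst integral_distr) (auto simp: integral_uniform_count_measure measurable_def space_uniform_count_measure sets_uniform_count_measure)
  then have "\<forall>\<^sub>F n in sequentially. (\<Sum>i<n. f ((attr_map ^^ i) x)) / real n = integral\<^sup>L (empirical_measure attr_map x n) f"
    by (intro eventually_mono[OF eventually_gt_at_top[of 0]]) simp
  with orbit_average[OF x f]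
  show "(\<lambda>n. integral\<^sup>L (empirical_measure attr_map x n) f) \<longlonglongrightarrow> integral\<^sup>L phys f"
    by (rule Lim_transform_eventually)
qed

section \<open>Uniqueness of weak-star limits\<close>

definition code_cylinder :: "nat \<times> nat \<Rightarrow> binseq set" where
  "code_cylinder = (\<lambda>(m, c). {y. agree m (word c) y})"

lemma cylinder_code: "{y. agree m x y} = code_cylinder (m, initial_word x m)"
  using agree_word_initial[of m x] by (auto simp: code_cylinder_def agree_def)

text \<open>Cylinders are indexed by pairs of numbers, so an open set is a countable union of them
  and lies in the generated sigma-algebra.\<close>

lemma borel_eq_cylinders: "sets (borel :: binseq measure) = sigma_sets UNIV (insert {} (range code_cylinder))"
proof
  show "sigma_sets UNIV (insert {} (range code_cylinder)) \<subseteq> sets (borel :: binseq measure)"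
  proof (rule sets.sigma_sets_subset[where M = "borel :: binseq measure", simplified])
    show "insert {} (range code_cylinder) \<subseteq> sets (borel :: binseq measure)"
      using open_cylinder by (auto simp: code_cylinder_def)
  qed
  have "U \<in> sigma_sets UNIV (insert {} (range code_cylinder))" if "open U" for U
  proof -
    let ?I = "{p. code_cylinder p \<subseteq> U}"
    have "U = (\<Union>p\<in>?I. code_cylinder p)"
    proof
      show "U \<subseteq> (\<Union>p\<in>?I. code_cylinder p)"
      proof
        fix x assume "x \<in> U"
        with that obtain m where "\<forall>y. agree m x y \<longrightarrow> y \<in> U" unfolding open_iff_cylinder by meson
        then have "{y. agree m x y} \<subseteq> U" by blast
        then have "(m, initial_word x m) \<in> ?I" unfolding cylinder_code by simp
        moreover have "x \<in> code_cylinder (m, initial_word x m)"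
          unfolding cylinder_code[symmetric] by (simp add: agree_refl)
        ultimately show "x \<in> (\<Union>p\<in>?I. code_cylinder p)" by blast
      qed
    qed auto
    moreover have "(\<Union>p\<in>?I. code_cylinder p) \<in> sigma_sets UNIV (insert {} (range code_cylinder))"
      by (rule sigma_sets_UNION) (auto intro: sigma_sets.Basic)
    ultimately show ?thesis by simp
  qed
  then show "sets (borel :: binseq measure) \<subseteq> sigma_sets UNIV (insert {} (range code_cylinder))"
    using sigma_sets_mono[of "{S :: binseq set. open S}" UNIV "insert {} (range code_cylinder)"]
    by (auto simp: borel_def)
qed

text \<open>Indicators of cylinders are continuous because cylinders are clopen. So both measures
  agree on cylinders, which are stable under intersection up to the empty set and generate the Borel
  sets.\<close>

lemma weak_star_limit_unique:
  assumes "weak_star_limit E \<mu>" "weak_star_limit E \<nu>" "borel_prob \<mu>" "borel_prob \<nu>"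
  shows "\<mu> = \<nu>"
proof (rule measure_eqI_generator_eq[where E = "insert {} (range code_cylinder)" and \<Omega> = UNIV
      and A = "\<lambda>_. UNIV"])
  interpret \<mu>: prob_space \<mu> using assms(3) by (simp add: borel_prob_def)
  interpret \<nu>: prob_space \<nu> using assms(4) by (simp add: borel_prob_def)
  show "Int_stable (insert {} (range code_cylinder))"
  proof (rule Int_stableI)
    fix a b assume ab: "a \<in> insert {} (range code_cylinder)" "b \<in> insert {} (range code_cylinder)"
    show "a \<inter> b \<in> insert {} (range code_cylinder)"
    proof (cases "a \<inter> b = {}")
      case False
      then obtain x where x: "x \<in> a" "x \<in> b" by blast
      with ab obtain m c m' c' where "a = {y. agree m (word c) y}" "b = {y. agree m' (word c') y}"
        by (auto simp: code_cylinder_def)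
      with x have "a \<inter> b = {y. agree (max m m') x y}" by (auto simp: agree_def less_max_iff_disj)
      then show ?thesis unfolding cylinder_code by simp
    qed simp
  qed
  show "insert {} (range code_cylinder) \<subseteq> Pow UNIV" by simp
  show "sets \<mu> = sigma_sets UNIV (insert {} (range code_cylinder))"
    "sets \<nu> = sigma_sets UNIV (insert {} (range code_cylinder))"
    using assms(3,4) borel_eq_cylinders by (auto simp: borel_prob_def)
  have "code_cylinder (0, 0) = UNIV" by (auto simp: code_cylinder_def agree_def)
  then have "UNIV \<in> range code_cylinder" by (metis rangeI)
  then show "range (\<lambda>_. UNIV) \<subseteq> insert {} (range code_cylinder)" by simp
  show "(\<Union>i. UNIV) = UNIV" by simp
  show "emeasure \<mu> UNIV \<noteq> \<infinity>" by simp
  fix C assume "C \<in> insert {} (range code_cylinder)"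
  then show "emeasure \<mu> C = emeasure \<nu> C"
  proof
    assume "C \<in> range code_cylinder"
    then obtain m w where C: "C = {y. agree m w y}" by (auto simp: code_cylinder_def)
    have CB: "C \<in> sets borel" unfolding C by (rule borel_open[OF open_cylinder])
    have "continuous_on UNIV (indicator C :: binseq \<Rightarrow> real)"
    proof (rule continuous_onI_agree)
      fix x show "\<exists>m. \<forall>y. agree m x y \<longrightarrow> indicator C y = (indicator C x :: real)"
        by (intro exI[of _ m]) (auto simp: C agree_def indicator_def)
    qed
    then have "integral\<^sup>L \<mu> (indicator C :: binseq \<Rightarrow> real) = integral\<^sup>L \<nu> (indicator C)"
      using assms(1,2) unfolding weak_star_limit_def using LIMSEQ_unique by blast
    then have "measure \<mu> C = measure \<nu> C" using CB assms(3,4) by (simp add: borel_prob_def)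
    then show ?thesis by (simp add: \<mu>.emeasure_eq_measure \<nu>.emeasure_eq_measure)
  qed simp
qed

section \<open>Mixing and entropy\<close>

text \<open>The run of ones has length at least two, so no pattern crosses it and any pattern lies
  entirely in \<open>x\<close> or in \<open>y\<close>.\<close>

lemma concatenation_in_attr:
  assumes x: "x \<in> attr" and y: "y \<in> attr" and n: "m + 2 \<le> n"
  shows "(\<lambda>i. if i < m then x i else if i < n then True else y (i - n)) \<in> attr"
    (is "?z \<in> attr")
  unfolding attr_iff
proof (intro allI impI notI)
  fix s k p assume f: "forbidden s k" and pat: "has_pattern k p ?z"
  from pat have zp: "\<not> ?z p" by (simp add: has_pattern_def)
  have "?z m" "?z (Suc m)" "?z (n - 2)" "?z (Suc (n - 2))" using n by auto
  from pattern_no_cross[OF pat this(1,2)] pattern_no_cross[OF pat this(3,4)]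
  have "p + 2 * k + 2 < m \<or> n \<le> p" using zp n by (auto split: if_splits)
  then show False
  proof
    assume "p + 2 * k + 2 < m"
    then have "has_pattern k p x" by (intro has_pattern_cong[OF pat]) auto
    with x f show False unfolding attr_iff by blast
  next
    assume "n \<le> p"
    have "has_pattern k (p - n) y"
    proof (rule has_pattern_cong[OF pat])
      fix d
      have "p + d - n = p - n + d" using \<open>n \<le> p\<close> by simp
      then show "?z (p + d) = y (p - n + d)" using \<open>n \<le> p\<close> n by simp
    qed
    with y f show False unfolding attr_iff by blast
  qed
qed

lemma mixing_attr: "topologically_mixing_on shift_map attr"
  unfolding topologically_mixing_on_def
proof (intro allI impI)
  fix U V :: "binseq set" assume U: "open U" and "U \<inter> attr \<noteq> {}" "V \<inter> attr \<noteq> {}"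
  then obtain x y where x: "x \<in> U" "x \<in> attr" and y: "y \<in> V" "y \<in> attr" by blast
  from U x obtain m where m: "\<And>z. agree m x z \<Longrightarrow> z \<in> U" unfolding open_iff_cylinder by meson
  have "(shift_map ^^ n) ` (U \<inter> attr) \<inter> (V \<inter> attr) \<noteq> {}" if n: "m + 2 \<le> n" for n
  proof -
    let ?z = "\<lambda>i. if i < m then x i else if i < n then True else y (i - n)"
    have "?z \<in> U" by (rule m) (simp add: agree_def)
    moreover have "?z \<in> attr" by (rule concatenation_in_attr[OF x(2) y(2) n])
    moreover have "(shift_map ^^ n) ?z = y" using n by (auto simp: shift_map_funpow)
    ultimately show ?thesis using y by force
  qed
  then show "\<exists>N. \<forall>n\<ge>N. (shift_map ^^ n) ` (U \<inter> attr) \<inter> (V \<inter> attr) \<noteq> {}" by blast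
qed

text \<open>Zeros are allowed at multiples of 3 only. They are never adjacent, while every pattern
  starts with two adjacent zeros, so \<open>S\<close> is free and supplies one bit per three
  positions.\<close>

definition sparse_point :: "nat set \<Rightarrow> binseq" where
  "sparse_point S i \<longleftrightarrow> \<not> (3 dvd i \<and> i div 3 \<in> S)"

lemma sparse_point_in_attr: "sparse_point S \<in> attr"
  unfolding attr_iff
proof (intro allI impI notI)
  fix s k p assume "has_pattern k p (sparse_point S)"
  then have "\<not> sparse_point S p" "\<not> sparse_point S (p + 1)"
    unfolding has_pattern_def by (auto dest: spec[of _ 0])
  then have "3 dvd p" "3 dvd p + 1" by (auto simp: sparse_point_def)
  then show False by presburger
qed

lemma inj_sparse_point: "inj sparse_point"
proof (rule injI)
  fix S S' assume eq: "sparse_point S = sparse_point S'"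
  have "j \<in> S \<longleftrightarrow> j \<in> S'" for j using fun_cong[OF eq, of "3 * j"] by (simp add: sparse_point_def)
  then show "S = S'" by blast
qed

lemma entropy_attr: "0 < topological_entropy shift_map attr"
proof -
  define h where "h \<epsilon> n = (SUP E\<in>{E. E \<subseteq> attr \<and> finite E \<and> separated shift_map n \<epsilon> E}. ereal (ln (real (card E)) / real n))"
    for \<epsilon> n
  have "ereal (ln 2 / 3) \<le> h (1/2) n" if n: "0 < n" for n
  proof -
    \<comment> \<open>The number of multiples of 3 below \<open>n\<close>.\<close>
    let ?K = "(n + 2) div 3"
    let ?E = "sparse_point ` Pow {..<?K}"
    have "separated shift_map n (1/2) ?E"
      unfolding separated_def
    proof (intro ballI impI)
      fix x y assume xy: "x \<in> ?E" "y \<in> ?E" "x \<noteq> y"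
      then obtain S S' where S: "S \<subseteq> {..<?K}" "S' \<subseteq> {..<?K}" "x = sparse_point S" "y = sparse_point S'" "S \<noteq> S'"
        by auto
      then obtain j where j: "j < ?K" "j \<in> S \<longleftrightarrow> j \<notin> S'" by blast
      let ?x = "(shift_map ^^ (3 * j)) x" and ?y = "(shift_map ^^ (3 * j)) y"
      have "?x 0 \<noteq> ?y 0" using j S by (simp add: shift_map_funpow sparse_point_def)
      then have "(LEAST i. ?x i \<noteq> ?y i) = 0" "?x \<noteq> ?y" by (auto intro: Least_equality)
      then have "seq_dist ?x ?y = 1" by (simp add: seq_dist_def)
      moreover have "3 * j < n" using j by linarith
      ultimately show "\<exists>i<n. 1/2 < seq_dist ((shift_map ^^ i) x) ((shift_map ^^ i) y)"
        by (intro exI[of _ "3 * j"]) simp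
    qed
    then have "ereal (ln (real (card ?E)) / real n) \<le> h (1/2) n"
      unfolding h_def using sparse_point_in_attr by (intro SUP_upper) auto
    moreover have "card ?E = 2 ^ ?K"
      using inj_sparse_point by (simp add: card_image inj_on_subset card_Pow)
    moreover have "ln 2 / 3 \<le> ln (real (2 ^ ?K)) / real n"
    proof -
      have "real n \<le> 3 * real ?K" by linarith
      then have "real n * ln 2 \<le> 3 * real ?K * ln 2" by (intro mult_right_mono) auto
      then show ?thesis using n by (simp add: ln_realpow field_simps)
    qed
    ultimately show ?thesis by (metis ereal_less_eq(3) order_trans)
  qed
  then have "\<forall>\<^sub>F n in sequentially. ereal (ln 2 / 3) \<le> h (1/2) n"
    by (intro eventually_mono[OF eventually_gt_at_top[of 0]]) simp
  then have "ereal (ln 2 / 3) \<le> limsup (h (1/2))"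
    by (intro le_Limsup) auto
  also have "\<dots> \<le> topological_entropy shift_map attr"
    unfolding topological_entropy_def h_def by (rule SUP_upper) simp
  finally have "ereal (ln 2 / 3) \<le> topological_entropy shift_map attr" .
  moreover have "0 < ereal (ln 2 / 3)" by simp
  ultimately show ?thesis by (rule less_le_trans[rotated])
qed

section \<open>Limit sets and attractors\<close>

lemma attr_map_attr: "x \<in> attr \<Longrightarrow> attr_map x \<in> attr"
  by (simp add: attr_map_def shift_map_attr)

lemma orbit_in_attr: "x \<in> attr \<Longrightarrow> (attr_map ^^ n) x \<in> attr"
  by (induction n) (auto intro: attr_map_attr)

text \<open>Outside \<open>attr\<close> the clock tends to infinity along the orbit, so every prefix
  of a limit point is valid.\<close>

lemma omega_limit_subset: "omega_limit attr_map x \<subseteq> attr"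
proof
  fix y assume y: "y \<in> omega_limit attr_map x"
  show "y \<in> attr"
  proof (cases "x \<in> attr")
    case True
    show ?thesis
    proof (rule ccontr)
      assume "y \<notin> attr"
      then have "\<exists>\<^sub>\<infinity>n. (attr_map ^^ n) x \<in> - attr"
        using y closed_attr unfolding omega_limit_def by (auto simp: open_Compl)
      then show False using orbit_in_attr[OF True] by simp
    qed
  next
    case False
    have "valid m y" for m
    proof -
      obtain J where J: "m \<le> clock ((attr_map ^^ J) x)" using clock_unbounded False by blast
      have "\<exists>\<^sub>\<infinity>n. agree m y ((attr_map ^^ n) x)"
        using y open_cylinder[of m y] unfolding omega_limit_def by (auto simp: agree_refl)
      then obtain n where n: "J \<le> n" "agree m y ((attr_map ^^ n) x)"
        unfolding INFM_nat_le by blast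
      have "m \<le> clock ((attr_map ^^ n) x)"
        using J clock_orbit_mono[OF False, of J "n - J"] n(1) by simp
      then have "valid m ((attr_map ^^ n) x)"
        using valid_iff_le_clock orbit_not_in_attr[OF False] by blast
      then show ?thesis using valid_cong[OF n(2)] by simp
    qed
    then show ?thesis by (simp add: attr_def)
  qed
qed

text \<open>A cylinder around a point of \<open>attr\<close> has positive \<open>phys\<close>
  measure and, its indicator being continuous, positive visiting frequency; finitely many visits
  would give frequency 0. This equality is what makes \<open>attr\<close> minimal, topologically and
  metrically.\<close>

lemma omega_limit_eq:
  assumes x: "x \<notin> attr"
  shows "omega_limit attr_map x = attr"
proof (rule antisym[OF omega_limit_subset], rule subsetI)
  fix y assume y: "y \<in> attr"
  show "y \<in> omega_limit attr_map x"
    unfolding omega_limit_def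
  proof (intro CollectI allI impI)
    fix U assume U: "open U" "y \<in> U"
    then obtain m where m: "\<And>z. agree m y z \<Longrightarrow> z \<in> U" unfolding open_iff_cylinder by meson
    define C where "C = {z. agree m y z}"
    interpret phys: prob_space phys by (rule prob_space_phys)
    have C: "C \<in> sets borel" "0 < emeasure phys C"
      using open_cylinder[of m y] y supp_phys agree_refl[of m y] unfolding C_def supp_def by auto
    have cont: "continuous_on UNIV (indicator C :: binseq \<Rightarrow> real)"
    proof (rule continuous_onI_agree)
      fix x show "\<exists>m. \<forall>y. agree m x y \<longrightarrow> indicator C y = (indicator C x :: real)"
        by (intro exI[of _ m]) (auto simp: C_def agree_def indicator_def)
    qed
    have pos: "0 < integral\<^sup>L phys (indicator C :: binseq \<Rightarrow> real)"
      using C by (simp add: phys.emeasure_eq_measure)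
    show "\<exists>\<^sub>\<infinity>n. (attr_map ^^ n) x \<in> U"
    proof (rule ccontr)
      assume "\<not> (\<exists>\<^sub>\<infinity>n. (attr_map ^^ n) x \<in> U)"
      then obtain K where "\<And>n. K \<le> n \<Longrightarrow> (attr_map ^^ n) x \<notin> U"
        unfolding INFM_nat_le by blast
      then have K: "\<And>n. K \<le> n \<Longrightarrow> (attr_map ^^ n) x \<notin> C" using m unfolding C_def by blast
      have "(\<Sum>n<R. indicator C ((attr_map ^^ n) x)) / real R \<le> real K / real R" for R
      proof (rule divide_right_mono)
        have "(\<Sum>n<R. indicator C ((attr_map ^^ n) x) :: real) \<le> (\<Sum>n<R. if n \<in> {..<K} then 1 else 0)"
        proof (rule sum_mono)
          fix n show "indicator C ((attr_map ^^ n) x) \<le> (if n \<in> {..<K} then 1 else 0 :: real)"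
            using K[of n] by (cases "n < K") (auto simp: indicator_def)
        qed
        also have "\<dots> = (\<Sum>n\<in>{..<R} \<inter> {..<K}. 1)" by (rule sum.inter_restrict[symmetric]) simp
        also have "\<dots> \<le> real K" using card_mono[of "{..<K}" "{..<R} \<inter> {..<K}"] by simp
        finally show "(\<Sum>n<R. indicator C ((attr_map ^^ n) x)) \<le> real K" .
      qed simp
      then have "integral\<^sup>L phys (indicator C :: binseq \<Rightarrow> real) \<le> 0"
        using orbit_average[OF x cont] const_ratio[of "real K"] by (intro LIMSEQ_le) auto
      with pos show False by simp
    qed
  qed
qed

lemma realm_attr: "realm attr_map attr = UNIV"
  using omega_limit_subset by (auto simp: realm_def)

lemma realm_proper: "A' \<subset> attr \<Longrightarrow> realm attr_map A' \<subseteq> attr"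
  unfolding realm_def using omega_limit_eq by blast

lemma shift_preimage_in_attr:
  assumes "x \<in> attr"
  shows "\<exists>y\<in>attr. attr_map y = x"
proof -
  let ?y = "\<lambda>i. i = 0 \<or> x (i - 1)"
  have "?y \<in> attr"
    unfolding attr_iff
  proof (intro allI impI notI)
    fix s k p assume f: "forbidden s k" and pat: "has_pattern k p ?y"
    then have "p \<noteq> 0" by (auto simp: has_pattern_def)
    then have "has_pattern k (p - 1) x" by (intro has_pattern_cong[OF pat]) auto
    with f assms show False unfolding attr_iff by blast
  qed
  moreover from this have "attr_map ?y = x" by (auto simp: attr_map_def shift_map_def)
  ultimately show ?thesis by blast
qed

text \<open>The neighbourhood is the whole space. Points of \<open>attr\<close> have backward orbits
  in \<open>attr\<close>, obtained by prepending ones. A point outside has a finite clock, while by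
  \<open>clock_unbounded\<close> all points outside \<open>attr\<close> in a sufficiently late image
  have a larger one.\<close>

lemma strongly_attracting_attr: "strongly_attracting attr_map attr"
proof -
  have "attr = (\<Inter>n. range (attr_map ^^ n))"
  proof (intro equalityI subsetI)
    fix x assume x: "x \<in> attr"
    have "\<exists>y\<in>attr. (attr_map ^^ n) y = x" for n
    proof (induction n)
      case (Suc n)
      then obtain y where y: "y \<in> attr" "(attr_map ^^ n) y = x" by blast
      from shift_preimage_in_attr[OF y(1)] obtain z where "z \<in> attr" "attr_map z = y" by blast
      with y(2) show ?case by (intro bexI[of _ z]) (simp_all add: funpow_swap1)
    qed (use x in simp)
    then show "x \<in> (\<Inter>n. range (attr_map ^^ n))" by (metis INT_I rangeI)
  next
    fix x assume x: "x \<in> (\<Inter>n. range (attr_map ^^ n))"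
    show "x \<in> attr"
    proof (rule ccontr)
      assume "x \<notin> attr"
      obtain J where J: "\<And>z. z \<notin> attr \<Longrightarrow> Suc (clock x) \<le> clock ((attr_map ^^ J) z)"
        using clock_unbounded by blast
      from x obtain z where z: "x = (attr_map ^^ J) z" by blast
      with \<open>x \<notin> attr\<close> have "z \<notin> attr" using orbit_in_attr by blast
      from J[OF this] z show False by simp
    qed
  qed
  then show ?thesis unfolding strongly_attracting_def by (intro exI[of _ UNIV]) auto
qed

lemma dense_Compl_attr: "closure (- attr) = UNIV"
proof -
  have *: "U \<inter> - attr \<noteq> {}" if U: "open U" "x \<in> U" for U x
  proof -
    from U obtain m where m: "\<And>y. agree m x y \<Longrightarrow> y \<in> U" unfolding open_iff_cylinder by meson
    let ?y = "\<lambda>i. i < m \<and> x i"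
    have "?y \<in> U" by (rule m) (simp add: agree_def)
    moreover have "?y \<notin> attr"
    proof
      assume "?y \<in> attr"
      moreover have "forbidden 0 0" by (simp add: forbidden_def)
      moreover have "has_pattern 0 m ?y" by (simp add: has_pattern_def)
      ultimately show False unfolding attr_iff by blast
    qed
    ultimately show ?thesis by blast
  qed
  have "interior attr = {}"
    using *[OF open_interior, of _ attr] interior_subset[of attr] by blast
  then show ?thesis by (simp add: closure_complement)
qed

lemma generic_meets_Compl_attr:
  assumes "generic S" shows "\<exists>x\<in>S. x \<notin> attr"
proof -
  from assms obtain \<G> where G: "countable \<G>" "\<forall>U\<in>\<G>. open U \<and> closure U = UNIV" "\<Inter>\<G> \<subseteq> S"
    unfolding generic_def by blast
  have "closure (\<Inter>(insert (- attr) \<G>)) = UNIV"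
    using G closed_attr dense_Compl_attr by (intro Baire_binseq) (auto simp: open_Compl)
  then have "\<Inter>(insert (- attr) \<G>) \<noteq> {}" by (metis closure_empty UNIV_not_empty)
  with G(3) show ?thesis by blast
qed

text \<open>Any candidate has a generic realm, which by Baire contains a point outside
  \<open>attr\<close>; so the candidate contains the limit set \<open>attr\<close> of that point,
  and minimality forces equality.\<close>

lemma topological_attractor_iff: "topological_attractor attr_map A' \<longleftrightarrow> A' = attr"
proof
  assume A': "topological_attractor attr_map A'"
  then have "generic (realm attr_map A')" by (simp add: topological_attractor_def)
  from generic_meets_Compl_attr[OF this] obtain x where "x \<in> realm attr_map A'" "x \<notin> attr" by blast
  then have "attr \<subseteq> A'" using omega_limit_eq[of x] by (simp add: realm_def)
  moreover have "\<not> meager (realm attr_map attr)"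
    using generic_meets_Compl_attr by (auto simp: meager_def realm_attr)
  ultimately show "A' = attr"
    using A' closed_attr unfolding topological_attractor_def by blast
next
  assume "A' = attr"
  have "generic (realm attr_map attr)"
    unfolding generic_def realm_attr by (intro exI[of _ "{}"]) simp
  moreover have "meager (realm attr_map B)" if "B \<subset> attr" for B
    unfolding meager_def generic_def using realm_proper[OF that] closed_attr dense_Compl_attr
    by (intro exI[of _ "{- attr}"]) (auto simp: open_Compl)
  ultimately show "topological_attractor attr_map A'"
    using closed_attr \<open>A' = attr\<close> unfolding topological_attractor_def by blast
qed

section \<open>Ergodic reference measures of full support\<close>

context
  fixes lam :: "binseq measure"
  assumes ergodic: "shift_ergodic lam" and full: "supp lam = UNIV"
begin

text \<open>The preimages of \<open>attr\<close> increase because \<open>attr\<close> is forward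
  invariant, and all have the same measure. Their union equals its own preimage, so it has measure 0
  or 1, and the measure of \<open>attr\<close> is the same number; 1 is excluded since the
  complement is open and nonempty.\<close>

lemma AE_not_in_attr: "AE x in lam. x \<notin> attr"
proof -
  have lam: "prob_space lam" "sets lam = sets borel" "shift_map \<in> borel_measurable borel" "distr lam borel shift_map = lam"
    using ergodic by (auto simp: shift_ergodic_def invariant_measure_def borel_prob_def)
  interpret prob_space lam by (rule lam)
  have attr_sets: "attr \<in> sets lam" unfolding lam(2) using closed_attr by simp
  define B where "B n = {x. (shift_map ^^ n) x \<in> attr}" for n
  have B_Suc: "B (Suc n) = shift_map -` B n" for n by (auto simp: B_def funpow_swap1)
  have sp: "space lam = UNIV" using lam(2) sets_eq_imp_space_eq by fastforce
  have B_sets: "B n \<in> sets borel" for n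
  proof (induction n)
    case 0 then show ?case using closed_attr by (simp add: B_def)
  next
    case (Suc n) then show ?case using measurable_sets[OF lam(3)] unfolding B_Suc by force
  qed
  have B_measure: "measure lam (B n) = measure lam attr" for n
  proof (induction n)
    case (Suc n)
    have "measure (distr lam borel shift_map) (B n) = measure lam (shift_map -` B n \<inter> space lam)"
      using lam(2,3) B_sets by (intro measure_distr) (auto simp: measurable_def sp)
    then show ?case using Suc lam(4) by (simp add: B_Suc sp)
  qed (simp add: B_def)
  have "incseq B"
    by (rule incseq_SucI) (auto simp: B_def intro: shift_map_attr)
  then have "(\<lambda>n. measure lam (B n)) \<longlonglongrightarrow> measure lam (\<Union>n. B n)"
    using B_sets lam(2) by (intro finite_Lim_measure_incseq) auto
  then have eq: "measure lam (\<Union>n. B n) = measure lam attr"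
    unfolding B_measure by (rule LIMSEQ_unique[OF _ tendsto_const, symmetric, THEN sym])
  have "shift_map -` (\<Union>n. B n) = (\<Union>n. B n)"
  proof -
    have "shift_map -` (\<Union>n. B n) = (\<Union>n. B (Suc n))" by (auto simp: B_Suc)
    also have "\<dots> = (\<Union>n. B n)"
      using \<open>incseq B\<close> by (auto simp: incseq_Suc_iff)
    finally show ?thesis .
  qed
  moreover have "(\<Union>n. B n) \<in> sets borel" using B_sets by (intro sets.countable_UN) auto
  moreover have "\<forall>S\<in>sets borel. shift_map -` S = S \<longrightarrow> measure lam S = 0 \<or> measure lam S = 1"
    using ergodic by (simp add: shift_ergodic_def)
  ultimately have "measure lam attr = 0 \<or> measure lam attr = 1"
    unfolding eq[symmetric] by (metis (no_types))
  moreover have "measure lam attr \<noteq> 1"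
  proof
    assume "measure lam attr = 1"
    then have "measure lam (- attr) = 0"
      using prob_compl[OF attr_sets] by (simp add: sp Compl_eq_Diff_UNIV)
    then have null: "emeasure lam (- attr) = 0" by (simp add: emeasure_eq_measure)
    obtain x where "x \<in> - attr"
      using dense_Compl_attr by (metis closure_empty UNIV_not_empty ex_in_conv)
    moreover have "x \<in> supp lam" by (simp add: full)
    ultimately have "0 < emeasure lam (- attr)"
      using closed_attr unfolding supp_def by (simp add: open_Compl)
    with null show False by simp
  qed
  ultimately have "emeasure lam attr = 0" by (simp add: emeasure_eq_measure)
  then show ?thesis using attr_sets by (intro AE_not_in) auto
qed

lemma AE_meets_Compl_attr:
  assumes "AE x in lam. P x" shows "\<exists>x. P x \<and> x \<notin> attr"
proof (rule ccontr)
  assume *: "\<not> ?thesis"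
  interpret prob_space lam
    using ergodic by (auto simp: shift_ergodic_def invariant_measure_def borel_prob_def)
  from assms AE_not_in_attr have "AE x in lam. False" by eventually_elim (use * in blast)
  then show False by simp
qed

lemma metric_attractor_iff: "metric_attractor attr_map lam A' \<longleftrightarrow> A' = attr"
proof
  assume A': "metric_attractor attr_map lam A'"
  then have "AE x in lam. x \<in> realm attr_map A'" by (simp add: metric_attractor_def)
  from AE_meets_Compl_attr[OF this] obtain x where "x \<in> realm attr_map A'" "x \<notin> attr" by blast
  then have "attr \<subseteq> A'" using omega_limit_eq[of x] by (simp add: realm_def)
  moreover have "\<not> (AE x in lam. x \<notin> realm attr_map attr)"
    using AE_meets_Compl_attr[of "\<lambda>_. False"] by (auto simp: realm_attr)
  ultimately show "A' = attr"
    using A' closed_attr unfolding metric_attractor_def by blast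
next
  assume "A' = attr"
  have "AE x in lam. x \<notin> realm attr_map B" if "B \<subset> attr" for B
    using AE_not_in_attr by eventually_elim (use realm_proper[OF that] in blast)
  then show "metric_attractor attr_map lam A'"
    using closed_attr \<open>A' = attr\<close> unfolding metric_attractor_def by (auto simp: realm_attr)
qed

lemma physical_measure_iff: "physical_measure attr_map lam A' \<nu> \<longleftrightarrow> \<nu> = phys \<and> A' = attr"
proof
  assume \<nu>: "physical_measure attr_map lam A' \<nu>"
  then have "AE x in lam. weak_star_limit (empirical_measure attr_map x) \<nu>"
    by (simp add: physical_measure_def)
  from AE_meets_Compl_attr[OF this]
  obtain x where x: "weak_star_limit (empirical_measure attr_map x) \<nu>" "x \<notin> attr" by blast
  then have "\<nu> = phys"
    using \<nu> invariant_phys weak_star_limit_phys[OF x(2)]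
    by (intro weak_star_limit_unique) (auto simp: physical_measure_def invariant_measure_def)
  then show "\<nu> = phys \<and> A' = attr" using \<nu> supp_phys by (auto simp: physical_measure_def)
next
  assume "\<nu> = phys \<and> A' = attr"
  moreover have "AE x in lam. weak_star_limit (empirical_measure attr_map x) phys"
    using AE_not_in_attr by eventually_elim (rule weak_star_limit_phys)
  ultimately show "physical_measure attr_map lam A' \<nu>"
    using invariant_phys supp_phys by (simp add: physical_measure_def)
qed

lemma statistical_attractor_iff: "statistical_attractor attr_map lam A' \<longleftrightarrow> A' = attr"
  unfolding statistical_attractor_def physical_measure_iff using closed_attr by auto

end

text \<open>The equivalences express that the attractors and the physical measure are unique; a
  single measure serves all admissible reference measures.\<close>

theorem theorem2:
  shows "\<exists>(T :: binseq \<Rightarrow> binseq) (A :: binseq set).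
    computable_map T \<and> closed A \<and> T ` A \<subseteq> A \<and>
    Pi_complete 1 A \<and>
    (\<forall>A'. topological_attractor T A' \<longleftrightarrow> A' = A) \<and>
    (\<forall>lam. shift_ergodic lam \<and> supp lam = UNIV \<longrightarrow>
       (\<forall>A'. metric_attractor T lam A' \<longleftrightarrow> A' = A)) \<and>
    subshift A \<and> (\<forall>x\<in>A. T x = shift_map x) \<and>
    topologically_mixing_on shift_map A \<and> topological_entropy shift_map A > 0 \<and>
    strongly_attracting T A \<and> realm T A = UNIV \<and>
    (\<forall>lam. shift_ergodic lam \<and> supp lam = UNIV \<longrightarrow>
       (\<forall>A'. statistical_attractor T lam A' \<longleftrightarrow> A' = A)) \<and>
    (\<exists>\<mu>. (\<forall>lam. shift_ergodic lam \<and> supp lam = UNIV \<longrightarrow>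
              (\<forall>\<nu>. physical_measure T lam A \<nu> \<longleftrightarrow> \<nu> = \<mu>)) \<and>
      \<not> computable_measure \<mu>)"
proof (intro exI[of _ attr_map] exI[of _ attr] conjI)
  show "subshift attr"
    using closed_attr shift_map_attr by (auto simp: subshift_def)
  show "\<exists>\<mu>. (\<forall>lam. shift_ergodic lam \<and> supp lam = UNIV \<longrightarrow>
              (\<forall>\<nu>. physical_measure attr_map lam attr \<nu> \<longleftrightarrow> \<nu> = \<mu>)) \<and>
      \<not> computable_measure \<mu>"
    using not_computable_measure_supp_attr[OF prob_space_phys sets_phys supp_phys] physical_measure_iff
    by (intro exI[of _ phys]) auto
qed (use computable_attr_map closed_attr attr_map_attr Pi_complete_attr topological_attractor_iff
    metric_attractor_iff mixing_attr entropy_attr strongly_attracting_attr realm_attr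
    statistical_attractor_iff in \<open>auto simp: attr_map_def\<close>)

end
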